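(* Let $\mathbb{X},\mathbb{Y},\mathbb{A}$ be Borel subsets of Polish spaces. Suppose that the stochastic kernel $P(dx'|x,a)$ on $\mathbb{X}$ given $\mathbb{X}\times\mathbb{A}$ is weakly continuous and the stochastic kernel $Q(dy|a,x)$ on $\mathbb{Y}$ given $\mathbb{A}\times\mathbb{X}$ is continuous in the total variation. Then the stochastic kernel $R'(dy|z,a)$ on $\mathbb{Y}$ given $\mathbb{P}(\mathbb{X})\times\mathbb{A}$ is setwise continuous and Assumption (H) holds, and therefore the stochastic kernel $q(dz'|z,a)$ on $\mathbb{P}(\mathbb{X})$ given $\mathbb{P}(\mathbb{X})\times\mathbb{A}$ is weakly continuous.
   Context: For a metric space $\mathbb{S}$, $\mathcal{B}(\mathbb{S})$ is its Borel $\sigma$-field and $\mathbb{P}(\mathbb{S})$ is the set of probability measures on $(\mathbb{S},\mathcal{B}(\mathbb{S}))$ with the topology of weak convergence. Measures $\mu^{(n)}$ converge weakly (setwise) to $\mu$ if $\int f\,d\mu^{(n)}\to\int f\,d\mu$ for every bounded continuous (bounded Borel) $f$, and in the total variation if $\sup\{\int f\,d\mu^{(n)}-\int f\,d\mu: f:\mathbb{S}\to[-1,1]\text{ Borel}\}\to0$. A stochastic kernel $T(ds_1|s_2)$ on $\mathbb{S}_1$ given $\mathbb{S}_2$ satisfies $T(\cdot|s_2)\in\mathbb{P}(\mathbb{S}_1)$ for each $s_2$ and $T(B|\cdot)$ Borel for each $B\in\mathcal{B}(\mathbb{S}_1)$; it is weakly continuous (setwise continuous, continuous in the total variation) if $s_2^{(n)}\to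 s_2$ implies $T(\cdot|s_2^{(n)})\to T(\cdot|s_2)$ weakly (setwise, in the total variation). For $z\in\mathbb{P}(\mathbb{X})$, $a\in\mathbb{A}$, $B\in\mathcal{B}(\mathbb{X})$, $C\in\mathcal{B}(\mathbb{Y})$ let $R(B\times C|z,a)=\int_{\mathbb{X}}\int_B Q(C|a,x')P(dx'|x,a)z(dx)$ (a stochastic kernel on $\mathbb{X}\times\mathbb{Y}$ given $\mathbb{P}(\mathbb{X})\times\mathbb{A}$) and $R'(C|z,a)=R(\mathbb{X}\times C|z,a)$. There exists a stochastic kernel $H(dx|z,a,y)$ on $\mathbb{X}$ given $\mathbb{P}(\mathbb{X})\times\mathbb{A}\times\mathbb{Y}$ satisfying the filtering equation (F) $R(B\times C|z,a)=\int_C H(B|z,a,y)R'(dy|z,a)$ for all $B,C,z,a$. Write $H(z,a,y)=H(\cdot|z,a,y)\in\mathbb{P}(\mathbb{X})$. Define $q(D|z,a)=\int_{\mathbb{Y}}\mathbf{1}\{H(z,a,y)\in D\}R'(dy|z,a)$ for $D\in\mathcal{B}(\mathbb{P}(\mathbb{X}))$; this does not depend on the choice of $H$ satisfying (F). Assumption (H): there exists a stochastic kernel $H$ on $\mathbb{X}$ given $\mathbb{P}(\mathbb{X})\times\mathbb{A}\times\mathbb{Y}$ satisfying (F) such that, if $z^{(n)}\to z$ weakly in $\mathbb{P}(\mathbb{X})$ and $a^{(n)}\to a$ in $\mathbb{A}$, then there exist a subsequence $\{(z^{(n_k)},a^{(n_k)})\}_{k}$ and a measurable set $C\subseteq\mathbb{Y}$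 with $R'(C|z,a)=1$ such that $H(z^{(n_k)},a^{(n_k)},y)\to H(z,a,y)$ weakly for all $y\in C$. *)

theory Defs
  imports "HOL-Probability.Probability"
begin

section \<open>Probability measures on a topological space\<close>

text \<open>
  Every space is given as a topology, so that Borel subsets of Polish spaces
  (\<open>top_of_set X\<close>), spaces of probability measures and products of these are treated alike.
\<close>

definition borel_of :: "'s topology \<Rightarrow> 's measure" where
  "borel_of S = sigma (topspace S) {U. openin S U}"

definition prob_measures :: "'s topology \<Rightarrow> 's measure set" where
  "prob_measures S = {\<mu>. prob_space \<mu> \<and> sets \<mu> = sets (borel_of S)}"

definition bounded_continuous :: "'s topology \<Rightarrow> ('s \<Rightarrow> real) set" where
  "bounded_continuous S = {f. continuous_map S euclideanreal f \<and> bounded (f ` topspace S)}"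

definition bounded_Borel :: "'s topology \<Rightarrow> ('s \<Rightarrow> real) set" where
  "bounded_Borel S = {f \<in> borel_measurable (borel_of S). bounded (f ` topspace S)}"

definition weakly_converges :: "'s topology \<Rightarrow> (nat \<Rightarrow> 's measure) \<Rightarrow> 's measure \<Rightarrow> bool" where
  "weakly_converges S \<mu> \<nu> \<longleftrightarrow>
     (\<forall>f\<in>bounded_continuous S. (\<lambda>n. integral\<^sup>L (\<mu> n) f) \<longlonglongrightarrow> integral\<^sup>L \<nu> f)"

definition setwise_converges :: "'s topology \<Rightarrow> (nat \<Rightarrow> 's measure) \<Rightarrow> 's measure \<Rightarrow> bool" where
  "setwise_converges S \<mu> \<nu> \<longleftrightarrow>
     (\<forall>f\<in>bounded_Borel S. (\<lambda>n. integral\<^sup>L (\<mu> n) f) \<longlonglongrightarrow> integral\<^sup>L \<nu> f)"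

definition tv_converges :: "'s topology \<Rightarrow> (nat \<Rightarrow> 's measure) \<Rightarrow> 's measure \<Rightarrow> bool" where
  "tv_converges S \<mu> \<nu> \<longleftrightarrow>
     (\<lambda>n. SUP f\<in>{f :: 's \<Rightarrow> real. f \<in> borel_measurable (borel_of S) \<and> (\<forall>s\<in>topspace S. f s \<in> {-1..1})}.
            integral\<^sup>L (\<mu> n) f - integral\<^sup>L \<nu> f) \<longlonglongrightarrow> 0"

text \<open>
  The topology of weak convergence: the coarsest topology on the probability measures that
  makes integration of each bounded continuous function continuous.
\<close>

definition weak_topology :: "'s topology \<Rightarrow> 's measure topology" where
  "weak_topology S = topology_generated_by
     {{\<mu> \<in> prob_measures S. integral\<^sup>L \<mu> f \<in> U} | f U. f \<in> bounded_continuous S \<and> open U}"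

section \<open>Stochastic kernels\<close>

text \<open>
  In \<open>stochastic_kernel S1 S2 T\<close>, \<open>T\<close> is a kernel on \<open>S1\<close> given \<open>S2\<close>.  The values of \<open>T\<close> outside
  of \<open>topspace S2\<close> are irrelevant.
\<close>

definition stochastic_kernel :: "'s topology \<Rightarrow> 't topology \<Rightarrow> ('t \<Rightarrow> 's measure) \<Rightarrow> bool" where
  "stochastic_kernel S1 S2 T \<longleftrightarrow>
     (\<forall>s\<in>topspace S2. T s \<in> prob_measures S1) \<and>
     (\<forall>B\<in>sets (borel_of S1). (\<lambda>s. measure (T s) B) \<in> borel_measurable (borel_of S2))"

definition kernel_continuous ::
  "((nat \<Rightarrow> 's measure) \<Rightarrow> 's measure \<Rightarrow> bool) \<Rightarrow> 't topology \<Rightarrow> ('t \<Rightarrow> 's measure) \<Rightarrow> bool" where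
  "kernel_continuous converges S2 T \<longleftrightarrow>
     (\<forall>s l. (\<forall>n. s n \<in> topspace S2) \<and> limitin S2 s l sequentially \<longrightarrow> converges (\<lambda>n. T (s n)) (T l))"

definition weakly_continuous_kernel :: "'s topology \<Rightarrow> 't topology \<Rightarrow> ('t \<Rightarrow> 's measure) \<Rightarrow> bool" where
  "weakly_continuous_kernel S1 S2 T \<longleftrightarrow>
     stochastic_kernel S1 S2 T \<and> kernel_continuous (weakly_converges S1) S2 T"

definition setwise_continuous_kernel :: "'s topology \<Rightarrow> 't topology \<Rightarrow> ('t \<Rightarrow> 's measure) \<Rightarrow> bool" where
  "setwise_continuous_kernel S1 S2 T \<longleftrightarrow>
     stochastic_kernel S1 S2 T \<and> kernel_continuous (setwise_converges S1) S2 T"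

definition tv_continuous_kernel :: "'s topology \<Rightarrow> 't topology \<Rightarrow> ('t \<Rightarrow> 's measure) \<Rightarrow> bool" where
  "tv_continuous_kernel S1 S2 T \<longleftrightarrow>
     stochastic_kernel S1 S2 T \<and> kernel_continuous (tv_converges S1) S2 T"

section \<open>Filtering\<close>

text \<open>
  The kernel \<open>R\<close> is defined on all Borel sets \<open>E\<close> of the product space by
  \<open>R(E|z,a) = \<integral>\<integral> Q({y. (x',y) \<in> E}|a,x') P(dx'|x,a) z(dx)\<close>; on rectangles \<open>E = B \<times> C\<close> the
  integrand is \<open>Q(C|a,x')\<close> for \<open>x' \<in> B\<close> and 0 otherwise, see \<open>emeasure_R_kernel_Times\<close> below.
\<close>

definition R_kernel ::
  "'x topology \<Rightarrow> 'y topology \<Rightarrow> ('x \<times> 'a \<Rightarrow> 'x measure) \<Rightarrow> ('a \<times> 'x \<Rightarrow> 'y measure)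
     \<Rightarrow> 'x measure \<times> 'a \<Rightarrow> ('x \<times> 'y) measure" where
  "R_kernel X Y P Q = (\<lambda>(z, a).
     measure_of (topspace X \<times> topspace Y) (sets (borel_of (prod_topology X Y)))
       (\<lambda>E. \<integral>\<^sup>+x. (\<integral>\<^sup>+x'. emeasure (Q (a, x')) {y. (x', y) \<in> E} \<partial>P (x, a)) \<partial>z))"

definition R'_kernel ::
  "'x topology \<Rightarrow> 'y topology \<Rightarrow> ('x \<times> 'a \<Rightarrow> 'x measure) \<Rightarrow> ('a \<times> 'x \<Rightarrow> 'y measure)
     \<Rightarrow> 'x measure \<times> 'a \<Rightarrow> 'y measure" where
  "R'_kernel X Y P Q = (\<lambda>(z, a). distr (R_kernel X Y P Q (z, a)) (borel_of Y) snd)"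

text \<open>\<open>H\<close> is a stochastic kernel that satisfies the filtering equation (F).\<close>

definition filter_kernel ::
  "'x topology \<Rightarrow> 'y topology \<Rightarrow> 'a topology \<Rightarrow> ('x \<times> 'a \<Rightarrow> 'x measure) \<Rightarrow> ('a \<times> 'x \<Rightarrow> 'y measure)
     \<Rightarrow> ('x measure \<times> 'a \<times> 'y \<Rightarrow> 'x measure) \<Rightarrow> bool" where
  "filter_kernel X Y A P Q H \<longleftrightarrow>
     stochastic_kernel X (prod_topology (weak_topology X) (prod_topology A Y)) H \<and>
     (\<forall>B\<in>sets (borel_of X). \<forall>C\<in>sets (borel_of Y). \<forall>z\<in>prob_measures X. \<forall>a\<in>topspace A.
        emeasure (R_kernel X Y P Q (z, a)) (B \<times> C) =
        (\<integral>\<^sup>+y\<in>C. emeasure (H (z, a, y)) B \<partial>R'_kernel X Y P Q (z, a)))"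

definition assumption_H ::
  "'x topology \<Rightarrow> 'y topology \<Rightarrow> 'a topology \<Rightarrow> ('x \<times> 'a \<Rightarrow> 'x measure) \<Rightarrow> ('a \<times> 'x \<Rightarrow> 'y measure)
     \<Rightarrow> bool" where
  "assumption_H X Y A P Q \<longleftrightarrow>
     (\<exists>H. filter_kernel X Y A P Q H \<and>
       (\<forall>zn z an a.
          (\<forall>n. zn n \<in> prob_measures X) \<and> z \<in> prob_measures X \<and> weakly_converges X zn z \<and>
          (\<forall>n. an n \<in> topspace A) \<and> limitin A an a sequentially \<longrightarrow>
          (\<exists>r C. strict_mono (r :: nat \<Rightarrow> nat) \<and> C \<in> sets (borel_of Y) \<and>
             measure (R'_kernel X Y P Q (z, a)) C = 1 \<and>
             (\<forall>y\<in>C. weakly_converges X (\<lambda>k. H (zn (r k), an (r k), y)) (H (z, a, y))))))"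

text \<open>
  \<open>q(\<sqdot>|z,a)\<close> is the image of \<open>R'(\<sqdot>|z,a)\<close> under \<open>y \<mapsto> H(z,a,y)\<close>, where the space of probability
  measures carries the Borel sets of its weak topology.
\<close>

definition q_kernel ::
  "'x topology \<Rightarrow> 'y topology \<Rightarrow> ('x \<times> 'a \<Rightarrow> 'x measure) \<Rightarrow> ('a \<times> 'x \<Rightarrow> 'y measure)
     \<Rightarrow> ('x measure \<times> 'a \<times> 'y \<Rightarrow> 'x measure) \<Rightarrow> 'x measure \<times> 'a \<Rightarrow> 'x measure measure" where
  "q_kernel X Y P Q H = (\<lambda>(z, a).
     distr (R'_kernel X Y P Q (z, a)) (borel_of (weak_topology X)) (\<lambda>y. H (z, a, y)))"

section \<open>Agreement with the defining properties\<close>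

lemma space_borel_of [simp]: "space (borel_of S) = topspace S"
  by (auto simp: borel_of_def space_measure_of_conv)

lemma sets_borel_of: "sets (borel_of S) = sigma_sets (topspace S) {U. openin S U}"
  unfolding borel_of_def by (rule sets_measure_of) (auto dest: openin_subset)

lemma topspace_weak_topology [simp]: "topspace (weak_topology S) = prob_measures S"
proof -
  have "(\<lambda>_. 0) \<in> bounded_continuous S"
    by (auto simp: bounded_continuous_def image_constant_conv)
  then have "prob_measures S \<in> {{\<mu> \<in> prob_measures S. integral\<^sup>L \<mu> f \<in> U} | f U. f \<in> bounded_continuous S \<and> open U}"
    by (intro CollectI exI[of _ "\<lambda>_. 0"] exI[of _ UNIV]) auto
  then show ?thesis
    unfolding weak_topology_def topology_generated_by_topspace by blast
qed

lemma limitin_weak_topology: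
  assumes "\<And>n. \<mu> n \<in> prob_measures S"
  shows "limitin (weak_topology S) \<mu> \<nu> sequentially \<longleftrightarrow> \<nu> \<in> prob_measures S \<and> weakly_converges S \<mu> \<nu>"
proof safe
  assume lim: "limitin (weak_topology S) \<mu> \<nu> sequentially"
  show nu: "\<nu> \<in> prob_measures S"
    using limitin_topspace[OF lim] by simp
  show "weakly_converges S \<mu> \<nu>"
    unfolding weakly_converges_def
  proof (intro ballI topological_tendstoI)
    fix f U assume f: "f \<in> bounded_continuous S" and U: "open U" "integral\<^sup>L \<nu> f \<in> U"
    have "openin (weak_topology S) {\<mu> \<in> prob_measures S. integral\<^sup>L \<mu> f \<in> U}"
      unfolding weak_topology_def using f U by (intro topology_generated_by_Basis) blast
    from limitinD[OF lim this] nu U show "\<forall>\<^sub>F n in sequentially. integral\<^sup>L (\<mu> n) f \<in> U"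
      by (auto elim: eventually_mono)
  qed
next
  assume nu: "\<nu> \<in> prob_measures S" and conv: "weakly_converges S \<mu> \<nu>"
  show "limitin (weak_topology S) \<mu> \<nu> sequentially"
    unfolding limitin_def
  proof (intro conjI allI impI)
    show "\<nu> \<in> topspace (weak_topology S)" using nu by simp
    fix V assume V: "openin (weak_topology S) V \<and> \<nu> \<in> V"
    then have "generate_topology_on
        {{\<mu> \<in> prob_measures S. integral\<^sup>L \<mu> f \<in> U} | f U. f \<in> bounded_continuous S \<and> open U} V"
      unfolding weak_topology_def by (auto simp: openin_topology_generated_by_iff)
    then have "\<nu> \<in> V \<longrightarrow> (\<forall>\<^sub>F n in sequentially. \<mu> n \<in> V)"
    proof induction
      case Empty
      then show ?case by simp
    next
      case (Int a b)
      then show ?case by (auto intro: eventually_conj)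
    next
      case (UN K)
      show ?case
      proof
        assume "\<nu> \<in> \<Union> K"
        then obtain k where "k \<in> K" "\<nu> \<in> k" by blast
        with UN.IH have "\<forall>\<^sub>F n in sequentially. \<mu> n \<in> k" by blast
        with \<open>k \<in> K\<close> show "\<forall>\<^sub>F n in sequentially. \<mu> n \<in> \<Union> K"
          by (auto elim: eventually_mono)
      qed
    next
      case (Basis s)
      then obtain f U where s: "s = {\<mu> \<in> prob_measures S. integral\<^sup>L \<mu> f \<in> U}"
        and f: "f \<in> bounded_continuous S" and U: "open U" by blast
      have "(\<lambda>n. integral\<^sup>L (\<mu> n) f) \<longlonglongrightarrow> integral\<^sup>L \<nu> f"
        using conv f by (auto simp: weakly_converges_def)
      then show ?case
        using topological_tendstoD[OF _ U] assms by (auto simp: s)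
    qed
    with V show "\<forall>\<^sub>F n in sequentially. \<mu> n \<in> V" by blast
  qed
qed

lemma measurable_borel_of_continuous_map:
  assumes "continuous_map S T f"
  shows "f \<in> borel_of S \<rightarrow>\<^sub>M borel_of T"
proof (subst (2) borel_of_def, rule measurable_measure_of)
  show "{U. openin T U} \<subseteq> Pow (topspace T)" by (auto dest: openin_subset)
  show "f \<in> space (borel_of S) \<rightarrow> topspace T"
    using assms by (auto simp: continuous_map_def)
  fix U assume "U \<in> {U. openin T U}"
  then have "openin S {x \<in> topspace S. f x \<in> U}"
    using assms by (auto simp: continuous_map_def)
  moreover have "f -` U \<inter> space (borel_of S) = {x \<in> topspace S. f x \<in> U}" by auto
  ultimately show "f -` U \<inter> space (borel_of S) \<in> sets (borel_of S)"
    by (auto simp: sets_borel_of)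
qed

lemma sets_borel_of_top_of_set: "sets (borel_of (top_of_set S)) = sets (restrict_space borel S)"
proof
  show "sets (borel_of (top_of_set S)) \<subseteq> sets (restrict_space borel S)"
    unfolding sets_borel_of
  proof (rule sets.sigma_sets_subset')
    show "{U. openin (top_of_set S) U} \<subseteq> sets (restrict_space borel S)"
      by (auto simp: openin_open sets_restrict_space)
    show "topspace (top_of_set S) \<in> sets (restrict_space borel S)"
      by (auto simp: sets_restrict_space)
  qed
next
  have "id \<in> borel_of (top_of_set S) \<rightarrow>\<^sub>M borel"
    by (rule borel_measurableI) (auto simp: sets_borel_of openin_open Int_commute intro!: sigma_sets.Basic)
  then show "sets (restrict_space borel S) \<subseteq> sets (borel_of (top_of_set S))"
    by (auto simp: sets_restrict_space dest!: measurable_sets) (metis Int_commute)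
qed

lemma top_of_set_Times: "prod_topology (top_of_set S) (top_of_set T) = top_of_set (S \<times> T)"
  by (simp add: subtopology_Times [symmetric] euclidean_product_topology)

lemma sets_borel_of_Times:
  fixes X :: "'x::second_countable_topology set" and Y :: "'y::second_countable_topology set"
  shows "sets (borel_of (prod_topology (top_of_set X) (top_of_set Y))) =
         sets (borel_of (top_of_set X) \<Otimes>\<^sub>M borel_of (top_of_set Y))" (is "?L = ?R")
proof
  have "(\<lambda>p. (fst p, snd p)) \<in> restrict_space borel X \<Otimes>\<^sub>M restrict_space borel Y \<rightarrow>\<^sub>M (borel \<Otimes>\<^sub>M borel :: ('x \<times> 'y) measure)"
    by (intro measurable_Pair measurable_compose[OF measurable_fst] measurable_compose[OF measurable_snd]
        measurable_restrict_space1 measurable_ident_sets refl)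
  then have "(\<lambda>p. p) \<in> restrict_space borel X \<Otimes>\<^sub>M restrict_space borel Y \<rightarrow>\<^sub>M (borel :: ('x \<times> 'y) measure)"
    by (simp add: borel_prod)
  from measurable_sets[OF this]
  have "(X \<times> Y) \<inter> E \<in> sets (restrict_space borel X \<Otimes>\<^sub>M restrict_space borel Y)" if "E \<in> sets borel" for E
    using that by (auto simp: space_pair_measure space_restrict_space Int_commute)
  moreover have "sets (restrict_space borel X \<Otimes>\<^sub>M restrict_space borel Y) = ?R"
    by (intro sets_pair_measure_cong) (simp_all add: sets_borel_of_top_of_set)
  ultimately show "?L \<subseteq> ?R"
    by (auto simp: top_of_set_Times sets_borel_of_top_of_set sets_restrict_space)
next
  show "?R \<subseteq> ?L"
    unfolding sets_pair_measure
  proof (rule sets.sigma_sets_subset')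
    show "{a \<times> b |a b. a \<in> sets (borel_of (top_of_set X)) \<and> b \<in> sets (borel_of (top_of_set Y))} \<subseteq> ?L"
    proof clarify
      fix a b assume "a \<in> sets (borel_of (top_of_set X))" "b \<in> sets (borel_of (top_of_set Y))"
      then obtain a' b' where *: "a = X \<inter> a'" "b = Y \<inter> b'" "a' \<in> sets borel" "b' \<in> sets borel"
        by (auto simp: sets_borel_of_top_of_set sets_restrict_space)
      then have "a' \<times> b' \<in> sets (borel :: ('x \<times> 'y) measure)"
        by (simp add: borel_Times)
      moreover have "a \<times> b = (X \<times> Y) \<inter> (a' \<times> b')" using * by auto
      ultimately show "a \<times> b \<in> ?L"
        by (auto simp: top_of_set_Times sets_borel_of_top_of_set sets_restrict_space)
    qed
    show "space (borel_of (top_of_set X)) \<times> space (borel_of (top_of_set Y)) \<in> ?L"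
      by (metis sets.top space_borel_of topspace_prod_topology)
  qed
qed

lemma stochastic_kernel_measurable:
  assumes "stochastic_kernel S1 S2 T"
  shows "T \<in> borel_of S2 \<rightarrow>\<^sub>M subprob_algebra (borel_of S1)"
proof (rule measurable_subprob_algebra)
  fix s assume "s \<in> space (borel_of S2)"
  then have "T s \<in> prob_measures S1" using assms by (auto simp: stochastic_kernel_def)
  then show "subprob_space (T s)" "sets (T s) = sets (borel_of S1)"
    by (auto simp: prob_measures_def intro: prob_space_imp_subprob_space)
next
  fix B assume B: "B \<in> sets (borel_of S1)"
  have "(\<lambda>s. ennreal (measure (T s) B)) \<in> borel_measurable (borel_of S2)"
    using assms B by (auto simp: stochastic_kernel_def)
  moreover have "emeasure (T s) B = ennreal (measure (T s) B)" if "s \<in> space (borel_of S2)" for s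
  proof -
    interpret prob_space "T s"
      using assms that by (auto simp: stochastic_kernel_def prob_measures_def)
    show ?thesis by (rule emeasure_eq_measure)
  qed
  ultimately show "(\<lambda>s. emeasure (T s) B) \<in> borel_measurable (borel_of S2)"
    by (subst measurable_cong) auto
qed

context
  fixes X :: "'x::second_countable_topology set" and Y :: "'y::second_countable_topology set"
    and A :: "'a::topological_space set"
    and P :: "'x \<times> 'a \<Rightarrow> 'x measure" and Q :: "'a \<times> 'x \<Rightarrow> 'y measure"
    and z :: "'x measure" and a :: 'a
  assumes P: "stochastic_kernel (top_of_set X) (prod_topology (top_of_set X) (top_of_set A)) P"
    and Q: "stochastic_kernel (top_of_set Y) (prod_topology (top_of_set A) (top_of_set X)) Q"
    and z: "z \<in> prob_measures (top_of_set X)" and a: "a \<in> A"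
begin

lemma emeasure_R_kernel:
  assumes E: "E \<in> sets (borel_of (prod_topology (top_of_set X) (top_of_set Y)))"
  shows "emeasure (R_kernel (top_of_set X) (top_of_set Y) P Q (z, a)) E =
    (\<integral>\<^sup>+x. (\<integral>\<^sup>+x'. emeasure (Q (a, x')) {y. (x', y) \<in> E} \<partial>P (x, a)) \<partial>z)"
proof -
  let ?BX = "borel_of (top_of_set X)" and ?BY = "borel_of (top_of_set Y)"
  let ?S = "sets (borel_of (prod_topology (top_of_set X) (top_of_set Y)))"
  have "(\<lambda>x. (x, a)) \<in> ?BX \<rightarrow>\<^sub>M borel_of (prod_topology (top_of_set X) (top_of_set A))"
    by (intro measurable_borel_of_continuous_map continuous_map_pairedI) (simp_all add: a)
  from measurable_compose[OF this stochastic_kernel_measurable[OF P]]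
  have Pm: "(\<lambda>x. P (x, a)) \<in> ?BX \<rightarrow>\<^sub>M subprob_algebra ?BX" .
  have "(\<lambda>x. (a, x)) \<in> ?BX \<rightarrow>\<^sub>M borel_of (prod_topology (top_of_set A) (top_of_set X))"
    by (intro measurable_borel_of_continuous_map continuous_map_pairedI) (simp_all add: a)
  from measurable_compose[OF this stochastic_kernel_measurable[OF Q]]
  have Qm: "(\<lambda>x. Q (a, x)) \<in> ?BX \<rightarrow>\<^sub>M subprob_algebra ?BY" .
  have sets_z: "sets z = sets ?BX" using z by (simp add: prob_measures_def)
  have space_z: "space z = X" using sets_eq_imp_space_eq[OF sets_z] by simp
  have sets_P: "sets (P (x, a)) = sets ?BX" if "x \<in> X" for x
    using P a that by (auto simp: stochastic_kernel_def prob_measures_def)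
  have space_P: "space (P (x, a)) = X" if "x \<in> X" for x
    using sets_eq_imp_space_eq[OF sets_P[OF that]] by simp
  have sets_Q: "sets (Q (a, x)) = sets ?BY" if "x \<in> X" for x
    using Q a that by (auto simp: stochastic_kernel_def prob_measures_def)
  have sec: "{y. (x, y) \<in> D} \<in> sets ?BY" if "D \<in> ?S" for D x
    using sets_Pair1[OF that[unfolded sets_borel_of_Times], of x] by (simp add: vimage_def)
  have m1: "(\<lambda>x'. emeasure (Q (a, x')) {y. (x', y) \<in> D}) \<in> borel_measurable ?BX" if "D \<in> ?S" for D
  proof (rule emeasure_measurable_subprob_algebra2[OF _ Qm])
    have "D \<subseteq> X \<times> Y" using sets.sets_into_space[OF that] by simp
    then have "(SIGMA x:space ?BX. {y. (x, y) \<in> D}) = D" by auto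
    with that show "(SIGMA x:space ?BX. {y. (x, y) \<in> D}) \<in> sets (?BX \<Otimes>\<^sub>M ?BY)"
      by (simp only: sets_borel_of_Times)
  qed
  have m2: "(\<lambda>x. \<integral>\<^sup>+x'. emeasure (Q (a, x')) {y. (x', y) \<in> D} \<partial>P (x, a)) \<in> borel_measurable ?BX"
    if "D \<in> ?S" for D
    using measurable_compose[OF Pm nn_integral_measurable_subprob_algebra[OF m1[OF that]]] .
  have m1': "(\<lambda>x'. emeasure (Q (a, x')) {y. (x', y) \<in> D}) \<in> borel_measurable (P (x, a))"
    if "D \<in> ?S" "x \<in> X" for D x
    using m1[OF that(1)] by (simp add: measurable_cong_sets[OF sets_P[OF that(2)] refl])
  have m2': "(\<lambda>x. \<integral>\<^sup>+x'. emeasure (Q (a, x')) {y. (x', y) \<in> D} \<partial>P (x, a)) \<in> borel_measurable z"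
    if "D \<in> ?S" for D
    using m2[OF that] by (simp add: measurable_cong_sets[OF sets_z refl])
  show ?thesis
    unfolding R_kernel_def prod.case
  proof (rule emeasure_measure_of_sigma)
    show "sigma_algebra (topspace (top_of_set X) \<times> topspace (top_of_set Y)) ?S"
      using sets.sigma_algebra_axioms[of "borel_of (prod_topology (top_of_set X) (top_of_set Y))"] by simp
    show "positive ?S (\<lambda>E. \<integral>\<^sup>+x. (\<integral>\<^sup>+x'. emeasure (Q (a, x')) {y. (x', y) \<in> E} \<partial>P (x, a)) \<partial>z)"
      by (simp add: positive_def)
    show "countably_additive ?S (\<lambda>E. \<integral>\<^sup>+x. (\<integral>\<^sup>+x'. emeasure (Q (a, x')) {y. (x', y) \<in> E} \<partial>P (x, a)) \<partial>z)"
    proof (rule countably_additiveI)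
      fix D :: "nat \<Rightarrow> ('x \<times> 'y) set"
      assume D: "range D \<subseteq> ?S" and disj: "disjoint_family D" and "(\<Union>i. D i) \<in> ?S"
      have Di: "D i \<in> ?S" for i using D by auto
      have "(\<Sum>i. \<integral>\<^sup>+x. (\<integral>\<^sup>+x'. emeasure (Q (a, x')) {y. (x', y) \<in> D i} \<partial>P (x, a)) \<partial>z) =
        (\<integral>\<^sup>+x. (\<Sum>i. \<integral>\<^sup>+x'. emeasure (Q (a, x')) {y. (x', y) \<in> D i} \<partial>P (x, a)) \<partial>z)"
        by (rule nn_integral_suminf[symmetric]) (rule m2'[OF Di])
      also have "\<dots> = (\<integral>\<^sup>+x. (\<integral>\<^sup>+x'. (\<Sum>i. emeasure (Q (a, x')) {y. (x', y) \<in> D i}) \<partial>P (x, a)) \<partial>z)"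
        by (intro nn_integral_cong nn_integral_suminf[symmetric] m1'[OF Di]) (simp add: space_z)
      also have "\<dots> = (\<integral>\<^sup>+x. (\<integral>\<^sup>+x'. emeasure (Q (a, x')) {y. (x', y) \<in> (\<Union>i. D i)} \<partial>P (x, a)) \<partial>z)"
      proof (intro nn_integral_cong)
        fix x x' assume "x \<in> space z" "x' \<in> space (P (x, a))"
        then have x': "x' \<in> X" by (simp add: space_z space_P)
        have "(\<Sum>i. emeasure (Q (a, x')) {y. (x', y) \<in> D i}) = emeasure (Q (a, x')) (\<Union>i. {y. (x', y) \<in> D i})"
        proof (rule suminf_emeasure)
          show "range (\<lambda>i. {y. (x', y) \<in> D i}) \<subseteq> sets (Q (a, x'))"
            using sec[OF Di] by (auto simp: sets_Q[OF x'])
          show "disjoint_family (\<lambda>i. {y. (x', y) \<in> D i})"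
            using disj by (auto simp: disjoint_family_on_def)
        qed
        also have "(\<Union>i. {y. (x', y) \<in> D i}) = {y. (x', y) \<in> (\<Union>i. D i)}" by auto
        finally show "(\<Sum>i. emeasure (Q (a, x')) {y. (x', y) \<in> D i}) = emeasure (Q (a, x')) {y. (x', y) \<in> (\<Union>i. D i)}" .
      qed
      finally show "(\<Sum>i. \<integral>\<^sup>+x. (\<integral>\<^sup>+x'. emeasure (Q (a, x')) {y. (x', y) \<in> D i} \<partial>P (x, a)) \<partial>z) =
        (\<integral>\<^sup>+x. (\<integral>\<^sup>+x'. emeasure (Q (a, x')) {y. (x', y) \<in> (\<Union>i. D i)} \<partial>P (x, a)) \<partial>z)" .
    qed
    show "E \<in> ?S" by (rule E)
  qed
qed

lemma emeasure_R_kernel_Times: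
  assumes "B \<in> sets (borel_of (top_of_set X))" "C \<in> sets (borel_of (top_of_set Y))"
  shows "emeasure (R_kernel (top_of_set X) (top_of_set Y) P Q (z, a)) (B \<times> C) =
    (\<integral>\<^sup>+x. (\<integral>\<^sup>+x'\<in>B. emeasure (Q (a, x')) C \<partial>P (x, a)) \<partial>z)"
proof -
  have "emeasure (Q (a, x')) {y. (x', y) \<in> B \<times> C} = emeasure (Q (a, x')) C * indicator B x'" for x'
    by (cases "x' \<in> B") auto
  moreover have "B \<times> C \<in> sets (borel_of (prod_topology (top_of_set X) (top_of_set Y)))"
    using assms by (simp only: sets_borel_of_Times) (rule pair_measureI)
  ultimately show ?thesis
    by (simp only: emeasure_R_kernel)
qed

lemma emeasure_R'_kernel:
  assumes "C \<in> sets (borel_of (top_of_set Y))"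
  shows "emeasure (R'_kernel (top_of_set X) (top_of_set Y) P Q (z, a)) C =
    emeasure (R_kernel (top_of_set X) (top_of_set Y) P Q (z, a)) (X \<times> C)"
proof -
  let ?R = "R_kernel (top_of_set X) (top_of_set Y) P Q (z, a)"
  have Pow: "sets (borel_of (prod_topology (top_of_set X) (top_of_set Y))) \<subseteq> Pow (X \<times> Y)"
    using sets.space_closed[of "borel_of (prod_topology (top_of_set X) (top_of_set Y))"] by simp
  have "sigma_algebra (X \<times> Y) (sets (borel_of (prod_topology (top_of_set X) (top_of_set Y))))"
    using sets.sigma_algebra_axioms[of "borel_of (prod_topology (top_of_set X) (top_of_set Y))"] by simp
  then have sets_R: "sets ?R = sets (borel_of (top_of_set X) \<Otimes>\<^sub>M borel_of (top_of_set Y))"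
    unfolding R_kernel_def prod.case
    by (simp only: topspace_euclidean_subtopology sets_measure_of[OF Pow] sigma_algebra.sigma_sets_eq)
      (rule sets_borel_of_Times)
  have snd: "snd \<in> ?R \<rightarrow>\<^sub>M borel_of (top_of_set Y)"
    by (simp add: measurable_cong_sets[OF sets_R refl])
  have "snd -` C \<inter> space ?R = X \<times> C"
    using sets_eq_imp_space_eq[OF sets_R] sets.sets_into_space[OF assms]
    by (auto simp: space_pair_measure)
  then show ?thesis
    unfolding R'_kernel_def using emeasure_distr[OF snd assms] by simp
qed

end

end

theory Submission
  imports Defs
begin

text \<open>
  Total variation continuity and separability make all measures \<open>Q(\<sqdot>|a,x)\<close> absolutely continuous
  with respect to one finite measure \<open>\<nu>\<close>, with a jointly measurable density \<open>q\<close>.  Bayes' formula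
  then gives an explicit filter: \<open>H(z,a,y)\<close> has density \<open>q(y|a,\<sqdot>) / N(y)\<close> with respect to the
  prediction \<open>m(dx') = \<integral> P(dx'|x,a) z(dx)\<close>, where \<open>N = \<integral> q(\<sqdot>|a,x') m(dx')\<close> is the density of
  \<open>R'(\<sqdot>|z,a)\<close>.  Predictions depend weakly continuously on \<open>(z,a)\<close>.  For bounded continuous \<open>h\<close>
  the functions \<open>x' \<mapsto> h(x') \<integral> \<phi> dQ(\<sqdot>|a,x')\<close> with \<open>|\<phi>| \<le> 1\<close> are equicontinuous, and weak
  convergence is uniform over such families; hence \<open>\<integral> h(x') q(\<sqdot>|a,x') m(dx')\<close> is continuous in
  \<open>(z,a)\<close> as an element of \<open>L\<^sup>1(\<nu>)\<close>.  With \<open>h = 1\<close> this is continuity of \<open>R'\<close> in total variation;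
  with \<open>h\<close> running through a countable convergence-determining family it yields, along a
  subsequence, weak convergence of the filters for almost every \<open>y\<close>.
\<close>

text \<open>For fixed y the density q(y|a,x) need not be continuous in x, so weak convergence of the
  predictions says nothing about the integral of h(x') q(y|a,x') at a single y. Continuity appears
  only after y is integrated out against a bounded \<phi>, and the \<phi> that attains an L1
  distance is the sign of a difference, which changes along the sequence. Hence integrands that move
  with n must be allowed, and total variation continuity enters through its uniformity over \<phi>.
  The role of tightness is taken by a finite partition of unity: it is chosen for the limit measure
  alone, and weak convergence transfers it to the sequence.

  The countably many test integrals map measures into real sequences. Through this one map,
  convergence, open sets and Borel sets of the space of measures become scalar questions with a
  single exceptional null set. The claim on the law of the posterior concerns every filter, while
  convergence is shown for the Bayes filter; (F) fixes the test integrals of a filter up to an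
  R'-null set, and integrals of weakly continuous functions do not see more.\<close>

lemma prob_measuresD:
  assumes "\<mu> \<in> prob_measures S"
  shows "prob_space \<mu>" "sets \<mu> = sets (borel_of S)" "space \<mu> = topspace S"
  using assms sets_eq_imp_space_eq[of \<mu> "borel_of S"] by (auto simp: prob_measures_def)

lemma sets_borel_of_euclidean: "sets (borel_of euclidean) = sets borel"
  by (simp add: sets_borel_of borel_def)

lemma bounded_continuous_measurable:
  assumes "f \<in> bounded_continuous S"
  shows "f \<in> borel_measurable (borel_of S)"
proof -
  have "f \<in> borel_of S \<rightarrow>\<^sub>M borel_of euclidean"
    using assms by (intro measurable_borel_of_continuous_map) (simp add: bounded_continuous_def)
  then show ?thesis
    by (simp add: measurable_cong_sets[OF refl sets_borel_of_euclidean])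
qed

lemma prob_measures_integrable:
  fixes f :: "'s \<Rightarrow> real"
  assumes "\<mu> \<in> prob_measures S" "f \<in> borel_measurable (borel_of S)" "\<And>x. x \<in> topspace S \<Longrightarrow> \<bar>f x\<bar> \<le> M"
  shows "integrable \<mu> f"
proof -
  interpret prob_space \<mu> using assms by (simp add: prob_measuresD)
  show ?thesis
    using assms
    by (intro integrable_const_bound[of _ M])
      (auto simp: prob_measuresD measurable_cong_sets[OF prob_measuresD(2) refl])
qed

lemma prob_measures_integral_le:
  fixes f :: "'s \<Rightarrow> real"
  assumes "\<mu> \<in> prob_measures S" "f \<in> borel_measurable (borel_of S)" "\<And>x. x \<in> topspace S \<Longrightarrow> \<bar>f x\<bar> \<le> M"
  shows "\<bar>integral\<^sup>L \<mu> f\<bar> \<le> M"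
proof -
  interpret prob_space \<mu> using assms by (simp add: prob_measuresD)
  have "\<bar>integral\<^sup>L \<mu> f\<bar> \<le> (\<integral>x. \<bar>f x\<bar> \<partial>\<mu>)"
    by (rule integral_abs_bound)
  also have "\<dots> \<le> (\<integral>x. M \<partial>\<mu>)"
    using assms by (intro integral_mono integrable_abs prob_measures_integrable[OF assms])
      (auto simp: prob_measuresD(3)[OF assms(1)])
  finally show ?thesis by (simp add: prob_space)
qed

lemma bounded_continuous_integrable:
  assumes "f \<in> bounded_continuous S" "\<mu> \<in> prob_measures S"
  shows "integrable \<mu> f"
proof -
  obtain M where "\<And>x. x \<in> topspace S \<Longrightarrow> \<bar>f x\<bar> \<le> M"
    using assms(1) by (auto simp: bounded_continuous_def bounded_iff)
  then show ?thesis
    using prob_measures_integrable[OF assms(2) bounded_continuous_measurable[OF assms(1)]] by blast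
qed

lemma bounded_continuous_top_of_set:
  "f \<in> bounded_continuous (top_of_set X) \<longleftrightarrow> continuous_on X f \<and> bounded (f ` X)"
  by (simp add: bounded_continuous_def)

section \<open>Weak convergence and uniformly equicontinuous integrands\<close>

text \<open>A piecewise linear cut-off: 1 on the ball of radius \<open>d / 2\<close>, 0 off the ball
  of radius \<open>d\<close>. The plateau matters, since a cover by the half-size balls then makes
  some factor \<open>1 - bump\<close> vanish at every point.\<close>

definition bump :: "'a::metric_space \<Rightarrow> real \<Rightarrow> 'a \<Rightarrow> real" where
  "bump c d x = max 0 (min 1 (2 - 2 * dist x c / d))"

lemma bump_props:
  assumes "d > 0"
  shows "0 \<le> bump c d x" "bump c d x \<le> 1" "dist x c \<le> d / 2 \<Longrightarrow> bump c d x = 1"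
    "dist x c \<ge> d \<Longrightarrow> bump c d x = 0"
  using assms by (auto simp: bump_def field_simps max_def min_def)

lemma continuous_on_bump [continuous_intros]: "continuous_on X (bump c d)"
  unfolding bump_def divide_inverse by (intro continuous_intros)

text \<open>Stick breaking: term \<open>i\<close> takes the share \<open>\<psi> i\<close> of what
  the earlier terms have left, so the sum telescopes to one minus the final rest.\<close>

lemma partition_of_unity_sum:
  fixes \<psi> :: "nat \<Rightarrow> real"
  shows "(\<Sum>i<K. \<psi> i * (\<Prod>j<i. 1 - \<psi> j)) = 1 - (\<Prod>j<K. 1 - \<psi> j)"
  by (induction K) (auto simp: algebra_simps)

text \<open>
  The functions \<open>\<psi> i * (\<Prod>j<i. 1 - \<psi> j)\<close> form a partition of unity up to the remainder
  \<open>\<Prod>j<K. 1 - \<psi> j\<close>, whose integral becomes small when the balls cover the space.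
\<close>

lemma integral_partition_of_unity:
  fixes F :: "'x::metric_space \<Rightarrow> real" and c :: "nat \<Rightarrow> 'x"
  assumes mu: "\<mu> \<in> prob_measures (top_of_set X)"
    and F: "F \<in> borel_measurable (borel_of (top_of_set X))" "\<And>x. x \<in> X \<Longrightarrow> \<bar>F x\<bar> \<le> M"
    and d: "\<And>i. d i > 0"
    and g: "\<And>i x. i < K \<Longrightarrow> x \<in> X \<Longrightarrow> dist x (c i) < d i \<Longrightarrow> \<bar>F x - g i\<bar> \<le> \<epsilon>"
    and "\<epsilon> \<ge> 0"
  defines "\<phi> \<equiv> \<lambda>i x. bump (c i) (d i) x * (\<Prod>j<i. 1 - bump (c j) (d j) x)"
    and "R \<equiv> \<lambda>K x. \<Prod>j<K. 1 - bump (c j) (d j) x"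
  shows "\<bar>(\<integral>x. F x \<partial>\<mu>) - (\<Sum>i<K. g i * (\<integral>x. \<phi> i x \<partial>\<mu>))\<bar> \<le> \<epsilon> + M * (\<integral>x. R K x \<partial>\<mu>)"
proof -
  interpret prob_space \<mu> using mu by (simp add: prob_measuresD)
  have R01: "0 \<le> R k x" "R k x \<le> 1" for k x
    unfolding R_def using bump_props[OF d] by (auto intro!: prod_nonneg prod_le_1)
  have phi01: "0 \<le> \<phi> i x" "\<phi> i x \<le> 1" for i x
    using bump_props(1,2)[OF d] R01[of i x] by (auto simp: \<phi>_def R_def intro!: mult_le_one mult_nonneg_nonneg)
  have "R K \<in> bounded_continuous (top_of_set X)" for K
    unfolding bounded_continuous_top_of_set using R01
    by (auto simp: R_def[abs_def] bounded_iff intro!: continuous_intros exI[of _ 1])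
  then have iR: "integrable \<mu> (R K)" for K
    using mu by (rule bounded_continuous_integrable)
  have "\<phi> i \<in> bounded_continuous (top_of_set X)" for i
    unfolding bounded_continuous_top_of_set using phi01
    by (auto simp: \<phi>_def[abs_def] bounded_iff intro!: continuous_intros exI[of _ 1])
  then have iphi: "integrable \<mu> (\<phi> i)" for i
    using mu by (rule bounded_continuous_integrable)
  have iF: "integrable \<mu> F" using prob_measures_integrable[OF mu F(1), of M] F(2) by simp
  \<comment> \<open>Pointwise form of the estimate. Where \<open>\<phi> i x\<close> is nonzero,
    \<open>x\<close> lies within \<open>d i\<close> of \<open>c i\<close> and \<open>g i\<close> is
    a good value; the rest \<open>R K x\<close> is charged at the bound \<open>M\<close>.\<close>
  have pw: "\<bar>F x - (\<Sum>i<K. g i * \<phi> i x)\<bar> \<le> \<epsilon> + M * R K x" if x: "x \<in> X" for x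
  proof -
    have sum: "(\<Sum>i<K. \<phi> i x) = 1 - R K x"
      using partition_of_unity_sum[of "\<lambda>i. bump (c i) (d i) x"] by (simp add: \<phi>_def R_def)
    then have "F x = F x * ((\<Sum>i<K. \<phi> i x) + R K x)" by simp
    then have "F x = (\<Sum>i<K. F x * \<phi> i x) + F x * R K x"
      by (simp only: distrib_left sum_distrib_left)
    then have "F x - (\<Sum>i<K. g i * \<phi> i x) = (\<Sum>i<K. (F x - g i) * \<phi> i x) + F x * R K x"
      by (simp add: sum_subtractf algebra_simps)
    also have "\<bar>\<dots>\<bar> \<le> (\<Sum>i<K. \<bar>(F x - g i) * \<phi> i x\<bar>) + \<bar>F x * R K x\<bar>"
      by (intro order_trans[OF abs_triangle_ineq] add_mono sum_abs order_refl)
    also have "(\<Sum>i<K. \<bar>(F x - g i) * \<phi> i x\<bar>) \<le> (\<Sum>i<K. \<epsilon> * \<phi> i x)"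
    proof (intro sum_mono)
      fix i assume i: "i \<in> {..<K}"
      show "\<bar>(F x - g i) * \<phi> i x\<bar> \<le> \<epsilon> * \<phi> i x"
      proof (cases "dist x (c i) < d i")
        case True
        then show ?thesis using g[of i x] i x phi01[of i x] by (simp add: abs_mult mult_right_mono)
      next
        case False
        then have "bump (c i) (d i) x = 0" by (intro bump_props(4) d) simp
        then have "\<phi> i x = 0" by (simp add: \<phi>_def)
        then show ?thesis by simp
      qed
    qed
    also have "\<dots> \<le> \<epsilon>"
      using R01[of K x] \<open>\<epsilon> \<ge> 0\<close> mult_left_mono[of "1 - R K x" 1 \<epsilon>] by (simp add: sum_distrib_left[symmetric] sum)
    also have "\<bar>F x * R K x\<bar> \<le> M * R K x"
      using F(2)[OF x] R01[of K x] by (simp add: abs_mult mult_right_mono)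
    finally show ?thesis by simp
  qed
  have "(\<integral>x. F x \<partial>\<mu>) - (\<Sum>i<K. g i * (\<integral>x. \<phi> i x \<partial>\<mu>)) = (\<integral>x. F x - (\<Sum>i<K. g i * \<phi> i x) \<partial>\<mu>)"
    using iF iphi by (subst Bochner_Integration.integral_diff) (auto simp: integral_sum)
  also have "\<bar>\<dots>\<bar> \<le> (\<integral>x. \<bar>F x - (\<Sum>i<K. g i * \<phi> i x)\<bar> \<partial>\<mu>)"
    by (rule integral_abs_bound)
  also have "\<dots> \<le> (\<integral>x. \<epsilon> + M * R K x \<partial>\<mu>)"
    using iF iphi iR pw prob_measuresD(3)[OF mu] by (intro integral_mono) auto
  also have "\<dots> = \<epsilon> + M * (\<integral>x. R K x \<partial>\<mu>)"
    using iR by (simp add: prob_space)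
  finally show ?thesis .
qed

text \<open>Lindelof's property selects countably many balls even though the radius varies with the
  centre. Nonemptiness allows the centres to be listed, with repetitions, by all natural
  numbers.\<close>

lemma countable_ball_cover:
  fixes X :: "'x::{metric_space, second_countable_topology} set"
  assumes "X \<noteq> {}" and \<delta>: "\<And>x. x \<in> X \<Longrightarrow> \<delta> x > 0"
  obtains c :: "nat \<Rightarrow> 'x" where "\<And>i. c i \<in> X" "\<And>x. x \<in> X \<Longrightarrow> \<exists>i. dist x (c i) < \<delta> (c i)"
proof -
  obtain \<F> where \<F>: "\<F> \<subseteq> (\<lambda>x. ball x (\<delta> x)) ` X" "countable \<F>" "\<Union>\<F> = (\<Union>x\<in>X. ball x (\<delta> x))"
    by (rule Lindelof[of "(\<lambda>x. ball x (\<delta> x)) ` X"]) auto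
  have "\<exists>X'. countable X' \<and> X' \<subseteq> X \<and> \<F> = (\<lambda>x. ball x (\<delta> x)) ` X'"
    using \<F>(1,2) countable_subset_image[of \<F> "\<lambda>x. ball x (\<delta> x)" X] by blast
  then obtain X' where X': "X' \<subseteq> X" "countable X'" "\<F> = (\<lambda>x. ball x (\<delta> x)) ` X'"
    by blast
  have XX': "X \<subseteq> (\<Union>x\<in>X'. ball x (\<delta> x))"
  proof
    fix x assume "x \<in> X"
    then have "x \<in> (\<Union>x\<in>X. ball x (\<delta> x))" using \<delta>[of x] by (intro UN_I[of x]) auto
    then show "x \<in> (\<Union>x\<in>X'. ball x (\<delta> x))" using \<F>(3) X'(3) by simp
  qed
  then have ne: "X' \<noteq> {}" using \<open>X \<noteq> {}\<close> by blast
  define c where "c = from_nat_into X'"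
  have "c i \<in> X" for i using X'(1) ne from_nat_into[of X' i] by (auto simp: c_def)
  moreover have "\<exists>i. dist x (c i) < \<delta> (c i)" if x: "x \<in> X" for x
  proof -
    obtain x' where "x' \<in> X'" "x \<in> ball x' (\<delta> x')"
      using XX' x by blast
    moreover obtain i where "c i = x'"
      using from_nat_into_surj[OF X'(2) \<open>x' \<in> X'\<close>] by (auto simp: c_def)
    ultimately show ?thesis by (auto simp: dist_commute)
  qed
  ultimately show thesis using that by blast
qed

text \<open>
  The limit integrands \<open>G n\<close> may change with \<open>n\<close>: this expresses uniformity over an equicontinuous
  family, since a supremum over the family is approached along a sequence of its members.
\<close>

lemma weakly_converges_integral_diff_tendsto_0:
  fixes X :: "'x::{metric_space, second_countable_topology} set" and F G :: "nat \<Rightarrow> 'x \<Rightarrow> real"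
  assumes mun: "\<And>n. \<mu>n n \<in> prob_measures (top_of_set X)" and mu: "\<mu> \<in> prob_measures (top_of_set X)"
    and conv: "weakly_converges (top_of_set X) \<mu>n \<mu>"
    and F: "\<And>n. F n \<in> borel_measurable (borel_of (top_of_set X))" "\<And>n x. x \<in> X \<Longrightarrow> \<bar>F n x\<bar> \<le> M"
    and G: "\<And>n. G n \<in> borel_measurable (borel_of (top_of_set X))" "\<And>n x. x \<in> X \<Longrightarrow> \<bar>G n x\<bar> \<le> M"
    and close: "\<And>x \<epsilon>. x \<in> X \<Longrightarrow> \<epsilon> > 0 \<Longrightarrow> \<exists>\<delta>>0. \<forall>\<^sub>F n in sequentially. \<forall>x'\<in>X. dist x' x < \<delta> \<longrightarrow>
        \<bar>F n x' - G n x\<bar> \<le> \<epsilon> \<and> \<bar>G n x' - G n x\<bar> \<le> \<epsilon>"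
  shows "(\<lambda>n. (\<integral>x. F n x \<partial>\<mu>n n) - (\<integral>x. G n x \<partial>\<mu>)) \<longlonglongrightarrow> 0"
proof -
  interpret mu: prob_space \<mu> using mu by (simp add: prob_measuresD)
  have spmu: "space \<mu> = X" using prob_measuresD(3)[OF mu] by simp
  have "X \<noteq> {}" using mu.not_empty by (simp add: spmu)
  then obtain x0 where x0: "x0 \<in> X" by blast
  have M0: "M \<ge> 0" using F(2)[OF x0, of 0] by simp
  \<comment> \<open>The constant adds up as follows: \<epsilon> each for replacing
    \<open>F n\<close> and \<open>G n\<close> by their values at the centres,
    \<open>M * \<epsilon>\<close> each for the two remainders, and \<open>M * \<epsilon>\<close> for
    the change of the weights \<open>\<phi> i\<close> between the two measures.\<close>
  have main: "\<forall>\<^sub>F n in sequentially. \<bar>(\<integral>x. F n x \<partial>\<mu>n n) - (\<integral>x. G n x \<partial>\<mu>)\<bar> \<le> (2 + 3 * M) * \<epsilon>"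
    if eps: "\<epsilon> > 0" for \<epsilon>
  proof -
    define near where "near = (\<lambda>x \<delta>. \<forall>\<^sub>F n in sequentially. \<forall>x'\<in>X. dist x' x < \<delta> \<longrightarrow>
        \<bar>F n x' - G n x\<bar> \<le> \<epsilon> \<and> \<bar>G n x' - G n x\<bar> \<le> \<epsilon>)"
    have "\<forall>x\<in>X. \<exists>\<delta>. \<delta> > 0 \<and> near x \<delta>"
      using close[OF _ eps] unfolding near_def by (intro ballI) auto
    then obtain \<delta>0 where \<delta>0: "\<And>x. x \<in> X \<Longrightarrow> \<delta>0 x > 0" "\<And>x. x \<in> X \<Longrightarrow> near x (\<delta>0 x)"
      by (auto dest!: bchoice)
    define \<delta> where "\<delta> = (\<lambda>x. if x \<in> X then \<delta>0 x else 1)"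
    have \<delta>: "\<And>x. \<delta> x > 0" "\<And>x. x \<in> X \<Longrightarrow> near x (\<delta> x)"
      using \<delta>0 by (auto simp: \<delta>_def)
    \<comment> \<open>Covering by half radii puts each point on the plateau of some bump, so
      \<open>R K\<close> decreases to 0 pointwise.\<close>
    obtain c :: "nat \<Rightarrow> 'x" where cX: "\<And>i. c i \<in> X"
      and cover: "\<And>x. x \<in> X \<Longrightarrow> \<exists>i. dist x (c i) < \<delta> (c i) / 2"
      using countable_ball_cover[of X "\<lambda>x. \<delta> x / 2"] \<open>X \<noteq> {}\<close> \<delta>(1) by (auto intro: half_gt_zero)
    define R where "R = (\<lambda>K x. \<Prod>j<K. 1 - bump (c j) (\<delta> (c j)) x)"
    define \<phi> where "\<phi> = (\<lambda>i x. bump (c i) (\<delta> (c i)) x * (\<Prod>j<i. 1 - bump (c j) (\<delta> (c j)) x))"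
    have R01: "0 \<le> R k x" "R k x \<le> 1" for k x
      unfolding R_def using bump_props[OF \<delta>(1)] by (auto intro!: prod_nonneg prod_le_1)
    have phi01: "0 \<le> \<phi> i x" "\<phi> i x \<le> 1" for i x
      using bump_props(1,2)[OF \<delta>(1)] R01[of i x] by (auto simp: \<phi>_def R_def intro!: mult_le_one mult_nonneg_nonneg)
    have Rbc: "R K \<in> bounded_continuous (top_of_set X)" for K
      unfolding bounded_continuous_top_of_set using R01
      by (auto simp: R_def[abs_def] bounded_iff intro!: continuous_intros exI[of _ 1])
    have phibc: "\<phi> i \<in> bounded_continuous (top_of_set X)" for i
      unfolding bounded_continuous_top_of_set using phi01
      by (auto simp: \<phi>_def[abs_def] bounded_iff intro!: continuous_intros exI[of _ 1])
    have "(\<lambda>K. \<integral>x. R K x \<partial>\<mu>) \<longlonglongrightarrow> (\<integral>x. 0 \<partial>\<mu>)"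
    proof (rule integral_dominated_convergence[where w="\<lambda>_. 1"])
      show "AE x in \<mu>. (\<lambda>K. R K x) \<longlonglongrightarrow> 0"
      proof (rule AE_I2)
        fix x assume "x \<in> space \<mu>"
        then obtain i where i: "dist x (c i) < \<delta> (c i) / 2" using cover spmu by blast
        then have b: "bump (c i) (\<delta> (c i)) x = 1" by (intro bump_props(3) \<delta>(1)) simp
        have "\<forall>\<^sub>F K in sequentially. R K x = 0"
          using eventually_gt_at_top[of i] by eventually_elim (use b in \<open>auto simp: R_def\<close>)
        then show "(\<lambda>K. R K x) \<longlonglongrightarrow> 0" by (rule tendsto_eventually)
      qed
      show "R K \<in> borel_measurable \<mu>" for K
        using bounded_continuous_integrable[OF Rbc mu] by auto
    qed (use R01 in auto)
    \<comment> \<open>\<open>K\<close> depends on \<mu> only. Since \<open>R K\<close> is itself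
      bounded and continuous, weak convergence makes its integral small under
      \<open>\<mu>n n\<close> too, and from here on only finitely many centres matter.\<close>
    then have "\<forall>\<^sub>F K in sequentially. (\<integral>x. R K x \<partial>\<mu>) < \<epsilon>"
      using eps by (intro order_tendstoD(2)) auto
    then obtain K where K: "(\<integral>x. R K x \<partial>\<mu>) < \<epsilon>" by (auto simp: eventually_sequentially)
    have "(\<lambda>n. \<integral>x. R K x \<partial>\<mu>n n) \<longlonglongrightarrow> (\<integral>x. R K x \<partial>\<mu>)"
      using conv Rbc by (simp add: weakly_converges_def)
    then have ev1: "\<forall>\<^sub>F n in sequentially. (\<integral>x. R K x \<partial>\<mu>n n) < \<epsilon>"
      using K by (rule order_tendstoD(2))
    have "(\<lambda>n. \<Sum>i<K. \<bar>(\<integral>x. \<phi> i x \<partial>\<mu>n n) - (\<integral>x. \<phi> i x \<partial>\<mu>)\<bar>) \<longlonglongrightarrow> (\<Sum>i<K. \<bar>(\<integral>x. \<phi> i x \<partial>\<mu>) - (\<integral>x. \<phi> i x \<partial>\<mu>)\<bar>)"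
      using conv phibc by (intro tendsto_intros) (simp add: weakly_converges_def)
    then have ev2: "\<forall>\<^sub>F n in sequentially. (\<Sum>i<K. \<bar>(\<integral>x. \<phi> i x \<partial>\<mu>n n) - (\<integral>x. \<phi> i x \<partial>\<mu>)\<bar>) < \<epsilon>"
      using eps by (intro order_tendstoD(2)) auto
    have ev3: "\<forall>\<^sub>F n in sequentially. \<forall>i\<in>{..<K}. \<forall>x'\<in>X. dist x' (c i) < \<delta> (c i) \<longrightarrow>
        \<bar>F n x' - G n (c i)\<bar> \<le> \<epsilon> \<and> \<bar>G n x' - G n (c i)\<bar> \<le> \<epsilon>"
      by (rule eventually_ball_finite) (use \<delta>(2)[OF cX] in \<open>auto simp: near_def\<close>)
    show ?thesis
      using ev1 ev2 ev3
    proof eventually_elim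
      case (elim n)
      have 1: "\<bar>(\<integral>x. F n x \<partial>\<mu>n n) - (\<Sum>i<K. G n (c i) * (\<integral>x. \<phi> i x \<partial>\<mu>n n))\<bar> \<le> \<epsilon> + M * (\<integral>x. R K x \<partial>\<mu>n n)"
        unfolding \<phi>_def R_def using elim eps
        by (intro integral_partition_of_unity[OF mun F(1)] F(2) \<delta>(1)) auto
      have 2: "\<bar>(\<integral>x. G n x \<partial>\<mu>) - (\<Sum>i<K. G n (c i) * (\<integral>x. \<phi> i x \<partial>\<mu>))\<bar> \<le> \<epsilon> + M * (\<integral>x. R K x \<partial>\<mu>)"
        unfolding \<phi>_def R_def using elim eps
        by (intro integral_partition_of_unity[OF mu G(1)] G(2) \<delta>(1)) auto
      have "\<bar>(\<Sum>i<K. G n (c i) * (\<integral>x. \<phi> i x \<partial>\<mu>n n)) - (\<Sum>i<K. G n (c i) * (\<integral>x. \<phi> i x \<partial>\<mu>))\<bar>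
          = \<bar>\<Sum>i<K. G n (c i) * ((\<integral>x. \<phi> i x \<partial>\<mu>n n) - (\<integral>x. \<phi> i x \<partial>\<mu>))\<bar>"
        by (simp add: sum_subtractf right_diff_distrib)
      also have "\<dots> \<le> (\<Sum>i<K. M * \<bar>(\<integral>x. \<phi> i x \<partial>\<mu>n n) - (\<integral>x. \<phi> i x \<partial>\<mu>)\<bar>)"
        using G(2)[OF cX] by (intro order_trans[OF sum_abs] sum_mono) (auto simp: abs_mult mult_right_mono)
      also have "\<dots> \<le> M * \<epsilon>"
        unfolding sum_distrib_left[symmetric] using elim(2) M0 by (intro mult_left_mono) auto
      finally have 3: "\<bar>(\<Sum>i<K. G n (c i) * (\<integral>x. \<phi> i x \<partial>\<mu>n n)) - (\<Sum>i<K. G n (c i) * (\<integral>x. \<phi> i x \<partial>\<mu>))\<bar> \<le> M * \<epsilon>" .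
      have "M * (\<integral>x. R K x \<partial>\<mu>n n) \<le> M * \<epsilon>" "M * (\<integral>x. R K x \<partial>\<mu>) \<le> M * \<epsilon>"
        using elim(1) K M0 by (auto intro!: mult_left_mono)
      with 1 2 3 show ?case by (simp add: algebra_simps)
    qed
  qed
  show ?thesis
  proof (rule tendstoI)
    fix e :: real assume "e > 0"
    define C where "C = 2 + 3 * M"
    define \<epsilon> where "\<epsilon> = e / 2 / C"
    have "C > 0" using M0 by (simp add: C_def)
    then have "\<epsilon> > 0" "C * \<epsilon> < e" using \<open>e > 0\<close> by (simp_all add: \<epsilon>_def)
    then have "\<epsilon> > 0" "(2 + 3 * M) * \<epsilon> < e" by (simp_all add: C_def)
    with main[of \<epsilon>] show "\<forall>\<^sub>F n in sequentially. dist ((\<integral>x. F n x \<partial>\<mu>n n) - (\<integral>x. G n x \<partial>\<mu>)) 0 < e"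
      by (auto elim!: eventually_mono)
  qed
qed

section \<open>A countable convergence-determining family\<close>

definition dense_seq :: "nat \<Rightarrow> 'x::second_countable_topology" where
  "dense_seq = from_nat_into (SOME D. countable D \<and> (\<forall>U. open U \<and> U \<noteq> {} \<longrightarrow> (\<exists>d\<in>D. d \<in> U)))"

lemma dense_seq:
  fixes U :: "'x::second_countable_topology set"
  assumes "open U" "U \<noteq> {}"
  obtains i where "dense_seq i \<in> U"
proof -
  let ?P = "\<lambda>D::'x set. countable D \<and> (\<forall>U. open U \<and> U \<noteq> {} \<longrightarrow> (\<exists>d\<in>D. d \<in> U))"
  obtain D0 :: "'x set" where "?P D0" using countable_dense_exists by blast
  then have D: "?P (Eps ?P)" by (rule someI)
  then obtain d where d: "d \<in> Eps ?P" "d \<in> U" using assms by blast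
  obtain i where "from_nat_into (Eps ?P) i = d"
    using from_nat_into_surj[OF _ d(1)] D by blast
  then show ?thesis using that[of i] d(2) by (simp add: dense_seq_def)
qed

text \<open>
  Finite maxima of truncated cones with rational heights, natural slopes and apexes in a countable
  dense set (of the whole type, not of \<open>X\<close>) approximate every nonnegative lower semicontinuous
  function from below.
\<close>

definition cone_fun :: "rat \<times> nat \<times> nat \<Rightarrow> 'x::{metric_space, second_countable_topology} \<Rightarrow> real" where
  "cone_fun = (\<lambda>(q, k, i) x. of_rat q - real k * dist x (dense_seq i))"

primrec max_cones :: "(rat \<times> nat \<times> nat) list \<Rightarrow> 'x::{metric_space, second_countable_topology} \<Rightarrow> real" where
  "max_cones [] x = 0"
| "max_cones (p # l) x = max (cone_fun p x) (max_cones l x)"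

lemma max_cones_nonneg: "0 \<le> max_cones l x"
  by (induction l) auto

lemma max_cones_le: "0 \<le> c \<Longrightarrow> (\<And>p. p \<in> set l \<Longrightarrow> cone_fun p x \<le> c) \<Longrightarrow> max_cones l x \<le> c"
  by (induction l) auto

lemma max_cones_ge: "p \<in> set l \<Longrightarrow> cone_fun p x \<le> max_cones l x"
  by (induction l) (auto simp: le_max_iff_disj)

lemma max_cones_bounded: "\<exists>M. \<forall>x. max_cones l x \<le> M"
proof (induction l)
  case (Cons p l)
  then obtain M where M: "\<And>x::'a. max_cones l x \<le> M" by blast
  have "cone_fun p x \<le> of_rat (fst p)" for x :: 'a
    by (cases p) (simp add: cone_fun_def)
  with M have "max_cones (p # l) x \<le> max (of_rat (fst p)) M" for x :: 'a
    unfolding max_cones.simps by (intro max.mono)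
  then show ?case by blast
qed auto

lemma continuous_on_max_cones: "continuous_on X (max_cones l)"
proof (induction l)
  case (Cons p l)
  have "continuous_on X (cone_fun p)"
    by (cases p) (auto simp: cone_fun_def[abs_def] intro!: continuous_intros)
  with Cons show ?case by (auto intro!: continuous_intros)
qed auto

text \<open>Lists of cone parameters form a countable type, so \<open>from_nat\<close> runs through
  all finite maxima; the empty list contributes the truncation at 0.\<close>

definition test_fun :: "nat \<Rightarrow> 'x::{metric_space, second_countable_topology} \<Rightarrow> real" where
  "test_fun k = max_cones (from_nat k)"

lemma test_fun_nonneg: "0 \<le> test_fun k x"
  by (simp add: test_fun_def max_cones_nonneg)

lemma test_fun_bounded:
  obtains M where "\<And>x::'x::{metric_space, second_countable_topology}. \<bar>test_fun k x\<bar> \<le> M"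
proof -
  obtain M where "\<And>x::'x. max_cones (from_nat k) x \<le> M" using max_cones_bounded by blast
  then show ?thesis using that[of M] by (simp add: test_fun_def max_cones_nonneg)
qed

lemma continuous_on_test_fun: "continuous_on X (test_fun k)"
  by (simp add: test_fun_def continuous_on_max_cones)

lemma test_fun_bounded_continuous:
  fixes X :: "'x::{metric_space, second_countable_topology} set"
  shows "test_fun k \<in> bounded_continuous (top_of_set X)"
proof -
  obtain M where M: "\<And>x::'x. \<bar>test_fun k x\<bar> \<le> M" using test_fun_bounded[of k] by blast
  then have "bounded (test_fun k ` X)" by (auto simp: bounded_iff)
  then show ?thesis by (simp add: bounded_continuous_top_of_set continuous_on_test_fun)
qed

text \<open>\<open>f\<close> is the pointwise supremum of the cones below it, and these form a
  countable set; the maxima of its first \<open>m\<close> members converge to \<open>f\<close>.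
  Lower semicontinuity, rather than continuity, is the right generality because indicators of open
  sets are needed as well.\<close>

lemma lower_semicontinuous_approx_test_fun:
  fixes X :: "'x::{metric_space, second_countable_topology} set" and f :: "'x \<Rightarrow> real"
  assumes f0: "\<And>x. x \<in> X \<Longrightarrow> 0 \<le> f x"
    and lsc: "\<And>x q. x \<in> X \<Longrightarrow> q < f x \<Longrightarrow> \<exists>\<delta>>0. \<forall>x'\<in>X. dist x' x < \<delta> \<longrightarrow> q < f x'"
  obtains h :: "nat \<Rightarrow> nat" where "\<And>m x. x \<in> X \<Longrightarrow> test_fun (h m) x \<le> f x"
    "\<And>x. x \<in> X \<Longrightarrow> (\<lambda>m. test_fun (h m) x) \<longlonglongrightarrow> f x"
proof -
  define \<F> where "\<F> = {p. \<forall>x\<in>X. cone_fun p x \<le> f x}"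
  have zero: "(0, 0, 0) \<in> \<F>" using f0 by (auto simp: \<F>_def cone_fun_def)
  have ct: "countable \<F>" by (rule countableI_type)
  have sup: "\<exists>p\<in>\<F>. cone_fun p x > f x - \<epsilon>" if x: "x \<in> X" and eps: "\<epsilon> > 0" for x \<epsilon>
  proof (cases "f x < \<epsilon>")
    case True
    then show ?thesis using zero by (intro bexI[of _ "(0, 0, 0)"]) (auto simp: cone_fun_def)
  next
    case False
    obtain q where q: "f x - \<epsilon> < of_rat q" "of_rat q < f x"
      using of_rat_dense[of "f x - \<epsilon>" "f x"] eps by auto
    obtain \<delta> where \<delta>: "\<delta> > 0" "\<And>x'. x' \<in> X \<Longrightarrow> dist x' x < \<delta> \<Longrightarrow> of_rat q < f x'"
      using lsc[OF x q(2)] by blast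
    \<comment> \<open>The slope is so steep that the cone is at most 0 at distance
      \<open>\<delta> / 2\<close> from its apex. Off the \<delta>-ball about \<open>x\<close> the
      bound \<open>0 \<le> f\<close> then suffices, while inside it the height \<open>q\<close> is
      already below \<open>f\<close>.\<close>
    obtain k :: nat where "of_rat q / (\<delta> / 2) < real k" using reals_Archimedean2 by blast
    then have k: "of_rat q \<le> real k * (\<delta> / 2)" using \<delta>(1) by (simp add: field_simps)
    \<comment> \<open>The apex must be within \<open>\<delta> / 2\<close> of \<open>x\<close> for
      the previous estimate, and so close that the slope costs less than the slack
      \<open>q - (f x - \<epsilon>)\<close>; the \<open>+ 1\<close> covers
      \<open>k = 0\<close>.\<close>
    define \<eta> where "\<eta> = min (\<delta> / 2) ((of_rat q - (f x - \<epsilon>)) / (real k + 1))"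
    have "\<eta> > 0" using \<delta>(1) q by (simp add: \<eta>_def)
    then obtain i where i: "dense_seq i \<in> ball x \<eta>"
      using dense_seq[of "ball x \<eta>"] by auto
    have "real k * dist x (dense_seq i) \<le> real k * ((of_rat q - (f x - \<epsilon>)) / (real k + 1))"
      using i by (intro mult_left_mono) (auto simp: \<eta>_def)
    also have "\<dots> < of_rat q - (f x - \<epsilon>)"
      using q by (simp add: field_simps)
    finally have 1: "cone_fun (q, k, i) x > f x - \<epsilon>" by (simp add: cone_fun_def)
    have "cone_fun (q, k, i) x' \<le> f x'" if x': "x' \<in> X" for x'
    proof (cases "dist x' x < \<delta>")
      case True
      have "cone_fun (q, k, i) x' \<le> of_rat q" by (simp add: cone_fun_def)
      then show ?thesis using \<delta>(2)[OF x' True] by simp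
    next
      case False
      have "dist x (dense_seq i) < \<delta> / 2" using i by (simp add: \<eta>_def)
      then have "\<delta> / 2 \<le> dist x' (dense_seq i)"
        using False dist_triangle2[of x' x "dense_seq i"] by simp
      then have "real k * (\<delta> / 2) \<le> real k * dist x' (dense_seq i)"
        by (rule mult_left_mono) simp
      then show ?thesis using k f0[OF x'] by (simp add: cone_fun_def)
    qed
    with 1 show ?thesis by (intro bexI[of _ "(q, k, i)"]) (auto simp: \<F>_def)
  qed
  define g where "g = from_nat_into \<F>"
  have g: "g j \<in> \<F>" for j unfolding g_def using zero by (intro from_nat_into) auto
  define h where "h m = (to_nat (map g [0..<m]) :: nat)" for m
  have h: "test_fun (h m) = max_cones (map g [0..<m])" for m
    by (simp add: h_def test_fun_def)
  have le: "test_fun (h m) x \<le> f x" if "x \<in> X" for m x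
    unfolding h using that f0 g by (intro max_cones_le) (auto simp: \<F>_def)
  have lim: "(\<lambda>m. test_fun (h m) x) \<longlonglongrightarrow> f x" if x: "x \<in> X" for x
  proof (rule tendstoI)
    fix e :: real assume "e > 0"
    then obtain p where p: "p \<in> \<F>" "cone_fun p x > f x - e" using sup[OF x] by blast
    obtain j where j: "g j = p" using from_nat_into_surj[OF ct p(1)] by (auto simp: g_def)
    show "\<forall>\<^sub>F m in sequentially. dist (test_fun (h m) x) (f x) < e"
      using eventually_gt_at_top[of j]
    proof eventually_elim
      case (elim m)
      then have "p \<in> set (map g [0..<m])" using j by auto
      then have "cone_fun p x \<le> test_fun (h m) x" unfolding h by (rule max_cones_ge)
      then show ?case using p(2) le[OF x, of m] by (simp add: dist_real_def)
    qed
  qed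
  show thesis using that[of h] le lim by blast
qed

lemma integral_test_fun_tendsto:
  fixes X :: "'x::{metric_space, second_countable_topology} set" and f :: "'x \<Rightarrow> real"
  assumes mu: "\<mu> \<in> prob_measures (top_of_set X)"
    and f: "f \<in> borel_measurable (borel_of (top_of_set X))" "\<And>x. x \<in> X \<Longrightarrow> f x \<le> M"
    and h: "\<And>m x. x \<in> X \<Longrightarrow> test_fun (h m) x \<le> f x"
    "\<And>x. x \<in> X \<Longrightarrow> (\<lambda>m. test_fun (h m) x) \<longlonglongrightarrow> f x"
  shows "(\<lambda>m. \<integral>x. test_fun (h m) x \<partial>\<mu>) \<longlonglongrightarrow> (\<integral>x. f x \<partial>\<mu>)"
proof -
  interpret prob_space \<mu> using mu by (simp add: prob_measuresD)
  show ?thesis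
  proof (rule integral_dominated_convergence[where w="\<lambda>_. M"])
    show "f \<in> borel_measurable \<mu>"
      using f(1) by (simp add: measurable_cong_sets[OF prob_measuresD(2)[OF mu] refl])
    show "test_fun (h m) \<in> borel_measurable \<mu>" for m
      using bounded_continuous_integrable[OF test_fun_bounded_continuous mu] by auto
    show "AE x in \<mu>. (\<lambda>m. test_fun (h m) x) \<longlonglongrightarrow> f x"
      using h(2) by (intro AE_I2) (simp add: prob_measuresD(3)[OF mu])
    show "AE x in \<mu>. norm (test_fun (h m) x) \<le> M" for m
      using order_trans[OF h(1) f(2)]
      by (intro AE_I2) (simp add: prob_measuresD(3)[OF mu] test_fun_nonneg)
  qed auto
qed

text \<open>A portmanteau argument. Approximation from below gives an asymptotic lower bound on the
  integrals of every nonnegative bounded continuous function; applied to \<open>f + M\<close> and to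
  \<open>M - f\<close>, it bounds the integrals of \<open>f\<close> from both sides.\<close>

lemma weakly_converges_iff_test_fun:
  fixes X :: "'x::{metric_space, second_countable_topology} set"
  assumes mun: "\<And>n. \<mu>n n \<in> prob_measures (top_of_set X)" and mu: "\<mu> \<in> prob_measures (top_of_set X)"
  shows "weakly_converges (top_of_set X) \<mu>n \<mu> \<longleftrightarrow>
    (\<forall>k. (\<lambda>n. \<integral>x. test_fun k x \<partial>\<mu>n n) \<longlonglongrightarrow> (\<integral>x. test_fun k x \<partial>\<mu>))"
proof (intro iffI allI)
  fix k assume "weakly_converges (top_of_set X) \<mu>n \<mu>"
  then show "(\<lambda>n. \<integral>x. test_fun k x \<partial>\<mu>n n) \<longlonglongrightarrow> (\<integral>x. test_fun k x \<partial>\<mu>)"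
    unfolding weakly_converges_def using test_fun_bounded_continuous by blast
next
  assume test: "\<forall>k. (\<lambda>n. \<integral>x. test_fun k x \<partial>\<mu>n n) \<longlonglongrightarrow> (\<integral>x. test_fun k x \<partial>\<mu>)"
  have lower: "\<forall>\<^sub>F n in sequentially. (\<integral>x. f x \<partial>\<mu>) - \<epsilon> < (\<integral>x. f x \<partial>\<mu>n n)"
    if f: "f \<in> bounded_continuous (top_of_set X)" and f0: "\<And>x. x \<in> X \<Longrightarrow> 0 \<le> f x" and eps: "\<epsilon> > 0"
    for f and \<epsilon> :: real
  proof -
    obtain M where M': "\<And>x. x \<in> X \<Longrightarrow> \<bar>f x\<bar> \<le> M"
      using f by (auto simp: bounded_continuous_top_of_set bounded_iff)
    have M: "f x \<le> M" if "x \<in> X" for x using M'[OF that] by simp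
    have lsc: "\<exists>\<delta>>0. \<forall>x'\<in>X. dist x' x < \<delta> \<longrightarrow> q < f x'" if x: "x \<in> X" "q < f x" for x q
    proof -
      have pos: "f x - q > 0" using x by simp
      from f x(1) pos obtain \<delta> where "\<delta> > 0" "\<And>x'. x' \<in> X \<Longrightarrow> dist x' x < \<delta> \<Longrightarrow> dist (f x') (f x) < f x - q"
        unfolding bounded_continuous_top_of_set continuous_on_iff by blast
      then show ?thesis by (intro exI[of _ \<delta>]) (force simp: dist_real_def)
    qed
    obtain h :: "nat \<Rightarrow> nat" where h: "\<And>m x. x \<in> X \<Longrightarrow> test_fun (h m) x \<le> f x"
      "\<And>x. x \<in> X \<Longrightarrow> (\<lambda>m. test_fun (h m) x) \<longlonglongrightarrow> f x"
      using lower_semicontinuous_approx_test_fun[of X f] f0 lsc by blast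
    have "(\<lambda>m. \<integral>x. test_fun (h m) x \<partial>\<mu>) \<longlonglongrightarrow> (\<integral>x. f x \<partial>\<mu>)"
      by (rule integral_test_fun_tendsto[OF mu bounded_continuous_measurable[OF f] M h])
    then have "\<forall>\<^sub>F m in sequentially. (\<integral>x. f x \<partial>\<mu>) - \<epsilon> < (\<integral>x. test_fun (h m) x \<partial>\<mu>)"
      using eps by (intro order_tendstoD(1)) auto
    then obtain m where m: "(\<integral>x. f x \<partial>\<mu>) - \<epsilon> < (\<integral>x. test_fun (h m) x \<partial>\<mu>)"
      by (auto simp: eventually_sequentially)
    have "\<forall>\<^sub>F n in sequentially. (\<integral>x. f x \<partial>\<mu>) - \<epsilon> < (\<integral>x. test_fun (h m) x \<partial>\<mu>n n)"
      using test m by (intro order_tendstoD(1)) auto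
    then show ?thesis
    proof eventually_elim
      case (elim n)
      have "(\<integral>x. test_fun (h m) x \<partial>\<mu>n n) \<le> (\<integral>x. f x \<partial>\<mu>n n)"
        using bounded_continuous_integrable[OF f mun] bounded_continuous_integrable[OF test_fun_bounded_continuous mun]
        by (intro integral_mono) (simp_all add: h(1) prob_measuresD(3)[OF mun])
      with elim show ?case by simp
    qed
  qed
  show "weakly_converges (top_of_set X) \<mu>n \<mu>"
    unfolding weakly_converges_def
  proof (intro ballI tendstoI)
    fix f and e :: real assume f: "f \<in> bounded_continuous (top_of_set X)" and e: "e > 0"
    obtain M where M: "\<And>x. x \<in> X \<Longrightarrow> \<bar>f x\<bar> \<le> M"
      using f by (auto simp: bounded_continuous_top_of_set bounded_iff)
    have bp: "(\<lambda>x. f x + M) \<in> bounded_continuous (top_of_set X)"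
      and bm: "(\<lambda>x. M - f x) \<in> bounded_continuous (top_of_set X)"
      using f M by (auto simp: bounded_continuous_top_of_set bounded_iff intro!: continuous_intros exI[of _ "M + M"])
        (smt (verit))+
    have "\<forall>\<^sub>F n in sequentially. (\<integral>x. f x + M \<partial>\<mu>) - e < (\<integral>x. f x + M \<partial>\<mu>n n)"
      using M e by (intro lower[OF bp]) (smt (verit))+
    moreover have "\<forall>\<^sub>F n in sequentially. (\<integral>x. M - f x \<partial>\<mu>) - e < (\<integral>x. M - f x \<partial>\<mu>n n)"
      using M e by (intro lower[OF bm]) (smt (verit))+
    ultimately show "\<forall>\<^sub>F n in sequentially. dist (\<integral>x. f x \<partial>\<mu>n n) (\<integral>x. f x \<partial>\<mu>) < e"
    proof eventually_elim
      case (elim n)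
      interpret mu: prob_space \<mu> using mu by (simp add: prob_measuresD)
      interpret mun: prob_space "\<mu>n n" by (rule prob_measuresD(1)[OF mun])
      note [simp] = bounded_continuous_integrable[OF f mun] bounded_continuous_integrable[OF f mu]
      from elim show ?case
        by (simp add: mu.prob_space mun.prob_space dist_real_def)
    qed
  qed
qed

section \<open>The weak topology and its Borel sets\<close>

text \<open>Coordinates on the space of measures, with values in the second countable space of real
  sequences.\<close>

definition test_integrals :: "'x::{metric_space, second_countable_topology} measure \<Rightarrow> nat \<Rightarrow> real" where
  "test_integrals \<mu> k = (\<integral>x. test_fun k x \<partial>\<mu>)"

lemma continuous_map_weak_topology_integral:
  assumes "f \<in> bounded_continuous S"
  shows "continuous_map (weak_topology S) euclideanreal (\<lambda>\<mu>. integral\<^sup>L \<mu> f)"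
  unfolding continuous_map_def
proof (intro conjI allI impI)
  fix U :: "real set" assume "openin euclideanreal U"
  then show "openin (weak_topology S) {\<mu> \<in> topspace (weak_topology S). integral\<^sup>L \<mu> f \<in> U}"
    unfolding topspace_weak_topology unfolding weak_topology_def
    using assms by (intro topology_generated_by_Basis) auto
qed auto

lemma continuous_map_test_integrals:
  "continuous_map (weak_topology (top_of_set X)) euclidean test_integrals"
proof -
  have "continuous_map (weak_topology (top_of_set X)) (product_topology (\<lambda>_. euclideanreal) UNIV) test_integrals"
    unfolding continuous_map_componentwise_UNIV test_integrals_def
    by (intro allI continuous_map_weak_topology_integral test_fun_bounded_continuous)
  then show ?thesis by (simp only: euclidean_product_topology)
qed

lemma weakly_converges_iff_test_integrals:
  fixes X :: "'x::{metric_space, second_countable_topology} set"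
  assumes "\<And>n. \<mu>n n \<in> prob_measures (top_of_set X)" "\<mu> \<in> prob_measures (top_of_set X)"
  shows "weakly_converges (top_of_set X) \<mu>n \<mu> \<longleftrightarrow>
    (\<forall>k. (\<lambda>n. test_integrals (\<mu>n n) k) \<longlonglongrightarrow> test_integrals \<mu> k)"
  unfolding test_integrals_def using assms by (rule weakly_converges_iff_test_fun)

text \<open>
  The weak topology is the pullback of the product topology of \<open>nat \<Rightarrow> real\<close>; sequences
  suffice to see this because the latter is first countable.
\<close>

lemma openin_weak_topology_iff:
  fixes X :: "'x::{metric_space, second_countable_topology} set"
  shows "openin (weak_topology (top_of_set X)) U \<longleftrightarrow>
    (\<exists>W. open W \<and> U = {\<mu> \<in> prob_measures (top_of_set X). test_integrals \<mu> \<in> W})"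
proof
  assume "\<exists>W. open W \<and> U = {\<mu> \<in> prob_measures (top_of_set X). test_integrals \<mu> \<in> W}"
  then obtain W where W: "open W" "U = {\<mu> \<in> prob_measures (top_of_set X). test_integrals \<mu> \<in> W}"
    by blast
  have "openin euclidean W" using W(1) by (simp only: open_openin)
  from openin_continuous_map_preimage[OF continuous_map_test_integrals[of X] this]
  show "openin (weak_topology (top_of_set X)) U"
    by (simp only: W(2) topspace_weak_topology)
next
  let ?P = "prob_measures (top_of_set X)"
  assume U: "openin (weak_topology (top_of_set X)) U"
  have UP: "U \<subseteq> ?P" using openin_subset[OF U] by simp
  \<comment> \<open>The single number \<open>K\<close> serves both as the number of coordinates and
    as the inverse tolerance. If no \<open>K\<close> worked, counterexamples for
    \<open>K = 0, 1, ...\<close> would converge to \<mu> in every coordinate, hence weakly, and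
    would enter the open set \<open>U\<close>.\<close>
  have ex: "\<exists>K. \<forall>\<mu>'\<in>?P. (\<forall>k<K. \<bar>test_integrals \<mu>' k - test_integrals \<mu> k\<bar> < 1 / (real K + 1)) \<longrightarrow> \<mu>' \<in> U"
    if mu: "\<mu> \<in> U" for \<mu>
  proof (rule ccontr)
    assume "\<not> ?thesis"
    then have "\<forall>K. \<exists>\<mu>'. \<mu>' \<in> ?P \<and> (\<forall>k<K. \<bar>test_integrals \<mu>' k - test_integrals \<mu> k\<bar> < 1 / (real K + 1)) \<and> \<mu>' \<notin> U"
      by blast
    from choice[OF this] obtain m where m: "\<And>K. m K \<in> ?P" "\<And>K. m K \<notin> U"
      "\<And>K k. k < K \<Longrightarrow> \<bar>test_integrals (m K) k - test_integrals \<mu> k\<bar> < 1 / (real K + 1)"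
      by blast
    have muP: "\<mu> \<in> ?P" using mu UP by blast
    have "(\<lambda>K. test_integrals (m K) k) \<longlonglongrightarrow> test_integrals \<mu> k" for k
    proof (rule LIM_zero_cancel, rule Lim_null_comparison)
      show "\<forall>\<^sub>F K in sequentially. norm (test_integrals (m K) k - test_integrals \<mu> k) \<le> 1 / (real K + 1)"
        using eventually_gt_at_top[of k] by eventually_elim (use m(3) in \<open>auto intro: less_imp_le\<close>)
      show "(\<lambda>K. 1 / (real K + 1)) \<longlonglongrightarrow> 0" using LIMSEQ_inverse_real_of_nat by (simp add: inverse_eq_divide add.commute)
    qed
    then have "weakly_converges (top_of_set X) m \<mu>"
      using m(1) muP by (simp add: weakly_converges_iff_test_integrals)
    then have "limitin (weak_topology (top_of_set X)) m \<mu> sequentially"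
      using m(1) muP by (simp add: limitin_weak_topology)
    from limitinD[OF this U mu] m(2) show False by simp
  qed
  have "\<forall>\<mu>\<in>U. \<exists>K. \<forall>\<mu>'\<in>?P. (\<forall>k<K. \<bar>test_integrals \<mu>' k - test_integrals \<mu> k\<bar> < 1 / (real K + 1)) \<longrightarrow> \<mu>' \<in> U"
    by (intro ballI ex)
  from bchoice[OF this] obtain K where
    "\<forall>\<mu>\<in>U. \<forall>\<mu>'\<in>?P. (\<forall>k<K \<mu>. \<bar>test_integrals \<mu>' k - test_integrals \<mu> k\<bar> < 1 / (real (K \<mu>) + 1)) \<longrightarrow> \<mu>' \<in> U" ..
  then have K: "\<And>\<mu> \<mu>'. \<mu> \<in> U \<Longrightarrow> \<mu>' \<in> ?P \<Longrightarrow>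
      (\<And>k. k < K \<mu> \<Longrightarrow> \<bar>test_integrals \<mu>' k - test_integrals \<mu> k\<bar> < 1 / (real (K \<mu>) + 1)) \<Longrightarrow> \<mu>' \<in> U"
    by simp
  define W where "W = (\<Union>\<mu>\<in>U. \<Inter>k<K \<mu>. {y::nat\<Rightarrow>real. \<bar>y k - test_integrals \<mu> k\<bar> < 1 / (real (K \<mu>) + 1)})"
  have "open W"
    unfolding W_def
    by (intro open_UN ballI open_INT finite_lessThan open_Collect_less continuous_intros continuous_on_product_coordinates)
  moreover have "U = {\<mu> \<in> ?P. test_integrals \<mu> \<in> W}"
  proof (intro equalityI subsetI)
    fix \<mu> assume "\<mu> \<in> U"
    then show "\<mu> \<in> {\<mu> \<in> ?P. test_integrals \<mu> \<in> W}"
      using UP by (auto simp: W_def intro!: bexI[of _ \<mu>])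
  next
    fix \<mu>' assume "\<mu>' \<in> {\<mu> \<in> ?P. test_integrals \<mu> \<in> W}"
    then obtain \<mu> where mu: "\<mu>' \<in> ?P" "\<mu> \<in> U"
      "\<And>k. k < K \<mu> \<Longrightarrow> \<bar>test_integrals \<mu>' k - test_integrals \<mu> k\<bar> < 1 / (real (K \<mu>) + 1)"
      by (auto simp: W_def)
    show "\<mu>' \<in> U" by (rule K[OF mu(2,1,3)])
  qed
  ultimately show "\<exists>W. open W \<and> U = {\<mu> \<in> ?P. test_integrals \<mu> \<in> W}" by blast
qed

text \<open>A countable basis is pulled back along \<open>test_integrals\<close>. This is what later
  identifies Borel sets of products involving the space of measures with product-measurable
  sets.\<close>

lemma second_countable_weak_topology:
  fixes X :: "'x::{metric_space, second_countable_topology} set"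
  shows "second_countable (weak_topology (top_of_set X))"
proof -
  let ?pre = "\<lambda>W. {\<mu> \<in> prob_measures (top_of_set X). test_integrals \<mu> \<in> W}"
  obtain B :: "(nat \<Rightarrow> real) set set" where B: "countable B" "topological_basis B"
    using ex_countable_basis by blast
  show ?thesis
    unfolding second_countable_def
  proof (intro exI[of _ "?pre ` B"] conjI ballI allI impI)
    show "countable (?pre ` B)" using B(1) by simp
    show "openin (weak_topology (top_of_set X)) V" if "V \<in> ?pre ` B" for V
      using that topological_basis_open[OF B(2)] by (auto simp: openin_weak_topology_iff)
    fix U \<mu> assume U: "openin (weak_topology (top_of_set X)) U \<and> \<mu> \<in> U"
    then obtain W where W: "open W" "U = ?pre W" by (auto simp: openin_weak_topology_iff)
    with U obtain b where "b \<in> B" "test_integrals \<mu> \<in> b" "b \<subseteq> W"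
      using topological_basisE[OF B(2), of W "test_integrals \<mu>"] by blast
    with U W show "\<exists>V\<in>?pre ` B. \<mu> \<in> V \<and> V \<subseteq> U" by (intro bexI[of _ "?pre b"]) auto
  qed
qed

section \<open>Second countability and the Borel sets of products\<close>

lemma second_countable_top_of_set:
  fixes X :: "'x::second_countable_topology set"
  shows "second_countable (top_of_set X)"
proof -
  obtain B :: "'x set set" where B: "countable B" "topological_basis B"
    using ex_countable_basis by blast
  have "second_countable (euclidean :: 'x topology)"
    unfolding second_countable_def
  proof (intro exI[of _ B] conjI ballI allI impI)
    fix U x assume "openin euclidean U \<and> (x::'x) \<in> U"
    then have "open U" "x \<in> U" by (simp_all only: open_openin)
    then obtain V where "V \<in> B" "x \<in> V" "V \<subseteq> U" by (rule topological_basisE[OF B(2)])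
    then show "\<exists>V\<in>B. x \<in> V \<and> V \<subseteq> U" by blast
  next
    show "openin euclidean V" if "V \<in> B" for V
      using topological_basis_open[OF B(2) that] by (simp only: open_openin)
  qed (use B in auto)
  then show ?thesis by (rule second_countable_subtopology)
qed

lemma second_countable_prod_topology:
  assumes "second_countable S" "second_countable T"
  shows "second_countable (prod_topology S T)"
proof -
  obtain B where B: "countable B" "\<And>V. V \<in> B \<Longrightarrow> openin S V"
    "\<And>U x. openin S U \<Longrightarrow> x \<in> U \<Longrightarrow> \<exists>V\<in>B. x \<in> V \<and> V \<subseteq> U"
    using assms(1) unfolding second_countable_def by meson
  obtain C where C: "countable C" "\<And>V. V \<in> C \<Longrightarrow> openin T V"
    "\<And>U x. openin T U \<Longrightarrow> x \<in> U \<Longrightarrow> \<exists>V\<in>C. x \<in> V \<and> V \<subseteq> U"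
    using assms(2) unfolding second_countable_def by meson
  show ?thesis
    unfolding second_countable_def
  proof (intro exI[of _ "(\<lambda>(b, c). b \<times> c) ` (B \<times> C)"] conjI ballI allI impI)
    show "countable ((\<lambda>(b, c). b \<times> c) ` (B \<times> C))" using B(1) C(1) by simp
    show "openin (prod_topology S T) V" if "V \<in> (\<lambda>(b, c). b \<times> c) ` (B \<times> C)" for V
      using that B(2) C(2) by (auto simp: openin_prod_Times_iff)
    fix U p assume U: "openin (prod_topology S T) U \<and> p \<in> U"
    then have "openin (prod_topology S T) U" "(fst p, snd p) \<in> U" by simp_all
    then have "\<exists>u v. openin S u \<and> openin T v \<and> fst p \<in> u \<and> snd p \<in> v \<and> u \<times> v \<subseteq> U"
      by (rule openin_prod_topology_alt[THEN iffD1, rule_format])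
    then obtain u v where uv: "openin S u" "openin T v" "fst p \<in> u" "snd p \<in> v" "u \<times> v \<subseteq> U"
      by blast
    obtain b where b: "b \<in> B" "fst p \<in> b" "b \<subseteq> u" using B(3)[OF uv(1,3)] by blast
    obtain c where c: "c \<in> C" "snd p \<in> c" "c \<subseteq> v" using C(3)[OF uv(2,4)] by blast
    show "\<exists>V\<in>(\<lambda>(b, c). b \<times> c) ` (B \<times> C). p \<in> V \<and> V \<subseteq> U"
      using b c uv(5) by (intro bexI[of _ "b \<times> c"]) (auto simp: mem_Times_iff)
  qed
qed

text \<open>With countable bases an open set of the product is a countable union of open rectangles;
  the other inclusion is measurability of the projections. Needed with a space of measures as a
  factor.\<close>

lemma sets_borel_of_prod_topology:
  assumes "second_countable S" "second_countable T"
  shows "sets (borel_of (prod_topology S T)) = sets (borel_of S \<Otimes>\<^sub>M borel_of T)"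
proof
  obtain B where B: "countable B" "\<And>V. V \<in> B \<Longrightarrow> openin S V"
    "\<And>U x. openin S U \<Longrightarrow> x \<in> U \<Longrightarrow> \<exists>V\<in>B. x \<in> V \<and> V \<subseteq> U"
    using assms(1) unfolding second_countable_def by meson
  obtain C where C: "countable C" "\<And>V. V \<in> C \<Longrightarrow> openin T V"
    "\<And>U x. openin T U \<Longrightarrow> x \<in> U \<Longrightarrow> \<exists>V\<in>C. x \<in> V \<and> V \<subseteq> U"
    using assms(2) unfolding second_countable_def by meson
  show "sets (borel_of (prod_topology S T)) \<subseteq> sets (borel_of S \<Otimes>\<^sub>M borel_of T)"
    unfolding sets_borel_of
  proof (rule sets.sigma_sets_subset')
    show "topspace (prod_topology S T) \<in> sets (borel_of S \<Otimes>\<^sub>M borel_of T)"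
      using sets.top[of "borel_of S \<Otimes>\<^sub>M borel_of T"] by (simp add: space_pair_measure)
    show "{U. openin (prod_topology S T) U} \<subseteq> sets (borel_of S \<Otimes>\<^sub>M borel_of T)"
    proof
      fix U assume "U \<in> {U. openin (prod_topology S T) U}"
      then have U: "openin (prod_topology S T) U" by simp
      have eq: "U = (\<Union>(b, c)\<in>{(b, c) \<in> B \<times> C. b \<times> c \<subseteq> U}. b \<times> c)"
      proof (intro equalityI subsetI)
        fix p assume "p \<in> U"
        then have "(fst p, snd p) \<in> U" by simp
        with U have "\<exists>u v. openin S u \<and> openin T v \<and> fst p \<in> u \<and> snd p \<in> v \<and> u \<times> v \<subseteq> U"
          by (rule openin_prod_topology_alt[THEN iffD1, rule_format])
        then obtain u v where uv: "openin S u" "openin T v" "fst p \<in> u" "snd p \<in> v" "u \<times> v \<subseteq> U"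
          by blast
        obtain b where b: "b \<in> B" "fst p \<in> b" "b \<subseteq> u" using B(3)[OF uv(1,3)] by blast
        obtain c where c: "c \<in> C" "snd p \<in> c" "c \<subseteq> v" using C(3)[OF uv(2,4)] by blast
        show "p \<in> (\<Union>(b, c)\<in>{(b, c) \<in> B \<times> C. b \<times> c \<subseteq> U}. b \<times> c)"
          using b c uv(5) by (intro UN_I[of "(b, c)"]) (auto simp: mem_Times_iff)
      qed auto
      have "countable {(b, c) \<in> B \<times> C. b \<times> c \<subseteq> U}"
        by (rule countable_subset[of _ "B \<times> C"]) (use B(1) C(1) in auto)
      then have "(\<Union>(b, c)\<in>{(b, c) \<in> B \<times> C. b \<times> c \<subseteq> U}. b \<times> c) \<in> sets (borel_of S \<Otimes>\<^sub>M borel_of T)"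
      proof (rule sets.countable_UN', safe)
        fix b c assume "b \<in> B" "c \<in> C"
        then show "b \<times> c \<in> sets (borel_of S \<Otimes>\<^sub>M borel_of T)"
          using B(2) C(2) by (intro pair_measureI) (auto simp: sets_borel_of)
      qed
      with eq show "U \<in> sets (borel_of S \<Otimes>\<^sub>M borel_of T)" by simp
    qed
  qed
next
  show "sets (borel_of S \<Otimes>\<^sub>M borel_of T) \<subseteq> sets (borel_of (prod_topology S T))"
    unfolding sets_pair_measure
  proof (rule sets.sigma_sets_subset')
    show "{a \<times> b |a b. a \<in> sets (borel_of S) \<and> b \<in> sets (borel_of T)} \<subseteq> sets (borel_of (prod_topology S T))"
    proof clarify
      fix a b assume a: "a \<in> sets (borel_of S)" and b: "b \<in> sets (borel_of T)"
      have "fst -` a \<inter> space (borel_of (prod_topology S T)) \<in> sets (borel_of (prod_topology S T))"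
        by (intro measurable_sets[OF measurable_borel_of_continuous_map[OF continuous_map_fst] a])
      moreover have "snd -` b \<inter> space (borel_of (prod_topology S T)) \<in> sets (borel_of (prod_topology S T))"
        by (intro measurable_sets[OF measurable_borel_of_continuous_map[OF continuous_map_snd] b])
      moreover have "a \<times> b = (fst -` a \<inter> space (borel_of (prod_topology S T))) \<inter> (snd -` b \<inter> space (borel_of (prod_topology S T)))"
        using sets.sets_into_space[OF a] sets.sets_into_space[OF b] by auto
      ultimately show "a \<times> b \<in> sets (borel_of (prod_topology S T))" by simp
    qed
    show "space (borel_of S) \<times> space (borel_of T) \<in> sets (borel_of (prod_topology S T))"
      using sets.top[of "borel_of (prod_topology S T)"] by simp
  qed
qed

section \<open>Weak Borel sets and the sigma-algebra of evaluations\<close>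

text \<open>Evaluation need only be measurable on the intersection-stable generator of open sets.
  The indicator of an open set is lower semicontinuous, so evaluation there is a pointwise limit of
  weakly continuous functions of the measure.\<close>

lemma measurable_weak_topology_subprob_algebra:
  fixes X :: "'x::{metric_space, second_countable_topology} set"
  shows "(\<lambda>\<mu>. \<mu>) \<in> borel_of (weak_topology (top_of_set X)) \<rightarrow>\<^sub>M subprob_algebra (borel_of (top_of_set X))"
proof (rule measurable_subprob_algebra_generated[where \<Omega>=X and G="{U. openin (top_of_set X) U}"])
  show "sets (borel_of (top_of_set X)) = sigma_sets X {U. openin (top_of_set X) U}"
    by (simp add: sets_borel_of)
  show "Int_stable {U. openin (top_of_set X) U}" by (auto simp: Int_stable_def)
  show "{U. openin (top_of_set X) U} \<subseteq> Pow X" by (auto dest!: openin_subset)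
  fix \<mu> assume "\<mu> \<in> space (borel_of (weak_topology (top_of_set X)))"
  then have "\<mu> \<in> prob_measures (top_of_set X)" by simp
  then show "subprob_space \<mu>" "sets \<mu> = sets (borel_of (top_of_set X))"
    by (auto simp: prob_measuresD prob_space_imp_subprob_space)
next
  have main: "(\<lambda>\<mu>. emeasure \<mu> U) \<in> borel_measurable (borel_of (weak_topology (top_of_set X)))"
    if U: "openin (top_of_set X) U" for U
  proof -
    have Ub: "U \<in> sets (borel_of (top_of_set X))" using U by (auto simp: sets_borel_of)
    have UX: "U \<subseteq> X" using openin_subset[OF U] by simp
    have lsc: "\<exists>\<delta>>0. \<forall>x'\<in>X. dist x' x < \<delta> \<longrightarrow> q < (indicator U x' :: real)"
      if x: "x \<in> X" "q < indicator U x" for x q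
    proof (cases "x \<in> U")
      case True
      then obtain \<delta> where "\<delta> > 0" "\<And>x'. x' \<in> X \<Longrightarrow> dist x' x < \<delta> \<Longrightarrow> x' \<in> U"
        using U unfolding openin_euclidean_subtopology_iff by blast
      then show ?thesis using x True by (intro exI[of _ \<delta>]) auto
    next
      case False
      then have "q < 0" using x by simp
      then have "q < indicator U x'" for x' by (rule less_le_trans) simp
      then show ?thesis by (intro exI[of _ 1]) auto
    qed
    obtain h :: "nat \<Rightarrow> nat" where h: "\<And>m x. x \<in> X \<Longrightarrow> test_fun (h m) x \<le> indicator U x"
      "\<And>x. x \<in> X \<Longrightarrow> (\<lambda>m. test_fun (h m) x) \<longlonglongrightarrow> indicator U x"
      using lower_semicontinuous_approx_test_fun[of X "indicator U"] lsc by auto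
    have "(\<lambda>\<mu>. measure \<mu> U) \<in> borel_measurable (borel_of (weak_topology (top_of_set X)))"
    proof (rule borel_measurable_LIMSEQ_real)
      show "(\<lambda>\<mu>. \<integral>x. test_fun (h m) x \<partial>\<mu>) \<in> borel_measurable (borel_of (weak_topology (top_of_set X)))" for m
        using measurable_borel_of_continuous_map[OF continuous_map_weak_topology_integral[OF test_fun_bounded_continuous]]
        by (simp add: measurable_cong_sets[OF refl sets_borel_of_euclidean])
      fix \<mu> assume "\<mu> \<in> space (borel_of (weak_topology (top_of_set X)))"
      then have mu: "\<mu> \<in> prob_measures (top_of_set X)" by simp
      have "(\<lambda>m. \<integral>x. test_fun (h m) x \<partial>\<mu>) \<longlonglongrightarrow> (\<integral>x. indicator U x \<partial>\<mu>)"
        by (rule integral_test_fun_tendsto[OF mu _ _ h, where M=1]) (use Ub in \<open>auto simp: indicator_def\<close>)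
      then show "(\<lambda>m. \<integral>x. test_fun (h m) x \<partial>\<mu>) \<longlonglongrightarrow> measure \<mu> U"
        using Ub UX by (simp add: prob_measuresD[OF mu] Int_absorb2)
    qed
    then have "(\<lambda>\<mu>. ennreal (measure \<mu> U)) \<in> borel_measurable (borel_of (weak_topology (top_of_set X)))"
      by simp
    moreover have "emeasure \<mu> U = ennreal (measure \<mu> U)" if "\<mu> \<in> space (borel_of (weak_topology (top_of_set X)))" for \<mu>
    proof -
      interpret prob_space \<mu> using that by (simp add: prob_measuresD)
      show ?thesis by (rule emeasure_eq_measure)
    qed
    ultimately show ?thesis by (subst measurable_cong) auto
  qed
  show "(\<lambda>\<mu>. emeasure \<mu> U) \<in> borel_measurable (borel_of (weak_topology (top_of_set X)))"
    if "U \<in> {U. openin (top_of_set X) U}" for U using main that by simp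
  show "(\<lambda>\<mu>. emeasure \<mu> X) \<in> borel_measurable (borel_of (weak_topology (top_of_set X)))"
    by (rule main) (metis openin_topspace topspace_euclidean_subtopology)
qed

text \<open>The converse comparison: a weakly open set is a preimage under
  \<open>test_integrals\<close>, and each coordinate is measurable for the evaluations. It turns a
  stochastic kernel into a random element of the space of measures, whose law can then be
  formed.\<close>

lemma measurable_borel_of_weak_topology:
  fixes X :: "'x::{metric_space, second_countable_topology} set"
  assumes K: "K \<in> M \<rightarrow>\<^sub>M subprob_algebra (borel_of (top_of_set X))"
    and prob: "\<And>w. w \<in> space M \<Longrightarrow> K w \<in> prob_measures (top_of_set X)"
  shows "K \<in> M \<rightarrow>\<^sub>M borel_of (weak_topology (top_of_set X))"
proof (subst borel_of_def, rule measurable_measure_of)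
  show "{U. openin (weak_topology (top_of_set X)) U} \<subseteq> Pow (topspace (weak_topology (top_of_set X)))"
    by (auto dest!: openin_subset)
  show "K \<in> space M \<rightarrow> topspace (weak_topology (top_of_set X))" using prob by auto
  fix U assume "U \<in> {U. openin (weak_topology (top_of_set X)) U}"
  then obtain W where W: "open W" "U = {\<mu> \<in> prob_measures (top_of_set X). test_integrals \<mu> \<in> W}"
    by (auto simp: openin_weak_topology_iff)
  have "(\<lambda>w. test_integrals (K w)) \<in> borel_measurable M"
    unfolding test_integrals_def[abs_def]
    by (intro measurable_coordinatewise_then_product measurable_compose[OF K integral_measurable_subprob_algebra]
        bounded_continuous_measurable test_fun_bounded_continuous)
  then have "(\<lambda>w. test_integrals (K w)) -` W \<inter> space M \<in> sets M"
    using W(1) by (intro measurable_sets[where A=borel]) auto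
  moreover have "K -` U \<inter> space M = (\<lambda>w. test_integrals (K w)) -` W \<inter> space M"
    using prob W(2) by auto
  ultimately show "K -` U \<inter> space M \<in> sets M" by simp
qed

text \<open>Posteriors converge only after passing to a subsequence; this recovers convergence of
  integrals along the full sequence.\<close>

lemma tendsto_if_subsequences:
  fixes x :: "nat \<Rightarrow> 'b::metric_space"
  assumes sub: "\<And>r :: nat \<Rightarrow> nat. strict_mono r \<Longrightarrow> \<exists>s :: nat \<Rightarrow> nat. strict_mono s \<and> (\<lambda>k. x (r (s k))) \<longlonglongrightarrow> l"
  shows "x \<longlonglongrightarrow> l"
proof (rule ccontr)
  assume "\<not> ?thesis"
  then obtain e where e: "e > 0" "\<not> (\<forall>\<^sub>F n in sequentially. dist (x n) l < e)"
    unfolding tendsto_iff by blast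
  from e(2) have "\<exists>\<^sub>\<infinity>n. \<not> dist (x n) l < e"
    unfolding not_eventually cofinite_eq_sequentially[symmetric] .
  then have "infinite {n. \<not> dist (x n) l < e}" unfolding frequently_cofinite .
  then obtain r :: "nat \<Rightarrow> nat" where r: "strict_mono r" "\<And>n. r n \<in> {n. \<not> dist (x n) l < e}"
    using infinite_enumerate by blast
  obtain s :: "nat \<Rightarrow> nat" where "(\<lambda>k. x (r (s k))) \<longlonglongrightarrow> l" using sub[OF r(1)] by blast
  from tendstoD[OF this e(1)] obtain k where "dist (x (r (s k))) l < e"
    by (auto simp: eventually_sequentially)
  with r(2)[of "s k"] show False by simp
qed

text \<open>Every weakly open set is a preimage under \<open>test_integrals\<close>, so it cannot
  separate \<mu> from \<mu>'. This spares showing that the two measures are equal.\<close>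

lemma continuous_map_weak_topology_eqI:
  fixes X :: "'x::{metric_space, second_countable_topology} set" and F :: "'x measure \<Rightarrow> real"
  assumes F: "continuous_map (weak_topology (top_of_set X)) euclideanreal F"
    and mu: "\<mu> \<in> prob_measures (top_of_set X)" "\<mu>' \<in> prob_measures (top_of_set X)"
    and eq: "test_integrals \<mu> = test_integrals \<mu>'"
  shows "F \<mu> = F \<mu>'"
proof (rule ccontr)
  assume ne: "F \<mu> \<noteq> F \<mu>'"
  have "open (- {F \<mu>'})" by (rule open_Compl) simp
  then have "openin euclideanreal (- {F \<mu>'})" by (simp only: open_openin)
  from openin_continuous_map_preimage[OF F this]
  obtain W where W: "{\<mu> \<in> prob_measures (top_of_set X). F \<mu> \<in> - {F \<mu>'}} = {\<mu> \<in> prob_measures (top_of_set X). test_integrals \<mu> \<in> W}"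
    unfolding openin_weak_topology_iff topspace_weak_topology by blast
  have "\<mu> \<in> {\<mu> \<in> prob_measures (top_of_set X). F \<mu> \<in> - {F \<mu>'}}" using mu(1) ne by simp
  then have "\<mu>' \<in> {\<mu> \<in> prob_measures (top_of_set X). test_integrals \<mu> \<in> W}" unfolding W using mu(2) eq by simp
  then show False unfolding W[symmetric] by simp
qed

lemma continuous_map_weak_topology_tendsto:
  assumes F: "continuous_map (weak_topology S) euclideanreal F"
    and "\<And>n. \<mu>n n \<in> prob_measures S" "\<mu> \<in> prob_measures S" "weakly_converges S \<mu>n \<mu>"
  shows "(\<lambda>n. F (\<mu>n n)) \<longlonglongrightarrow> F \<mu>"
proof -
  have "limitin (weak_topology S) \<mu>n \<mu> sequentially"
    using assms by (simp add: limitin_weak_topology)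
  from continuous_map_limit[OF F this] show ?thesis by (simp add: o_def)
qed

lemma weakly_converges_subseq:
  assumes "weakly_converges S \<mu>n \<mu>" "strict_mono r"
  shows "weakly_converges S (\<lambda>k. \<mu>n (r k)) \<mu>"
  unfolding weakly_converges_def
proof
  fix f assume "f \<in> bounded_continuous S"
  then have "(\<lambda>n. integral\<^sup>L (\<mu>n n) f) \<longlonglongrightarrow> integral\<^sup>L \<mu> f" using assms(1) by (simp add: weakly_converges_def)
  from LIMSEQ_subseq_LIMSEQ[OF this assms(2)]
  show "(\<lambda>k. integral\<^sup>L (\<mu>n (r k)) f) \<longlonglongrightarrow> integral\<^sup>L \<mu> f" by (simp add: o_def)
qed

section \<open>Total variation\<close>

definition unit_functions :: "'s topology \<Rightarrow> ('s \<Rightarrow> real) set" where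
  "unit_functions S = {\<phi> \<in> borel_measurable (borel_of S). \<forall>s\<in>topspace S. \<bar>\<phi> s\<bar> \<le> 1}"

lemma unit_functionsD:
  assumes "\<phi> \<in> unit_functions S"
  shows "\<phi> \<in> borel_measurable (borel_of S)" "\<And>s. s \<in> topspace S \<Longrightarrow> \<bar>\<phi> s\<bar> \<le> 1"
  using assms by (auto simp: unit_functions_def)

text \<open>The class of test functions is closed under negation, so the one-sided supremum controls
  absolute values, with one threshold for all \<phi>.\<close>

lemma tv_converges_eventually:
  assumes conv: "tv_converges S \<mu>n \<mu>" and mun: "\<And>n. \<mu>n n \<in> prob_measures S" and mu: "\<mu> \<in> prob_measures S"
    and "\<epsilon> > 0"
  shows "\<forall>\<^sub>F n in sequentially. \<forall>\<phi>\<in>unit_functions S. \<bar>integral\<^sup>L (\<mu>n n) \<phi> - integral\<^sup>L \<mu> \<phi>\<bar> < \<epsilon>"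
proof -
  let ?U = "{f \<in> borel_measurable (borel_of S). \<forall>s\<in>topspace S. f s \<in> {-1..1::real}}"
  have U: "?U = unit_functions S" by (auto simp: unit_functions_def abs_le_iff)
  let ?d = "\<lambda>n \<phi>. integral\<^sup>L (\<mu>n n) \<phi> - integral\<^sup>L \<mu> \<phi>"
  have "(\<lambda>n. SUP \<phi>\<in>unit_functions S. ?d n \<phi>) \<longlonglongrightarrow> 0"
    using conv unfolding tv_converges_def U .
  then have "\<forall>\<^sub>F n in sequentially. (SUP \<phi>\<in>unit_functions S. ?d n \<phi>) < \<epsilon>"
    using \<open>\<epsilon> > 0\<close> by (rule order_tendstoD)
  then show ?thesis
  proof eventually_elim
    case (elim n)
    \<comment> \<open>A supremum of reals dominates the members only of a set that is bounded above;
      2 is the sum of the bounds 1 for the two integrals.\<close>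
    have bdd: "bdd_above (?d n ` unit_functions S)"
    proof (rule bdd_aboveI2)
      fix \<phi> assume "\<phi> \<in> unit_functions S"
      note \<phi> = unit_functionsD[OF this]
      show "?d n \<phi> \<le> 2"
        using prob_measures_integral_le[OF mun \<phi>, of n] prob_measures_integral_le[OF mu \<phi>] by simp
    qed
    show ?case
    proof
      fix \<phi> assume \<phi>: "\<phi> \<in> unit_functions S"
      then have \<phi>': "(\<lambda>s. - \<phi> s) \<in> unit_functions S" by (auto simp: unit_functions_def)
      have "?d n \<phi> < \<epsilon>" "?d n (\<lambda>s. - \<phi> s) < \<epsilon>"
        using cSUP_upper[OF \<phi> bdd] cSUP_upper[OF \<phi>' bdd] elim by simp_all
      then show "\<bar>?d n \<phi>\<bar> < \<epsilon>" by simp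
    qed
  qed
qed

text \<open>Sequential continuity becomes an \<epsilon>-\<delta> statement, because failure at all
  radii \<open>1 / (n + 1)\<close> would produce a convergent sequence violating it. Having one
  radius for all \<phi> is the source of equicontinuity.\<close>

lemma tv_continuous_kernel_nhd:
  fixes S :: "'s::metric_space set"
  assumes T: "tv_continuous_kernel Y (top_of_set S) T" and s: "s \<in> S" and "\<epsilon> > 0"
  shows "\<exists>\<delta>>0. \<forall>s'\<in>S. dist s' s < \<delta> \<longrightarrow>
    (\<forall>\<phi>\<in>unit_functions Y. \<bar>integral\<^sup>L (T s') \<phi> - integral\<^sup>L (T s) \<phi>\<bar> < \<epsilon>)"
proof (rule ccontr)
  let ?P = "\<lambda>s'. \<forall>\<phi>\<in>unit_functions Y. \<bar>integral\<^sup>L (T s') \<phi> - integral\<^sup>L (T s) \<phi>\<bar> < \<epsilon>"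
  assume "\<not> ?thesis"
  then have no: "\<And>\<delta>. \<delta> > 0 \<Longrightarrow> \<exists>s'\<in>S. dist s' s < \<delta> \<and> \<not> ?P s'" by blast
  have "\<forall>n. \<exists>s'. s' \<in> S \<and> dist s' s < inverse (real (Suc n)) \<and> \<not> ?P s'"
  proof
    fix n
    have "inverse (real (Suc n)) > 0" by simp
    from no[OF this] show "\<exists>s'. s' \<in> S \<and> dist s' s < inverse (real (Suc n)) \<and> \<not> ?P s'" by blast
  qed
  from choice[OF this] obtain t where
    t: "\<forall>n. t n \<in> S \<and> dist (t n) s < inverse (real (Suc n)) \<and> \<not> ?P (t n)" ..
  have prob: "\<And>s. s \<in> S \<Longrightarrow> T s \<in> prob_measures Y"
    using T by (auto simp: tv_continuous_kernel_def stochastic_kernel_def)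
  have "t \<longlonglongrightarrow> s"
    by (rule metric_tendsto_imp_tendsto[OF LIMSEQ_inverse_real_of_nat])
      (use t in \<open>auto simp: dist_real_def intro!: always_eventually less_imp_le\<close>)
  then have "limitin (top_of_set S) t s sequentially"
    using t s by (simp add: limitin_subtopology)
  then have "tv_converges Y (\<lambda>n. T (t n)) (T s)"
    using T t by (simp add: tv_continuous_kernel_def kernel_continuous_def)
  then have "\<forall>\<^sub>F n in sequentially. ?P (t n)"
    using t s \<open>\<epsilon> > 0\<close> by (intro tv_converges_eventually prob) auto
  then obtain n where "?P (t n)" using eventually_happens'[OF sequentially_bot] by blast
  with t show False by blast
qed

section \<open>L1 distances and almost everywhere convergence\<close>

text \<open>The sign of \<open>f - g\<close> attains the L1 distance. This translates between
  densities, which need not depend continuously on the state, and integrals of unit functions, which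
  do.\<close>

lemma L1_norm_eq_unit_function:
  fixes f g :: "'y \<Rightarrow> real"
  assumes f: "integrable \<nu> f" and g: "integrable \<nu> g" and sets: "sets \<nu> = sets (borel_of Y)"
  obtains \<phi> where "\<phi> \<in> unit_functions Y"
    "(\<integral>y. \<bar>f y - g y\<bar> \<partial>\<nu>) = (\<integral>y. f y * \<phi> y \<partial>\<nu>) - (\<integral>y. g y * \<phi> y \<partial>\<nu>)"
proof -
  define \<phi> where "\<phi> = (\<lambda>y. sgn (f y - g y))"
  have [measurable]: "f \<in> borel_measurable \<nu>" "g \<in> borel_measurable \<nu>" using f g by auto
  have m: "\<phi> \<in> borel_measurable \<nu>"
    unfolding \<phi>_def by measurable
  have "\<phi> \<in> unit_functions Y"
    using m by (auto simp: unit_functions_def measurable_cong_sets[OF sets refl] \<phi>_def sgn_real_def)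
  moreover have "integrable \<nu> (\<lambda>y. f y * \<phi> y)"
    by (rule Bochner_Integration.integrable_bound[OF f]) (use m in \<open>auto simp: \<phi>_def abs_mult sgn_real_def\<close>)
  moreover have "integrable \<nu> (\<lambda>y. g y * \<phi> y)"
    by (rule Bochner_Integration.integrable_bound[OF g]) (use m in \<open>auto simp: \<phi>_def abs_mult sgn_real_def\<close>)
  moreover have "\<bar>f y - g y\<bar> = f y * \<phi> y - g y * \<phi> y" for y
    by (auto simp: \<phi>_def sgn_real_def)
  ultimately show thesis using that[of \<phi>] by simp
qed

text \<open>Summable L1 norms make the sum of all \<open>\<bar>f n\<bar>\<close> integrable, hence
  finite almost everywhere, and the terms of a convergent series vanish.\<close>

lemma AE_tendsto_0_if_L1_le_geometric:
  fixes f :: "nat \<Rightarrow> 'y \<Rightarrow> real"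
  assumes int: "\<And>n. integrable \<nu> (f n)" and le: "\<And>n. (\<integral>y. \<bar>f n y\<bar> \<partial>\<nu>) \<le> (1/2)^n"
  shows "AE y in \<nu>. (\<lambda>n. f n y) \<longlonglongrightarrow> 0"
proof -
  have dm: "(\<lambda>y. ennreal \<bar>f n y\<bar>) \<in> borel_measurable \<nu>" for n using int[of n] by simp
  have le': "(\<integral>\<^sup>+y. ennreal \<bar>f n y\<bar> \<partial>\<nu>) \<le> ennreal ((1/2)^n)" for n
    using le[of n] int[of n] by (simp add: nn_integral_eq_integral)
  have "(\<integral>\<^sup>+y. (\<Sum>n. ennreal \<bar>f n y\<bar>) \<partial>\<nu>) = (\<Sum>n. \<integral>\<^sup>+y. ennreal \<bar>f n y\<bar> \<partial>\<nu>)"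
    by (rule nn_integral_suminf[OF dm])
  also have "\<dots> \<le> (\<Sum>n. ennreal ((1/2)^n))" using le' by (intro suminf_le) auto
  also have "\<dots> < \<infinity>"
    using summable_geometric[of "1/2::real"] by (simp add: suminf_ennreal2)
  finally have "(\<integral>\<^sup>+y. (\<Sum>n. ennreal \<bar>f n y\<bar>) \<partial>\<nu>) \<noteq> \<infinity>" by simp
  then have "AE y in \<nu>. (\<Sum>n. ennreal \<bar>f n y\<bar>) \<noteq> \<infinity>"
    using dm by (intro nn_integral_PInf_AE) auto
  then show ?thesis
  proof eventually_elim
    case (elim y)
    then have "summable (\<lambda>n. \<bar>f n y\<bar>)" by (intro summable_suminf_not_top) auto
    then have "(\<lambda>n. \<bar>f n y\<bar>) \<longlonglongrightarrow> 0" by (rule summable_LIMSEQ_zero)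
    then show ?case by (rule tendsto_rabs_zero_cancel)
  qed
qed

text \<open>One subsequence serves all \<open>k\<close>: stage \<open>j\<close> asks for smallness
  of the sequences \<open>0, ..., j\<close> only, so sequence \<open>k\<close> is geometrically
  small from stage \<open>k\<close> on.\<close>

lemma diagonal_subsequence_AE_tendsto_0:
  fixes u :: "nat \<Rightarrow> nat \<Rightarrow> 'y \<Rightarrow> real"
  assumes int: "\<And>k n. integrable \<nu> (u k n)" and lim: "\<And>k. (\<lambda>n. \<integral>y. \<bar>u k n y\<bar> \<partial>\<nu>) \<longlonglongrightarrow> 0"
  obtains r :: "nat \<Rightarrow> nat" where "strict_mono r" "AE y in \<nu>. \<forall>k. (\<lambda>j. u k (r j) y) \<longlonglongrightarrow> 0"
proof -
  have "\<forall>j. \<exists>N. \<forall>n\<ge>N. \<forall>k\<in>{..j}. (\<integral>y. \<bar>u k n y\<bar> \<partial>\<nu>) < (1/2)^j"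
  proof
    fix j :: nat
    have "\<forall>\<^sub>F n in sequentially. (\<integral>y. \<bar>u k n y\<bar> \<partial>\<nu>) < (1/2)^j" for k
      using lim[of k] by (rule order_tendstoD) simp
    then have "\<forall>\<^sub>F n in sequentially. \<forall>k\<in>{..j}. (\<integral>y. \<bar>u k n y\<bar> \<partial>\<nu>) < (1/2)^j"
      by (intro eventually_ball_finite[OF finite_atMost] ballI)
    then show "\<exists>N. \<forall>n\<ge>N. \<forall>k\<in>{..j}. (\<integral>y. \<bar>u k n y\<bar> \<partial>\<nu>) < (1/2)^j"
      by (simp only: eventually_sequentially)
  qed
  from choice[OF this] obtain N where
    N: "\<forall>j. \<forall>n\<ge>N j. \<forall>k\<in>{..j}. (\<integral>y. \<bar>u k n y\<bar> \<partial>\<nu>) < (1/2)^j" ..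
  \<comment> \<open>Adding up all earlier thresholds makes \<open>r\<close> monotone and at least
    \<open>N j\<close>; the summand \<open>j\<close> makes it strictly monotone.\<close>
  define r where "r j = (\<Sum>i\<le>j. N i) + j" for j
  have "strict_mono r" by (rule strict_monoI_Suc) (simp add: r_def)
  moreover have rN: "N j \<le> r j" for j
    using member_le_sum[of j "{..j}" N] by (simp add: r_def)
  have tail: "AE y in \<nu>. (\<lambda>j. u k (r (j + k)) y) \<longlonglongrightarrow> 0" for k
  proof (rule AE_tendsto_0_if_L1_le_geometric[OF int])
    fix j
    have "(\<integral>y. \<bar>u k (r (j + k)) y\<bar> \<partial>\<nu>) < (1/2)^(j + k)"
      using N rN[of "j + k"] by simp
    also have "\<dots> \<le> (1/2::real)^j" by (rule power_decreasing) auto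
    finally show "(\<integral>y. \<bar>u k (r (j + k)) y\<bar> \<partial>\<nu>) \<le> (1/2)^j" by simp
  qed
  have "AE y in \<nu>. (\<lambda>j. u k (r j) y) \<longlonglongrightarrow> 0" for k
    using tail[of k] by eventually_elim (rule LIMSEQ_offset)
  then have "AE y in \<nu>. \<forall>k. (\<lambda>j. u k (r j) y) \<longlonglongrightarrow> 0" by (simp add: AE_all_countable)
  ultimately show thesis using that by blast
qed

lemma density_integrable:
  fixes f :: "'y \<Rightarrow> real"
  assumes "\<mu> \<in> prob_measures Y" "\<mu> = density \<nu> (\<lambda>y. ennreal (f y))" "f \<in> borel_measurable \<nu>" "\<And>y. 0 \<le> f y"
  shows "integrable \<nu> f"
proof -
  have "(\<integral>\<^sup>+y. ennreal (f y) \<partial>\<nu>) = emeasure \<mu> (space \<mu>)"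
    using assms(2,3) by (simp add: emeasure_density cong: nn_integral_cong)
  also have "\<dots> = 1" using prob_space.emeasure_space_1[OF prob_measuresD(1)[OF assms(1)]] .
  finally show ?thesis using assms(3,4) by (intro integrableI_nonneg) auto
qed

text \<open>
  The density at \<open>s\<close> is the limit of the densities at the centres of balls that contain \<open>s\<close>: for each
  \<open>n\<close>, countably many balls cover \<open>S\<close> on which the kernel varies by less than \<open>2\<^sup>-\<^sup>n\<close>, and the
  first ball containing \<open>s\<close> depends measurably on \<open>s\<close>.
\<close>

lemma tv_continuous_kernel_joint_density:
  fixes S :: "'s::{metric_space, second_countable_topology} set"
  assumes T: "tv_continuous_kernel Y (top_of_set S) T"
  obtains \<nu> :: "'y measure" and q :: "'s \<Rightarrow> 'y \<Rightarrow> real"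
  where "finite_measure \<nu>" "sets \<nu> = sets (borel_of Y)"
    "case_prod q \<in> borel_measurable (borel_of (top_of_set S) \<Otimes>\<^sub>M borel_of Y)"
    "\<And>s y. 0 \<le> q s y" "\<And>s. s \<in> S \<Longrightarrow> T s = density \<nu> (\<lambda>y. ennreal (q s y))"
proof (cases "S = {}")
  case True
  have "finite_measure (null_measure (borel_of Y))" by (rule finite_measureI) simp
  then show ?thesis
    using that[of "null_measure (borel_of Y)" "\<lambda>_ _. 0"] True by simp
next
  case False
  have prob: "\<And>s. s \<in> S \<Longrightarrow> T s \<in> prob_measures Y"
    using T by (auto simp: tv_continuous_kernel_def stochastic_kernel_def)
  define near where "near = (\<lambda>n s' s. \<forall>\<phi>\<in>unit_functions Y. \<bar>integral\<^sup>L (T s') \<phi> - integral\<^sup>L (T s) \<phi>\<bar> < (1/2::real)^n)"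
  define good where "good = (\<lambda>n c \<delta>. (\<forall>i::nat. c i \<in> S) \<and> (\<forall>s\<in>S. \<exists>i. dist s (c i) < \<delta> (c i))
      \<and> (\<forall>s\<in>S. \<forall>s'\<in>S. dist s' s < \<delta> s \<longrightarrow> near n s' s))"
  have ex_c: "\<exists>c \<delta>. good n c \<delta>" for n
  proof -
    have "\<forall>s\<in>S. \<exists>\<delta>. \<delta> > 0 \<and> (\<forall>s'\<in>S. dist s' s < \<delta> \<longrightarrow> near n s' s)"
      unfolding near_def using tv_continuous_kernel_nhd[OF T, of _ "(1/2)^n"] by simp
    from bchoice[OF this] obtain \<delta> where \<delta>: "\<forall>s\<in>S. \<delta> s > 0 \<and> (\<forall>s'\<in>S. dist s' s < \<delta> s \<longrightarrow> near n s' s)" ..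
    obtain c :: "nat \<Rightarrow> 's" where "\<And>i. c i \<in> S" "\<And>s. s \<in> S \<Longrightarrow> \<exists>i. dist s (c i) < \<delta> (c i)"
      using countable_ball_cover[OF False, of \<delta>] \<delta> by blast
    then show ?thesis using \<delta> unfolding good_def by blast
  qed
  then have "\<forall>n. \<exists>c. \<exists>\<delta>. good n c \<delta>" by blast
  from choice[OF this] obtain c where "\<forall>n. \<exists>\<delta>. good n (c n) \<delta>" ..
  from choice[OF this] obtain \<delta> where good: "\<forall>n. good n (c n) (\<delta> n)" ..
  have c: "c n i \<in> S" "s \<in> S \<Longrightarrow> \<exists>i. dist s (c n i) < \<delta> n (c n i)"
    "s \<in> S \<Longrightarrow> dist s (c n i) < \<delta> n (c n i) \<Longrightarrow> near n s (c n i)" for n i s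
    using good unfolding good_def by blast+
  \<comment> \<open>All centres of all levels \<open>n\<close> are listed in one sequence. The
    geometric weights below charge every index, so a null set of the mixture \<nu> is null for each
    \<open>T (t k)\<close>.\<close>
  define t where "t k = (case prod_decode k of (n, i) \<Rightarrow> c n i)" for k
  have tS: "t k \<in> S" for k using c(1) by (simp add: t_def split: prod.split)
  define p where "p = geometric_pmf (1/2)"
  have Tm: "(\<lambda>k. T (t k)) \<in> measure_pmf p \<rightarrow>\<^sub>M subprob_algebra (borel_of Y)"
    by (auto simp: measurable_def space_subprob_algebra prob_measuresD(2)[OF prob[OF tS]]
        intro!: prob_space_imp_subprob_space prob_measuresD(1)[OF prob[OF tS]])
  define \<nu> where "\<nu> = measure_pmf p \<bind> (\<lambda>k. T (t k))"
  have sets_\<nu>: "sets \<nu> = sets (borel_of Y)"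
    unfolding \<nu>_def by (rule sets_bind) (auto simp: prob_measuresD(2)[OF prob[OF tS]])
  have sp_\<nu>: "space \<nu> = topspace Y" using sets_eq_imp_space_eq[OF sets_\<nu>] by simp
  have em_\<nu>: "emeasure \<nu> C = (\<integral>\<^sup>+k. emeasure (T (t k)) C \<partial>measure_pmf p)" if "C \<in> sets (borel_of Y)" for C
    unfolding \<nu>_def using Tm that by (intro emeasure_bind) auto
  interpret \<nu>: finite_measure \<nu>
  proof (rule finite_measureI)
    have "emeasure \<nu> (space \<nu>) = (\<integral>\<^sup>+k. emeasure (T (t k)) (topspace Y) \<partial>measure_pmf p)"
      unfolding sp_\<nu> by (rule em_\<nu>) (metis sets.top space_borel_of)
    also have "\<dots> = (\<integral>\<^sup>+k. 1 \<partial>measure_pmf p)"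
      using prob_space.emeasure_space_1[OF prob_measuresD(1)[OF prob[OF tS]]]
      by (simp add: prob_measuresD(3)[OF prob[OF tS]])
    finally show "emeasure \<nu> (space \<nu>) \<noteq> \<infinity>" by simp
  qed
  \<comment> \<open>A \<nu>-null set has measure 0 under every centre, and at each level
    \<open>n\<close> some centre is within \<open>(1/2)^n\<close> of \<open>T s\<close> in total
    variation.\<close>
  have ac: "absolutely_continuous \<nu> (T s)" if s: "s \<in> S" for s
    unfolding absolutely_continuous_def
  proof
    fix C assume "C \<in> null_sets \<nu>"
    then have C: "C \<in> sets (borel_of Y)" "emeasure \<nu> C = 0" by (auto simp: sets_\<nu>)
    have "AE k in measure_pmf p. emeasure (T (t k)) C = 0"
      using C by (simp add: em_\<nu> nn_integral_0_iff_AE)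
    then have z: "emeasure (T (t k)) C = 0" for k
      by (simp add: AE_measure_pmf_iff p_def set_pmf_geometric)
    interpret prob_space "T s" by (rule prob_measuresD(1)[OF prob[OF s]])
    have CY: "C \<inter> topspace Y = C" using sets.sets_into_space[OF C(1)] by auto
    have phi: "indicator C \<in> unit_functions Y"
      using C by (auto simp: unit_functions_def indicator_def)
    have le: "measure (T s) C \<le> (1/2)^n" for n
    proof -
      obtain i where i: "dist s (c n i) < \<delta> n (c n i)" using c(2)[OF s] by blast
      have "measure (T (c n i)) C = 0"
        using z[of "prod_encode (n, i)"] by (simp add: t_def measure_def)
      moreover have "near n s (c n i)" using c(3)[OF s i] .
      then have "\<bar>integral\<^sup>L (T s) (indicat_real C) - integral\<^sup>L (T (c n i)) (indicat_real C)\<bar> < (1/2)^n"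
        using phi unfolding near_def by blast
      ultimately show ?thesis
        using CY by (simp add: prob_measuresD(3)[OF prob[OF s]] prob_measuresD(3)[OF prob[OF c(1)]])
    qed
    have "measure (T s) C \<le> 0"
      by (rule LIMSEQ_le_const[OF LIMSEQ_power_zero[of "1/2::real"]]) (use le in auto)
    then have "measure (T s) C = 0" by (simp add: measure_le_0_iff)
    then show "C \<in> null_sets (T s)"
      using C(1) by (auto simp: prob_measuresD[OF prob[OF s]] emeasure_eq_measure)
  qed
  have "\<forall>s\<in>S. \<exists>\<rho>. \<rho> \<in> borel_measurable \<nu> \<and> (\<forall>y. 0 \<le> \<rho> y) \<and> T s = density \<nu> (\<lambda>y. ennreal (\<rho> y))"
  proof
    fix s assume s: "s \<in> S"
    interpret T: prob_space "T s" by (rule prob_measuresD(1)[OF prob[OF s]])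
    have sets: "sets (T s) = sets \<nu>" by (simp add: sets_\<nu> prob_measuresD[OF prob[OF s]])
    obtain D where D: "D \<in> borel_measurable \<nu>" "AE y in \<nu>. RN_deriv \<nu> (T s) y = ennreal (D y)" "\<And>y. 0 \<le> D y"
      using \<nu>.real_RN_deriv[OF T.finite_measure_axioms ac[OF s] sets] by metis
    have "T s = density \<nu> (RN_deriv \<nu> (T s))" using \<nu>.density_RN_deriv[OF ac[OF s] sets] by simp
    also have "\<dots> = density \<nu> (\<lambda>y. ennreal (D y))" using D by (intro density_cong) auto
    finally show "\<exists>\<rho>. \<rho> \<in> borel_measurable \<nu> \<and> (\<forall>y. 0 \<le> \<rho> y) \<and> T s = density \<nu> (\<lambda>y. ennreal (\<rho> y))"
      using D by blast
  qed
  \<comment> \<open>These densities are chosen separately for each \<open>s\<close>, so nothing is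
    known about their dependence on \<open>s\<close>. Below, only the countably many at the centres
    enter the joint density.\<close>
  from bchoice[OF this] obtain \<rho> where
    "\<forall>s\<in>S. \<rho> s \<in> borel_measurable \<nu> \<and> (\<forall>y. 0 \<le> \<rho> s y) \<and> T s = density \<nu> (\<lambda>y. ennreal (\<rho> s y))" ..
  then have \<rho>: "\<And>s. s \<in> S \<Longrightarrow> \<rho> s \<in> borel_measurable \<nu>" "\<And>s y. s \<in> S \<Longrightarrow> 0 \<le> \<rho> s y"
    "\<And>s. s \<in> S \<Longrightarrow> T s = density \<nu> (\<lambda>y. ennreal (\<rho> s y))" by auto
  have int_\<rho>: "integrable \<nu> (\<rho> s)" if "s \<in> S" for s
    by (rule density_integrable[OF prob[OF that] \<rho>(3)[OF that] \<rho>(1)[OF that] \<rho>(2)[OF that]])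
  have L1: "(\<integral>y. \<bar>\<rho> s' y - \<rho> s y\<bar> \<partial>\<nu>) \<le> (1/2)^n" if s: "s \<in> S" "s' \<in> S" "near n s s'" for s s' n
  proof -
    obtain \<phi> where \<phi>: "\<phi> \<in> unit_functions Y"
      "(\<integral>y. \<bar>\<rho> s' y - \<rho> s y\<bar> \<partial>\<nu>) = (\<integral>y. \<rho> s' y * \<phi> y \<partial>\<nu>) - (\<integral>y. \<rho> s y * \<phi> y \<partial>\<nu>)"
      using L1_norm_eq_unit_function[OF int_\<rho>[OF s(2)] int_\<rho>[OF s(1)] sets_\<nu>] .
    have "\<phi> \<in> borel_measurable \<nu>" using unit_functionsD(1)[OF \<phi>(1)] by (simp add: measurable_cong_sets[OF sets_\<nu> refl])
    then have "integral\<^sup>L (T u) \<phi> = (\<integral>y. \<rho> u y * \<phi> y \<partial>\<nu>)" if "u \<in> S" for u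
      using \<rho>[OF that] by (simp add: integral_density)
    note eq = this[OF s(1)] this[OF s(2)]
    have "\<bar>integral\<^sup>L (T s) \<phi> - integral\<^sup>L (T s') \<phi>\<bar> < (1/2)^n"
      using \<phi>(1) s(3) unfolding near_def by blast
    then show ?thesis
      unfolding eq \<phi>(2) by linarith
  qed
  define idx where "idx n s = (LEAST i. dist s (c n i) < \<delta> n (c n i))" for n s
  have idx: "dist s (c n (idx n s)) < \<delta> n (c n (idx n s))" if "s \<in> S" for s n
    unfolding idx_def using c(2)[OF that, of n] by (auto intro: LeastI)
  define qn where "qn n s y = \<rho> (c n (idx n s)) y" for n s y
  \<comment> \<open>Where the sequence diverges, \<open>lim\<close> is an unspecified number; the
    cut at 0 keeps \<open>q\<close> nonnegative everywhere and leaves limits of nonnegative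
    densities unchanged.\<close>
  define q where "q s y = max 0 (lim (\<lambda>n. qn n s y))" for s y
  have idxm: "idx n \<in> borel_of (top_of_set S) \<rightarrow>\<^sub>M count_space UNIV" for n
  proof -
    have "Measurable.pred (borel_of (top_of_set S)) (\<lambda>s. dist s (c n i) < \<delta> n (c n i))" for i
    proof -
      have "{s \<in> S. dist s (c n i) < \<delta> n (c n i)} = S \<inter> ball (c n i) (\<delta> n (c n i))"
        by (auto simp: dist_commute)
      then have "openin (top_of_set S) {s \<in> S. dist s (c n i) < \<delta> n (c n i)}"
        by (simp add: openin_open_Int)
      then have "{s \<in> S. dist s (c n i) < \<delta> n (c n i)} \<in> sets (borel_of (top_of_set S))"
        by (auto simp: sets_borel_of)
      then show ?thesis by (simp add: pred_def)
    qed
    then show ?thesis unfolding idx_def by (rule measurable_Least)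
  qed
  have qnm: "case_prod (qn n) \<in> borel_measurable (borel_of (top_of_set S) \<Otimes>\<^sub>M borel_of Y)" for n
  proof -
    have "\<rho> (c n i) \<in> borel_measurable (borel_of Y)" for i
      using \<rho>(1)[OF c(1)] by (simp add: measurable_cong_sets[OF sets_\<nu> refl])
    then have 1: "(\<lambda>z. \<rho> (c n i) (snd z)) \<in> borel_measurable (borel_of (top_of_set S) \<Otimes>\<^sub>M borel_of Y)" for i
      by (rule measurable_compose[OF measurable_snd])
    have 2: "(\<lambda>z. idx n (fst z)) \<in> borel_of (top_of_set S) \<Otimes>\<^sub>M borel_of Y \<rightarrow>\<^sub>M count_space UNIV"
      by (rule measurable_compose[OF measurable_fst idxm])
    from measurable_compose_countable[OF 1 2]
    have "(\<lambda>z. \<rho> (c n (idx n (fst z))) (snd z)) \<in> borel_measurable (borel_of (top_of_set S) \<Otimes>\<^sub>M borel_of Y)" .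
    then show ?thesis unfolding qn_def case_prod_beta' .
  qed
  have qm: "case_prod q \<in> borel_measurable (borel_of (top_of_set S) \<Otimes>\<^sub>M borel_of Y)"
  proof -
    have "(\<lambda>z. max 0 (lim (\<lambda>n. qn n (fst z) (snd z)))) \<in> borel_measurable (borel_of (top_of_set S) \<Otimes>\<^sub>M borel_of Y)"
      using qnm unfolding case_prod_beta' by (intro borel_measurable_max borel_measurable_lim_metric) auto
    then show ?thesis unfolding q_def case_prod_beta' .
  qed
  have Tq: "T s = density \<nu> (\<lambda>y. ennreal (q s y))" if s: "s \<in> S" for s
  proof -
    have "AE y in \<nu>. (\<lambda>n. qn n s y - \<rho> s y) \<longlonglongrightarrow> 0"
    proof (rule AE_tendsto_0_if_L1_le_geometric)
      fix n
      show "integrable \<nu> (\<lambda>y. qn n s y - \<rho> s y)"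
        unfolding qn_def by (intro Bochner_Integration.integrable_diff int_\<rho> s c(1))
      show "(\<integral>y. \<bar>qn n s y - \<rho> s y\<bar> \<partial>\<nu>) \<le> (1/2)^n"
        unfolding qn_def by (rule L1[OF s c(1) c(3)[OF s idx[OF s]]])
    qed
    then have "AE y in \<nu>. q s y = \<rho> s y"
    proof eventually_elim
      case (elim y)
      then have "(\<lambda>n. qn n s y) \<longlonglongrightarrow> \<rho> s y" by (rule LIM_zero_cancel)
      then show ?case using \<rho>(2)[OF s, of y] by (simp add: q_def limI)
    qed
    moreover have "q s \<in> borel_measurable \<nu>"
      using measurable_Pair2[OF qm, of s] s by (simp add: measurable_cong_sets[OF sets_\<nu> refl])
    ultimately show ?thesis
      unfolding \<rho>(3)[OF s] using \<rho>(1)[OF s] by (intro density_cong) auto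
  qed
  show ?thesis
    by (rule that[OF \<nu>.finite_measure_axioms sets_\<nu> qm _ Tq]) (simp add: q_def)
qed

section \<open>The filtering model\<close>

text \<open>The dominating measure and the joint density are parameters, so that all later formulas
  refer to one fixed choice; the final interpretation supplies them.\<close>

locale filter_model =
  fixes X :: "'x::{metric_space, second_countable_topology} set"
    and Y :: "'y::second_countable_topology set"
    and A :: "'a::{metric_space, second_countable_topology} set"
    and P :: "'x \<times> 'a \<Rightarrow> 'x measure" and Q :: "'a \<times> 'x \<Rightarrow> 'y measure"
    and \<nu> :: "'y measure" and q :: "'a \<times> 'x \<Rightarrow> 'y \<Rightarrow> real"
  assumes weakly_continuous_P:
      "weakly_continuous_kernel (top_of_set X) (prod_topology (top_of_set X) (top_of_set A)) P"
    and tv_continuous_Q: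
      "tv_continuous_kernel (top_of_set Y) (prod_topology (top_of_set A) (top_of_set X)) Q"
    and finite_\<nu>: "finite_measure \<nu>" and sets_\<nu>: "sets \<nu> = sets (borel_of (top_of_set Y))"
    and case_prod_q_measurable:
      "case_prod q \<in> borel_measurable (borel_of (prod_topology (top_of_set A) (top_of_set X)) \<Otimes>\<^sub>M borel_of (top_of_set Y))"
    and q_nonneg: "\<And>s y. 0 \<le> q s y"
    and Q_eq_density: "\<And>a x. a \<in> A \<Longrightarrow> x \<in> X \<Longrightarrow> Q (a, x) = density \<nu> (\<lambda>y. ennreal (q (a, x) y))"
begin

abbreviation "BX \<equiv> borel_of (top_of_set X)"
abbreviation "BY \<equiv> borel_of (top_of_set Y)"
abbreviation "BA \<equiv> borel_of (top_of_set A)"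
abbreviation "PX \<equiv> prob_measures (top_of_set X)"
abbreviation "WX \<equiv> weak_topology (top_of_set X)"

sublocale \<nu>: finite_measure \<nu> by (rule finite_\<nu>)

lemma kernel_P: "stochastic_kernel (top_of_set X) (prod_topology (top_of_set X) (top_of_set A)) P"
  using weakly_continuous_P by (simp add: weakly_continuous_kernel_def)

lemma kernel_Q: "stochastic_kernel (top_of_set Y) (prod_topology (top_of_set A) (top_of_set X)) Q"
  using tv_continuous_Q by (simp add: tv_continuous_kernel_def)

lemma P_prob: "x \<in> X \<Longrightarrow> a \<in> A \<Longrightarrow> P (x, a) \<in> PX"
  using kernel_P by (simp add: stochastic_kernel_def)

lemma Q_prob: "a \<in> A \<Longrightarrow> x \<in> X \<Longrightarrow> Q (a, x) \<in> prob_measures (top_of_set Y)"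
  using kernel_Q by (simp add: stochastic_kernel_def)

lemma space_\<nu>: "space \<nu> = Y"
  using sets_eq_imp_space_eq[OF sets_\<nu>] by simp

lemma P_measurable:
  assumes "f \<in> M \<rightarrow>\<^sub>M BX" "g \<in> M \<rightarrow>\<^sub>M BA"
  shows "(\<lambda>w. P (f w, g w)) \<in> M \<rightarrow>\<^sub>M subprob_algebra BX"
proof -
  have "(\<lambda>w. (f w, g w)) \<in> M \<rightarrow>\<^sub>M BX \<Otimes>\<^sub>M BA" using assms by (rule measurable_Pair)
  then have "(\<lambda>w. (f w, g w)) \<in> M \<rightarrow>\<^sub>M borel_of (prod_topology (top_of_set X) (top_of_set A))"
    by (subst measurable_cong_sets[OF refl sets_borel_of_Times])
  from measurable_compose[OF this stochastic_kernel_measurable[OF kernel_P]] show ?thesis .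
qed

lemma q_measurable:
  assumes "f \<in> M \<rightarrow>\<^sub>M BA" "g \<in> M \<rightarrow>\<^sub>M BX" "h \<in> M \<rightarrow>\<^sub>M BY"
  shows "(\<lambda>w. q (f w, g w) (h w)) \<in> borel_measurable M"
proof -
  have "(\<lambda>w. (f w, g w)) \<in> M \<rightarrow>\<^sub>M BA \<Otimes>\<^sub>M BX" using assms(1,2) by (rule measurable_Pair)
  then have "(\<lambda>w. (f w, g w)) \<in> M \<rightarrow>\<^sub>M borel_of (prod_topology (top_of_set A) (top_of_set X))"
    by (subst measurable_cong_sets[OF refl sets_borel_of_Times])
  from measurable_compose[OF measurable_Pair[OF this assms(3)] case_prod_q_measurable]
  show ?thesis by simp
qed

section \<open>The prediction step\<close>

definition predict :: "'x measure \<Rightarrow> 'a \<Rightarrow> 'x measure" where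
  "predict z a = z \<bind> (\<lambda>x. P (x, a))"

lemma P_section_measurable:
  assumes "z \<in> PX" "a \<in> A"
  shows "(\<lambda>x. P (x, a)) \<in> z \<rightarrow>\<^sub>M subprob_algebra BX"
proof -
  have "(\<lambda>x. P (x, a)) \<in> BX \<rightarrow>\<^sub>M subprob_algebra BX"
    using assms(2) by (intro P_measurable) auto
  then show ?thesis by (simp add: measurable_cong_sets[OF prob_measuresD(2)[OF assms(1)] refl])
qed

lemma predict_prob:
  assumes z: "z \<in> PX" and a: "a \<in> A"
  shows "predict z a \<in> PX"
proof -
  interpret z: prob_space z by (rule prob_measuresD(1)[OF z])
  have "AE x in z. prob_space (P (x, a))"
    using a by (intro AE_I2 prob_measuresD(1)[OF P_prob]) (auto simp: prob_measuresD(3)[OF z])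
  then have "prob_space (predict z a)"
    unfolding predict_def using P_section_measurable[OF z a] by (rule z.prob_space_bind)
  moreover have "sets (predict z a) = sets BX"
    unfolding predict_def using a
    by (intro sets_bind z.not_empty) (auto simp: prob_measuresD(3)[OF z] prob_measuresD(2)[OF P_prob])
  ultimately show ?thesis by (simp add: prob_measures_def)
qed

lemma nn_integral_predict:
  assumes "z \<in> PX" "a \<in> A" "f \<in> borel_measurable BX"
  shows "(\<integral>\<^sup>+x'. f x' \<partial>predict z a) = (\<integral>\<^sup>+x. \<integral>\<^sup>+x'. f x' \<partial>P (x, a) \<partial>z)"
  unfolding predict_def by (rule nn_integral_bind[OF assms(3) P_section_measurable[OF assms(1,2)]])

lemma integral_predict:
  fixes f :: "'x \<Rightarrow> real"
  assumes z: "z \<in> PX" and a: "a \<in> A" and f: "f \<in> borel_measurable BX" "\<And>x. x \<in> X \<Longrightarrow> \<bar>f x\<bar> \<le> M"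
  shows "(\<integral>x'. f x' \<partial>predict z a) = (\<integral>x. \<integral>x'. f x' \<partial>P (x, a) \<partial>z)"
  unfolding predict_def
proof (rule integral_bind[OF f(1) _ P_section_measurable[OF z a]])
  show "\<bar>f x\<bar> \<le> M" if "x \<in> space BX" for x using f(2) that by simp
  show "finite_measure z" using prob_measuresD(1)[OF z] by (simp add: prob_space_def)
  show "AE x in z. emeasure (P (x, a)) (space (P (x, a))) \<le> ennreal 1"
    using prob_space.emeasure_space_1[OF prob_measuresD(1)[OF P_prob]] a
    by (intro AE_I2) (simp add: prob_measuresD(3)[OF z])
qed

lemma predict_measurable:
  assumes f: "f \<in> M \<rightarrow>\<^sub>M borel_of WX" and g: "g \<in> M \<rightarrow>\<^sub>M BA"
  shows "(\<lambda>w. predict (f w) (g w)) \<in> M \<rightarrow>\<^sub>M subprob_algebra BX"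
  unfolding predict_def
proof (rule measurable_bind)
  show "f \<in> M \<rightarrow>\<^sub>M subprob_algebra BX"
    by (rule measurable_compose[OF f measurable_weak_topology_subprob_algebra])
  show "(\<lambda>p. P (snd p, g (fst p))) \<in> M \<Otimes>\<^sub>M BX \<rightarrow>\<^sub>M subprob_algebra BX"
    by (intro P_measurable measurable_snd measurable_compose[OF measurable_fst g])
qed

text \<open>The inner integral \<open>g (x, an n)\<close> moves together with the measure
  \<open>zn n\<close>. Joint continuity of \<open>g\<close> keeps it locally uniformly close to
  \<open>g (x, a)\<close>, so the result on moving integrands applies with a limit integrand
  constant in \<open>n\<close>.\<close>

lemma predict_weakly_converges:
  assumes zn: "\<And>n. zn n \<in> PX" and z: "z \<in> PX" and conv: "weakly_converges (top_of_set X) zn z"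
    and an: "\<And>n. an n \<in> A" and a: "a \<in> A" and lim: "an \<longlonglongrightarrow> a"
  shows "weakly_converges (top_of_set X) (\<lambda>n. predict (zn n) (an n)) (predict z a)"
  unfolding weakly_converges_def
proof
  fix f assume f: "f \<in> bounded_continuous (top_of_set X)"
  have fm: "f \<in> borel_measurable BX" by (rule bounded_continuous_measurable[OF f])
  obtain M where M: "\<And>x. x \<in> X \<Longrightarrow> \<bar>f x\<bar> \<le> M"
    using f by (auto simp: bounded_continuous_top_of_set bounded_iff)
  define g where "g p = integral\<^sup>L (P p) f" for p
  have g: "continuous_on (X \<times> A) g"
    unfolding continuous_on_sequentially
  proof (intro allI ballI impI)
    fix s l assume l: "l \<in> X \<times> A" and s: "(\<forall>n. s n \<in> X \<times> A) \<and> s \<longlonglongrightarrow> l"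
    then have "limitin (prod_topology (top_of_set X) (top_of_set A)) s l sequentially"
      unfolding top_of_set_Times by (simp add: limitin_subtopology)
    moreover have "\<forall>n. s n \<in> topspace (prod_topology (top_of_set X) (top_of_set A))" using s by simp
    ultimately have "weakly_converges (top_of_set X) (\<lambda>n. P (s n)) (P l)"
      using weakly_continuous_P unfolding weakly_continuous_kernel_def kernel_continuous_def by blast
    then show "(g \<circ> s) \<longlonglongrightarrow> g l"
      using f by (simp add: weakly_converges_def g_def o_def)
  qed
  have gm: "(\<lambda>x. g (x, b)) \<in> borel_measurable BX" if "b \<in> A" for b
    unfolding g_def using that
    by (intro measurable_compose[OF P_measurable integral_measurable_subprob_algebra[OF fm]]) auto
  have gM: "\<bar>g (x, b)\<bar> \<le> M" if "x \<in> X" "b \<in> A" for x b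
    unfolding g_def using M by (intro prob_measures_integral_le[OF P_prob[OF that] fm]) simp
  have "(\<lambda>n. (\<integral>x. g (x, an n) \<partial>zn n) - (\<integral>x. g (x, a) \<partial>z)) \<longlonglongrightarrow> 0"
  proof (rule weakly_converges_integral_diff_tendsto_0[OF zn z conv, where M=M])
    fix x and \<epsilon> :: real assume x: "x \<in> X" and "\<epsilon> > 0"
    then obtain \<delta> where \<delta>: "\<delta> > 0" "\<And>p. p \<in> X \<times> A \<Longrightarrow> dist p (x, a) < \<delta> \<Longrightarrow> dist (g p) (g (x, a)) < \<epsilon>"
      using g a unfolding continuous_on_iff by (metis SigmaI)
    have near: "\<bar>g (x', b) - g (x, a)\<bar> \<le> \<epsilon>" if x': "x' \<in> X" "b \<in> A" "dist x' x < \<delta> / 2" "dist b a < \<delta> / 2" for x' b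
    proof -
      have "dist (x', b) (x, a) \<le> dist x' x + dist b a"
        by (simp add: dist_Pair_Pair sqrt_sum_squares_le_sum)
      then show ?thesis using \<delta>(2)[of "(x', b)"] x' by (simp add: dist_real_def)
    qed
    have "\<forall>\<^sub>F n in sequentially. dist (an n) a < \<delta> / 2"
      using lim \<delta>(1) by (intro tendstoD) auto
    then have "\<forall>\<^sub>F n in sequentially. \<forall>x'\<in>X. dist x' x < \<delta> / 2 \<longrightarrow>
        \<bar>g (x', an n) - g (x, a)\<bar> \<le> \<epsilon> \<and> \<bar>g (x', a) - g (x, a)\<bar> \<le> \<epsilon>"
      by eventually_elim (use near an a \<delta>(1) in auto)
    then show "\<exists>\<delta>>0. \<forall>\<^sub>F n in sequentially. \<forall>x'\<in>X. dist x' x < \<delta> \<longrightarrow>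
        \<bar>g (x', an n) - g (x, a)\<bar> \<le> \<epsilon> \<and> \<bar>g (x', a) - g (x, a)\<bar> \<le> \<epsilon>"
      using \<delta>(1) by (intro exI[of _ "\<delta> / 2"]) auto
  qed (use gm gM an a in auto)
  moreover have "integral\<^sup>L (predict (zn n) (an n)) f = (\<integral>x. g (x, an n) \<partial>zn n)" for n
    unfolding g_def by (rule integral_predict[OF zn an fm]) (rule M)
  moreover have "integral\<^sup>L (predict z a) f = (\<integral>x. g (x, a) \<partial>z)"
    unfolding g_def by (rule integral_predict[OF z a fm]) (rule M)
  ultimately show "(\<lambda>n. integral\<^sup>L (predict (zn n) (an n)) f) \<longlonglongrightarrow> integral\<^sup>L (predict z a) f"
    by (simp add: LIM_zero_cancel)
qed

section \<open>The joint law and its densities\<close>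

text \<open>The numerator of Bayes' formula, that is, the unnormalised filter integral of
  \<open>h\<close>; for \<open>h = 1\<close> it is the denominator. A divergent integral has value
  0.\<close>

definition obs_density :: "('x \<Rightarrow> real) \<Rightarrow> 'x measure \<Rightarrow> 'a \<Rightarrow> 'y \<Rightarrow> real" where
  "obs_density h z a y = (\<integral>x. h x * q (a, x) y \<partial>predict z a)"

lemma q_pair_measurable:
  assumes "z \<in> PX" "a \<in> A"
  shows "(\<lambda>p. q (a, fst p) (snd p)) \<in> borel_measurable (predict z a \<Otimes>\<^sub>M \<nu>)"
proof -
  have "(\<lambda>p. q (a, fst p) (snd p)) \<in> borel_measurable (BX \<Otimes>\<^sub>M BY)"
    using assms(2) by (intro q_measurable measurable_fst measurable_snd) auto
  then show ?thesis
    by (simp add: measurable_cong_sets[OF sets_pair_measure_cong[OF prob_measuresD(2)[OF predict_prob[OF assms]] sets_\<nu>] refl])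
qed

lemma q_section_measurable:
  assumes "a \<in> A" "x \<in> X"
  shows "q (a, x) \<in> borel_measurable \<nu>"
proof -
  have "(\<lambda>y. q (a, x) y) \<in> borel_measurable BY"
    using assms by (intro q_measurable) auto
  then show ?thesis by (simp add: measurable_cong_sets[OF sets_\<nu> refl])
qed

lemma q_section_integrable:
  assumes "a \<in> A" "x \<in> X"
  shows "integrable \<nu> (q (a, x))" "(\<integral>y. q (a, x) y \<partial>\<nu>) = 1"
proof -
  show int: "integrable \<nu> (q (a, x))"
    by (rule density_integrable[OF Q_prob[OF assms] Q_eq_density[OF assms] q_section_measurable[OF assms] q_nonneg])
  interpret prob_space "Q (a, x)" by (rule prob_measuresD(1)[OF Q_prob[OF assms]])
  have "1 = (\<integral>y. (1::real) \<partial>Q (a, x))" by (simp add: prob_space)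
  also have "\<dots> = (\<integral>y. q (a, x) y \<partial>\<nu>)"
    unfolding Q_eq_density[OF assms] using q_section_measurable[OF assms] q_nonneg by (subst integral_density) auto
  finally show "(\<integral>y. q (a, x) y \<partial>\<nu>) = 1" by simp
qed

text \<open>Joint integrability follows from the bounds on \<open>h\<close> and \<phi> and from
  \<open>q (a, x)\<close> having total mass 1. The third identity is the bridge for all convergence:
  the density disappears in favour of an integral against \<open>Q (a, x)\<close>, which is
  continuous in \<open>(a, x)\<close>.\<close>

lemma obs_density_fubini:
  assumes z: "z \<in> PX" and a: "a \<in> A" and h: "h \<in> borel_measurable BX" "\<And>x. x \<in> X \<Longrightarrow> \<bar>h x\<bar> \<le> M"
    and \<phi>: "\<phi> \<in> unit_functions (top_of_set Y)"
  shows "AE y in \<nu>. integrable (predict z a) (\<lambda>x. h x * q (a, x) y)"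
    and "integrable \<nu> (obs_density h z a)"
    and "(\<integral>y. obs_density h z a y * \<phi> y \<partial>\<nu>) = (\<integral>x. h x * (\<integral>y. \<phi> y \<partial>Q (a, x)) \<partial>predict z a)"
proof -
  let ?m = "predict z a"
  have m: "?m \<in> PX" by (rule predict_prob[OF z a])
  interpret m: prob_space ?m by (rule prob_measuresD(1)[OF m])
  interpret pair_sigma_finite ?m \<nu> ..
  have hm: "h \<in> borel_measurable ?m" using h(1) by (simp add: measurable_cong_sets[OF prob_measuresD(2)[OF m] refl])
  have spm: "space ?m = X" using prob_measuresD(3)[OF m] by simp
  have int: "integrable (?m \<Otimes>\<^sub>M \<nu>) (\<lambda>(x, y). h x * q (a, x) y * \<psi> y)"
    if \<psi>: "\<psi> \<in> unit_functions (top_of_set Y)" for \<psi>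
  proof -
    have \<psi>m: "\<psi> \<in> borel_measurable \<nu>"
      using unit_functionsD(1)[OF \<psi>] by (simp add: measurable_cong_sets[OF sets_\<nu> refl])
    have meas: "(\<lambda>(x, y). h x * q (a, x) y * \<psi> y) \<in> borel_measurable (?m \<Otimes>\<^sub>M \<nu>)"
      unfolding case_prod_beta'
      by (intro borel_measurable_times q_pair_measurable z a measurable_compose[OF measurable_fst hm]
          measurable_compose[OF measurable_snd \<psi>m])
    have qq: "integrable (?m \<Otimes>\<^sub>M \<nu>) (\<lambda>p. q (a, fst p) (snd p))"
    proof (rule Fubini_integrable)
      show "(\<lambda>p. q (a, fst p) (snd p)) \<in> borel_measurable (?m \<Otimes>\<^sub>M \<nu>)"
        by (rule q_pair_measurable[OF z a])
      have "integrable ?m (\<lambda>x. 1::real)" by simp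
      then show "integrable ?m (\<lambda>x. \<integral>y. norm (q (a, fst (x, y)) (snd (x, y))) \<partial>\<nu>)"
        by (rule Bochner_Integration.integrable_cong[THEN iffD1, OF refl, rotated])
          (simp add: spm q_nonneg q_section_integrable(2)[OF a])
      show "AE x in ?m. integrable \<nu> (\<lambda>y. q (a, fst (x, y)) (snd (x, y)))"
        by (rule AE_I2) (simp add: spm q_section_integrable(1)[OF a])
    qed
    show ?thesis
    proof (rule Bochner_Integration.integrable_bound)
      show "integrable (?m \<Otimes>\<^sub>M \<nu>) (\<lambda>p. M * q (a, fst p) (snd p))" using qq by simp
      show "AE p in ?m \<Otimes>\<^sub>M \<nu>. norm (case p of (x, y) \<Rightarrow> h x * q (a, x) y * \<psi> y) \<le> norm (M * q (a, fst p) (snd p))"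
      proof (rule AE_I2)
        fix p assume "p \<in> space (?m \<Otimes>\<^sub>M \<nu>)"
        then obtain x y where p: "p = (x, y)" "x \<in> X" "y \<in> Y" by (auto simp: space_pair_measure spm space_\<nu>)
        have "\<bar>h x\<bar> * q (a, x) y * \<bar>\<psi> y\<bar> \<le> M * q (a, x) y * 1"
          using h(2)[OF p(2)] unit_functionsD(2)[OF \<psi>, of y] p(3) q_nonneg
          by (intro mult_mono mult_nonneg_nonneg) auto
        moreover have "0 \<le> M" using h(2)[OF p(2)] by simp
        ultimately show "norm (case p of (x, y) \<Rightarrow> h x * q (a, x) y * \<psi> y) \<le> norm (M * q (a, fst p) (snd p))"
          by (simp add: p abs_mult q_nonneg)
      qed
    qed (rule meas)
  qed
  \<comment> \<open>The first two claims do not mention \<phi> and are the case of the constant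
    1.\<close>
  have "(\<lambda>_. 1) \<in> unit_functions (top_of_set Y)" by (simp add: unit_functions_def)
  from int[OF this] have int1: "integrable (?m \<Otimes>\<^sub>M \<nu>) (\<lambda>(x, y). h x * q (a, x) y)" by simp
  show "AE y in \<nu>. integrable ?m (\<lambda>x. h x * q (a, x) y)" using AE_integrable_snd[OF int1] .
  show "integrable \<nu> (obs_density h z a)" unfolding obs_density_def[abs_def] using integrable_snd[OF int1] .
  have \<phi>m: "\<phi> \<in> borel_measurable \<nu>"
    using unit_functionsD(1)[OF \<phi>] by (simp add: measurable_cong_sets[OF sets_\<nu> refl])
  have "(\<integral>y. obs_density h z a y * \<phi> y \<partial>\<nu>) = (\<integral>y. (\<integral>x. h x * q (a, x) y * \<phi> y \<partial>?m) \<partial>\<nu>)"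
    by (simp add: obs_density_def)
  also have "\<dots> = (\<integral>x. (\<integral>y. h x * q (a, x) y * \<phi> y \<partial>\<nu>) \<partial>?m)"
    by (rule Fubini_integral[OF int[OF \<phi>]])
  also have "\<dots> = (\<integral>x. h x * (\<integral>y. \<phi> y \<partial>Q (a, x)) \<partial>?m)"
  proof (rule Bochner_Integration.integral_cong[OF refl])
    fix x assume "x \<in> space ?m"
    then have x: "x \<in> X" by (simp add: spm)
    have "(\<integral>y. \<phi> y \<partial>Q (a, x)) = (\<integral>y. q (a, x) y * \<phi> y \<partial>\<nu>)"
      unfolding Q_eq_density[OF a x] using \<phi>m q_section_measurable[OF a x] q_nonneg by (simp add: integral_density)
    then show "(\<integral>y. h x * q (a, x) y * \<phi> y \<partial>\<nu>) = h x * (\<integral>y. \<phi> y \<partial>Q (a, x))"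
      by (simp add: mult.assoc)
  qed
  finally show "(\<integral>y. obs_density h z a y * \<phi> y \<partial>\<nu>) = (\<integral>x. h x * (\<integral>y. \<phi> y \<partial>Q (a, x)) \<partial>?m)" .
qed


lemma Q_measurable:
  assumes "f \<in> M \<rightarrow>\<^sub>M BA" "g \<in> M \<rightarrow>\<^sub>M BX"
  shows "(\<lambda>w. Q (f w, g w)) \<in> M \<rightarrow>\<^sub>M subprob_algebra BY"
proof -
  have "(\<lambda>w. (f w, g w)) \<in> M \<rightarrow>\<^sub>M BA \<Otimes>\<^sub>M BX" using assms by (rule measurable_Pair)
  then have "(\<lambda>w. (f w, g w)) \<in> M \<rightarrow>\<^sub>M borel_of (prod_topology (top_of_set A) (top_of_set X))"
    by (subst measurable_cong_sets[OF refl sets_borel_of_Times])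
  from measurable_compose[OF this stochastic_kernel_measurable[OF kernel_Q]] show ?thesis .
qed

lemma Q_unit_function_le:
  assumes "\<phi> \<in> unit_functions (top_of_set Y)" "a \<in> A" "x \<in> X"
  shows "\<bar>integral\<^sup>L (Q (a, x)) \<phi>\<bar> \<le> 1"
  using unit_functionsD[OF assms(1)] by (intro prob_measures_integral_le[OF Q_prob[OF assms(2,3)]]) auto

lemma obs_density_integrable:
  assumes "z \<in> PX" "a \<in> A" "h \<in> bounded_continuous (top_of_set X)"
  shows "integrable \<nu> (obs_density h z a)"
proof -
  obtain M where M: "\<And>x. x \<in> X \<Longrightarrow> \<bar>h x\<bar> \<le> M"
    using assms(3) by (auto simp: bounded_continuous_top_of_set bounded_iff)
  have "(\<lambda>_. 1) \<in> unit_functions (top_of_set Y)" by (simp add: unit_functions_def)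
  from obs_density_fubini(2)[OF assms(1,2) bounded_continuous_measurable[OF assms(3)] M this]
  show ?thesis by simp
qed

text \<open>The L1 distance is written with a sign function \<open>\<phi> n\<close> and moved by
  Fubini to the state space. There the integrands \<open>h x * U n b x\<close> vary with
  \<open>n\<close>, but they are equicontinuous in \<open>(b, x)\<close> because the radius from
  total variation continuity serves all unit functions.\<close>

lemma obs_density_L1_converges:
  assumes zn: "\<And>n. zn n \<in> PX" and z: "z \<in> PX" and conv: "weakly_converges (top_of_set X) zn z"
    and an: "\<And>n. an n \<in> A" and a: "a \<in> A" and lim: "an \<longlonglongrightarrow> a"
    and h: "h \<in> bounded_continuous (top_of_set X)"
  shows "(\<lambda>n. \<integral>y. \<bar>obs_density h (zn n) (an n) y - obs_density h z a y\<bar> \<partial>\<nu>) \<longlonglongrightarrow> 0"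
proof -
  have hm: "h \<in> borel_measurable BX" by (rule bounded_continuous_measurable[OF h])
  obtain M where M: "\<And>x. x \<in> X \<Longrightarrow> \<bar>h x\<bar> \<le> M"
    using h by (auto simp: bounded_continuous_top_of_set bounded_iff)
  let ?d = "\<lambda>n y. \<bar>obs_density h (zn n) (an n) y - obs_density h z a y\<bar>"
  have "\<forall>n. \<exists>\<phi>. \<phi> \<in> unit_functions (top_of_set Y) \<and> (\<integral>y. ?d n y \<partial>\<nu>) =
      (\<integral>y. obs_density h (zn n) (an n) y * \<phi> y \<partial>\<nu>) - (\<integral>y. obs_density h z a y * \<phi> y \<partial>\<nu>)"
    using L1_norm_eq_unit_function[OF obs_density_integrable[OF zn an h] obs_density_integrable[OF z a h] sets_\<nu>]
    by blast
  from choice[OF this] obtain \<phi> where "\<forall>n. \<phi> n \<in> unit_functions (top_of_set Y) \<and> (\<integral>y. ?d n y \<partial>\<nu>) =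
      (\<integral>y. obs_density h (zn n) (an n) y * \<phi> n y \<partial>\<nu>) - (\<integral>y. obs_density h z a y * \<phi> n y \<partial>\<nu>)" ..
  then have \<phi>: "\<And>n. \<phi> n \<in> unit_functions (top_of_set Y)" and eq: "\<And>n. (\<integral>y. ?d n y \<partial>\<nu>) =
      (\<integral>y. obs_density h (zn n) (an n) y * \<phi> n y \<partial>\<nu>) - (\<integral>y. obs_density h z a y * \<phi> n y \<partial>\<nu>)"
    by auto
  define U where "U n b x = (\<integral>y. \<phi> n y \<partial>Q (b, x))" for n b x
  have U1: "\<bar>U n b x\<bar> \<le> 1" if "b \<in> A" "x \<in> X" for n b x
    unfolding U_def by (rule Q_unit_function_le[OF \<phi> that])
  have fub: "(\<integral>y. obs_density h z' b y * \<phi> n y \<partial>\<nu>) = (\<integral>x. h x * U n b x \<partial>predict z' b)"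
    if "z' \<in> PX" "b \<in> A" for z' b n
    unfolding U_def using obs_density_fubini(3)[OF that hm M \<phi>] by simp
  have Um: "U n b \<in> borel_measurable BX" if "b \<in> A" for n b
    unfolding U_def[abs_def] using that
    by (intro measurable_compose[OF Q_measurable integral_measurable_subprob_algebra[OF unit_functionsD(1)[OF \<phi>]]]) auto
  have "(\<lambda>n. (\<integral>x. h x * U n (an n) x \<partial>predict (zn n) (an n)) - (\<integral>x. h x * U n a x \<partial>predict z a)) \<longlonglongrightarrow> 0"
  proof (rule weakly_converges_integral_diff_tendsto_0[OF predict_prob[OF zn an] predict_prob[OF z a], where M=M])
    show "weakly_converges (top_of_set X) (\<lambda>n. predict (zn n) (an n)) (predict z a)"
      by (rule predict_weakly_converges[OF zn z conv an a lim])
    show "(\<lambda>x. h x * U n (an n) x) \<in> borel_measurable BX" "(\<lambda>x. h x * U n a x) \<in> borel_measurable BX" for n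
      by (intro borel_measurable_times hm Um an a)+
    have hU: "\<bar>h x * U n b x\<bar> \<le> M" if "x \<in> X" "b \<in> A" for n b x
      using mult_mono[OF M[OF that(1)] U1[OF that(2,1), of n]] M[OF that(1)] by (simp add: abs_mult)
    show "\<bar>h x * U n (an n) x\<bar> \<le> M" "\<bar>h x * U n a x\<bar> \<le> M" if "x \<in> X" for n x
      using hU that an a by auto
    fix x and \<epsilon> :: real assume x: "x \<in> X" and eps: "\<epsilon> > 0"
    have M0: "M \<ge> 0" using M[OF x] by simp
    \<comment> \<open>Chosen so that \<open>M * \<eta>\<close> is at most
      \<open>\<epsilon> / 2\<close>; the \<open>+ 1\<close> covers \<open>M = 0\<close>.\<close>
    define \<eta> where "\<eta> = \<epsilon> / (2 * (M + 1))"
    have eta: "\<eta> > 0" "M * \<eta> \<le> \<epsilon> / 2" using M0 eps by (auto simp: \<eta>_def field_simps)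
    have "tv_continuous_kernel (top_of_set Y) (top_of_set (A \<times> X)) Q"
      using tv_continuous_Q by (simp only: top_of_set_Times)
    from tv_continuous_kernel_nhd[OF this, of "(a, x)" \<eta>] a x eta(1)
    obtain \<delta>1 where \<delta>1: "\<delta>1 > 0" "\<And>p \<psi>. p \<in> A \<times> X \<Longrightarrow> dist p (a, x) < \<delta>1 \<Longrightarrow> \<psi> \<in> unit_functions (top_of_set Y) \<Longrightarrow>
        \<bar>integral\<^sup>L (Q p) \<psi> - integral\<^sup>L (Q (a, x)) \<psi>\<bar> < \<eta>"
      by auto
    have "continuous_on X h" using h by (simp add: bounded_continuous_top_of_set)
    then obtain \<delta>2 where \<delta>2: "\<delta>2 > 0" "\<And>x'. x' \<in> X \<Longrightarrow> dist x' x < \<delta>2 \<Longrightarrow> dist (h x') (h x) < \<epsilon> / 2"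
      unfolding continuous_on_iff using x half_gt_zero[OF eps] by blast
    \<comment> \<open>The distance in the product is at most the sum of the coordinate distances,
      hence \<open>\<delta>1 / 2\<close> for each coordinate.\<close>
    define \<delta> where "\<delta> = min (\<delta>1 / 2) \<delta>2"
    have \<delta>: "\<delta> > 0" using \<delta>1(1) \<delta>2(1) by (simp add: \<delta>_def)
    have near: "\<bar>h x' * U n b x' - h x * U n a x\<bar> \<le> \<epsilon>"
      if x': "x' \<in> X" "b \<in> A" "dist x' x < \<delta>" "dist b a < \<delta>" for x' b n
    proof -
      have "dist (b, x') (a, x) \<le> dist b a + dist x' x"
        by (simp add: dist_Pair_Pair sqrt_sum_squares_le_sum)
      then have "dist (b, x') (a, x) < \<delta>1" using x' by (simp add: \<delta>_def)
      then have 1: "\<bar>U n b x' - U n a x\<bar> \<le> \<eta>"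
        using \<delta>1(2)[of "(b, x')" "\<phi> n"] x' \<phi> by (simp add: U_def)
      have 2: "\<bar>h x' - h x\<bar> \<le> \<epsilon> / 2" using \<delta>2(2)[of x'] x' by (simp add: \<delta>_def dist_real_def)
      have "h x' * U n b x' - h x * U n a x = h x' * (U n b x' - U n a x) + (h x' - h x) * U n a x"
        by (simp add: algebra_simps)
      also have "\<bar>\<dots>\<bar> \<le> \<bar>h x'\<bar> * \<bar>U n b x' - U n a x\<bar> + \<bar>h x' - h x\<bar> * \<bar>U n a x\<bar>"
        by (rule order_trans[OF abs_triangle_ineq]) (simp add: abs_mult)
      also have "\<dots> \<le> M * \<eta> + \<epsilon> / 2 * 1"
        using M[OF x'(1)] M0 1 2 U1[OF a x, of n] eps by (intro add_mono mult_mono) auto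
      also have "\<dots> \<le> \<epsilon>" using eta(2) by simp
      finally show ?thesis .
    qed
    have "\<forall>\<^sub>F n in sequentially. dist (an n) a < \<delta>"
      using lim \<delta> by (rule tendstoD)
    then have "\<forall>\<^sub>F n in sequentially. \<forall>x'\<in>X. dist x' x < \<delta> \<longrightarrow>
        \<bar>h x' * U n (an n) x' - h x * U n a x\<bar> \<le> \<epsilon> \<and> \<bar>h x' * U n a x' - h x * U n a x\<bar> \<le> \<epsilon>"
      by eventually_elim (use near an a \<delta> in auto)
    then show "\<exists>\<delta>>0. \<forall>\<^sub>F n in sequentially. \<forall>x'\<in>X. dist x' x < \<delta> \<longrightarrow>
        \<bar>h x' * U n (an n) x' - h x * U n a x\<bar> \<le> \<epsilon> \<and> \<bar>h x' * U n a x' - h x * U n a x\<bar> \<le> \<epsilon>"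
      using \<delta> by blast
  qed
  then show ?thesis unfolding eq using fub zn an z a by simp
qed

section \<open>The joint law and the observation law in terms of densities\<close>

abbreviation "R \<equiv> R_kernel (top_of_set X) (top_of_set Y) P Q"
abbreviation "R' \<equiv> R'_kernel (top_of_set X) (top_of_set Y) P Q"

abbreviation evidence :: "'x measure \<Rightarrow> 'a \<Rightarrow> 'y \<Rightarrow> real" where
  "evidence \<equiv> obs_density (\<lambda>_. 1)"

lemma one_bounded_continuous: "(\<lambda>_. 1) \<in> bounded_continuous (top_of_set X)"
  by (auto simp: bounded_continuous_top_of_set image_constant_conv)

lemma obs_density_nonneg: "(\<And>x. 0 \<le> h x) \<Longrightarrow> 0 \<le> obs_density h z a y"
  unfolding obs_density_def using q_nonneg by (intro integral_nonneg_AE AE_I2) auto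

text \<open>The nested integrals collapse to one integral over the prediction; the Fubini identity
  with \<open>h = indicator B\<close> and \<open>\<phi> = indicator C\<close> then brings in the
  density.\<close>

lemma emeasure_R_Times:
  assumes z: "z \<in> PX" and a: "a \<in> A" and B: "B \<in> sets BX" and C: "C \<in> sets BY"
  shows "emeasure (R (z, a)) (B \<times> C) = (\<integral>\<^sup>+y\<in>C. ennreal (obs_density (indicator B) z a y) \<partial>\<nu>)"
proof -
  have m: "predict z a \<in> PX" by (rule predict_prob[OF z a])
  have spm: "space (predict z a) = X" using prob_measuresD(3)[OF m] by simp
  have CY: "C \<subseteq> Y" using sets.sets_into_space[OF C] by simp
  have Qm: "(\<lambda>x. Q (a, x)) \<in> BX \<rightarrow>\<^sub>M subprob_algebra BY" using a by (intro Q_measurable) auto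
  have Cu: "indicator C \<in> unit_functions (top_of_set Y)" using C by (auto simp: unit_functions_def indicator_def)
  have Qe: "emeasure (Q (a, x)) C = ennreal (measure (Q (a, x)) C)" if "x \<in> X" for x
  proof -
    interpret prob_space "Q (a, x)" by (rule prob_measuresD(1)[OF Q_prob[OF a that]])
    show ?thesis by (rule emeasure_eq_measure)
  qed
  have Qi: "(\<integral>y. indicat_real C y \<partial>Q (a, x)) = measure (Q (a, x)) C" if "x \<in> X" for x
    using CY by (simp add: prob_measuresD(3)[OF Q_prob[OF a that]] Int_absorb2)
  have mQ: "(\<lambda>x. measure (Q (a, x)) C) \<in> borel_measurable BX"
    using measurable_compose[OF Qm measurable_measure_subprob_algebra[OF C]] .
  have "emeasure (R (z, a)) (B \<times> C) = (\<integral>\<^sup>+x. (\<integral>\<^sup>+x'\<in>B. emeasure (Q (a, x')) C \<partial>P (x, a)) \<partial>z)"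
    by (rule emeasure_R_kernel_Times[OF kernel_P kernel_Q z a B C])
  also have "\<dots> = (\<integral>\<^sup>+x'\<in>B. emeasure (Q (a, x')) C \<partial>predict z a)"
  proof (rule nn_integral_predict[OF z a, symmetric])
    have "(\<lambda>x'. emeasure (Q (a, x')) C) \<in> borel_measurable BX"
      using measurable_compose[OF Qm measurable_emeasure_subprob_algebra[OF C]] .
    then show "(\<lambda>x'. emeasure (Q (a, x')) C * indicator B x') \<in> borel_measurable BX" using B by simp
  qed
  also have "\<dots> = (\<integral>\<^sup>+x. ennreal (indicator B x * measure (Q (a, x)) C) \<partial>predict z a)"
    by (rule nn_integral_cong) (auto simp: spm Qe split: split_indicator)
  also have "\<dots> = ennreal (\<integral>x. indicator B x * measure (Q (a, x)) C \<partial>predict z a)"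
  proof (rule nn_integral_eq_integral)
    show "integrable (predict z a) (\<lambda>x. indicator B x * measure (Q (a, x)) C)"
    proof (rule prob_measures_integrable[OF m, where M=1])
      show "(\<lambda>x. indicator B x * measure (Q (a, x)) C) \<in> borel_measurable BX" using B mQ by simp
      fix x assume "x \<in> topspace (top_of_set X)"
      then have "\<bar>measure (Q (a, x)) C\<bar> \<le> 1" using prob_space.prob_le_1[OF prob_measuresD(1)[OF Q_prob[OF a]]] by simp
      then show "\<bar>indicator B x * measure (Q (a, x)) C\<bar> \<le> 1" by (simp split: split_indicator)
    qed
  qed auto
  also have "(\<integral>x. indicator B x * measure (Q (a, x)) C \<partial>predict z a) =
      (\<integral>x. indicator B x * (\<integral>y. indicat_real C y \<partial>Q (a, x)) \<partial>predict z a)"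
    using Qi by (intro Bochner_Integration.integral_cong refl) (simp only: spm)
  also have "\<dots> = (\<integral>y. obs_density (indicator B) z a y * indicator C y \<partial>\<nu>)"
    using B by (intro obs_density_fubini(3)[OF z a _ _ Cu, symmetric, where M=1]) (auto simp: indicator_def)
  also have "ennreal \<dots> = (\<integral>\<^sup>+y. ennreal (obs_density (indicator B) z a y * indicator C y) \<partial>\<nu>)"
  proof (rule nn_integral_eq_integral[symmetric])
    have "integrable \<nu> (obs_density (indicator B) z a)"
      using B by (intro obs_density_fubini(2)[OF z a _ _ Cu, where M=1]) (auto simp: indicator_def)
    then show "integrable \<nu> (\<lambda>y. obs_density (indicator B) z a y * indicator C y)"
      using C by (intro integrable_real_mult_indicator) (auto simp: sets_\<nu>)
    show "AE y in \<nu>. 0 \<le> obs_density (indicator B) z a y * indicator C y"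
      using obs_density_nonneg[of "indicator B" z a] by (intro AE_I2 mult_nonneg_nonneg) auto
  qed
  also have "\<dots> = (\<integral>\<^sup>+y\<in>C. ennreal (obs_density (indicator B) z a y) \<partial>\<nu>)"
    by (intro nn_integral_cong) (simp split: split_indicator)
  finally show ?thesis .
qed

lemma evidence_measurable: "z \<in> PX \<Longrightarrow> a \<in> A \<Longrightarrow> evidence z a \<in> borel_measurable \<nu>"
  using obs_density_integrable[OF _ _ one_bounded_continuous] by auto

lemma R'_eq_density:
  assumes z: "z \<in> PX" and a: "a \<in> A"
  shows "R' (z, a) = density \<nu> (\<lambda>y. ennreal (evidence z a y))"
proof (rule measure_eqI)
  have s: "sets (R' (z, a)) = sets BY" by (simp add: R'_kernel_def)
  then show "sets (R' (z, a)) = sets (density \<nu> (\<lambda>y. ennreal (evidence z a y)))" by (simp add: sets_\<nu>)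
  fix C assume "C \<in> sets (R' (z, a))"
  then have C: "C \<in> sets BY" by (simp only: s)
  have X: "X \<in> sets BX" by (metis sets.top space_borel_of topspace_euclidean_subtopology)
  have eq: "obs_density (indicator X) z a y = evidence z a y" for y
    unfolding obs_density_def using prob_measuresD(3)[OF predict_prob[OF z a]]
    by (intro Bochner_Integration.integral_cong) auto
  show "emeasure (R' (z, a)) C = emeasure (density \<nu> (\<lambda>y. ennreal (evidence z a y))) C"
    using C evidence_measurable[OF z a]
    by (simp add: emeasure_R'_kernel[OF kernel_P kernel_Q z a] emeasure_R_Times[OF z a X] eq emeasure_density sets_\<nu>)
qed

lemma R'_prob:
  assumes z: "z \<in> PX" and a: "a \<in> A"
  shows "R' (z, a) \<in> prob_measures (top_of_set Y)"
proof -
  have s: "sets (R' (z, a)) = sets BY" by (simp add: R'_kernel_def)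
  have one: "(\<lambda>_. 1) \<in> unit_functions (top_of_set Y)" by (simp add: unit_functions_def)
  have "(\<integral>y. evidence z a y * 1 \<partial>\<nu>) = (\<integral>x. 1 * (\<integral>y. 1 \<partial>Q (a, x)) \<partial>predict z a)"
    by (rule obs_density_fubini(3)[OF z a _ _ one, where M=1]) auto
  also have "\<dots> = (\<integral>x. 1 \<partial>predict z a)"
  proof (rule Bochner_Integration.integral_cong[OF refl])
    fix x assume "x \<in> space (predict z a)"
    then have "x \<in> X" using prob_measuresD(3)[OF predict_prob[OF z a]] by simp
    then interpret prob_space "Q (a, x)" by (rule prob_measuresD(1)[OF Q_prob[OF a]])
    show "1 * (\<integral>y. 1 \<partial>Q (a, x)) = (1::real)" by (simp add: prob_space)
  qed
  also have "\<dots> = 1" using prob_space.prob_space[OF prob_measuresD(1)[OF predict_prob[OF z a]]] by simp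
  finally have "(\<integral>y. evidence z a y \<partial>\<nu>) = 1" by simp
  then have "(\<integral>\<^sup>+y. ennreal (evidence z a y) \<partial>\<nu>) = 1"
    using obs_density_integrable[OF z a one_bounded_continuous] obs_density_nonneg[of "\<lambda>_. 1" z a]
    by (simp add: nn_integral_eq_integral)
  then have "prob_space (R' (z, a))"
    unfolding R'_eq_density[OF z a] using evidence_measurable[OF z a]
    by (intro prob_spaceI) (simp add: emeasure_density cong: nn_integral_cong)
  with s show ?thesis by (simp add: prob_measures_def)
qed


section \<open>The posterior\<close>

text \<open>
  Where the evidence integral diverges, its value is 0 by convention, so that the \<open>else\<close> branch
  applies; such \<open>y\<close> form a null set.
\<close>

definition posterior :: "'x measure \<times> 'a \<times> 'y \<Rightarrow> 'x measure" where
  "posterior = (\<lambda>(z, a, y).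
     if 0 < evidence z a y then density (predict z a) (\<lambda>x. ennreal (q (a, x) y / evidence z a y))
     else predict z a)"

lemma q_state_measurable:
  assumes "z \<in> PX" "a \<in> A" "y \<in> Y"
  shows "(\<lambda>x. q (a, x) y) \<in> borel_measurable (predict z a)"
proof -
  have "(\<lambda>x. q (a, x) y) \<in> borel_measurable BX"
    using assms by (intro q_measurable) auto
  then show ?thesis by (simp add: measurable_cong_sets[OF prob_measuresD(2)[OF predict_prob[OF assms(1,2)]] refl])
qed

lemma measurable_predict:
  assumes "z \<in> PX" "a \<in> A" "f \<in> borel_measurable BX"
  shows "f \<in> borel_measurable (predict z a)"
  using assms(3) by (simp add: measurable_cong_sets[OF prob_measuresD(2)[OF predict_prob[OF assms(1,2)]] refl])

text \<open>For nonnegative \<open>h\<close> the integral equals \<open>enn2real\<close> of a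
  nonnegative integral, whose measurability in the kernel is standard. Both sides turn a divergent
  integral into 0, so no integrability condition arises.\<close>

lemma obs_density_measurable:
  assumes f: "f \<in> M \<rightarrow>\<^sub>M borel_of WX" and g: "g \<in> M \<rightarrow>\<^sub>M BA" and k: "k \<in> M \<rightarrow>\<^sub>M BY"
    and h: "h \<in> borel_measurable BX" "\<And>x. 0 \<le> h x"
  shows "(\<lambda>w. obs_density h (f w) (g w) (k w)) \<in> borel_measurable M"
proof -
  have "(\<lambda>p. ennreal (h (snd p) * q (g (fst p), snd p) (k (fst p)))) \<in> borel_measurable (M \<Otimes>\<^sub>M BX)"
    by (intro measurable_compose[OF _ measurable_ennreal] borel_measurable_times measurable_compose[OF measurable_snd h(1)]
        q_measurable measurable_compose[OF measurable_fst g] measurable_compose[OF measurable_fst k] measurable_snd)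
  then have "(\<lambda>(w, x). ennreal (h x * q (g w, x) (k w))) \<in> borel_measurable (M \<Otimes>\<^sub>M BX)"
    unfolding case_prod_beta' .
  from nn_integral_measurable_subprob_algebra2[OF this predict_measurable[OF f g]]
  have "(\<lambda>w. enn2real (\<integral>\<^sup>+x. ennreal (h x * q (g w, x) (k w)) \<partial>predict (f w) (g w))) \<in> borel_measurable M"
    by (rule borel_measurable_enn2real)
  moreover have "obs_density h (f w) (g w) (k w) = enn2real (\<integral>\<^sup>+x. ennreal (h x * q (g w, x) (k w)) \<partial>predict (f w) (g w))"
    if w: "w \<in> space M" for w
  proof -
    have w': "f w \<in> PX" "g w \<in> A" "k w \<in> Y"
      using measurable_space[OF f w] measurable_space[OF g w] measurable_space[OF k w] by auto
    have "(\<lambda>x. h x * q (g w, x) (k w)) \<in> borel_measurable (predict (f w) (g w))"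
      by (intro borel_measurable_times measurable_predict[OF w'(1,2) h(1)] q_state_measurable[OF w'])
    then show ?thesis
      unfolding obs_density_def by (rule integral_eq_nn_integral) (use h q_nonneg in auto)
  qed
  ultimately show ?thesis by (subst measurable_cong) auto
qed

text \<open>Positivity certifies convergence, since a divergent integral would have value 0.\<close>

lemma q_state_integrable:
  assumes "0 < evidence z a y"
  shows "integrable (predict z a) (\<lambda>x. q (a, x) y)"
proof (rule ccontr)
  assume "\<not> ?thesis"
  then have "evidence z a y = 0" by (simp add: obs_density_def not_integrable_integral_eq)
  with assms show False by simp
qed

lemma emeasure_posterior:
  assumes z: "z \<in> PX" and a: "a \<in> A" and y: "y \<in> Y" and pos: "0 < evidence z a y" and B: "B \<in> sets BX"
  shows "emeasure (posterior (z, a, y)) B = ennreal (obs_density (indicator B) z a y / evidence z a y)"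
proof -
  let ?m = "predict z a" and ?e = "evidence z a y"
  have Bm: "B \<in> sets ?m" using B prob_measuresD(2)[OF predict_prob[OF z a]] by simp
  have "emeasure (posterior (z, a, y)) B = (\<integral>\<^sup>+x. ennreal (q (a, x) y / ?e) * indicator B x \<partial>?m)"
    using pos Bm q_state_measurable[OF z a y] by (simp add: posterior_def emeasure_density)
  also have "\<dots> = (\<integral>\<^sup>+x. ennreal (indicator B x * q (a, x) y / ?e) \<partial>?m)"
    by (intro nn_integral_cong) (simp split: split_indicator)
  also have "\<dots> = ennreal (\<integral>x. indicator B x * q (a, x) y / ?e \<partial>?m)"
  proof (rule nn_integral_eq_integral)
    have "integrable ?m (\<lambda>x. q (a, x) y * indicator B x)"
      by (rule integrable_real_mult_indicator[OF Bm q_state_integrable[OF pos]])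
    then show "integrable ?m (\<lambda>x. indicator B x * q (a, x) y / ?e)" by (simp add: mult.commute)
    show "AE x in ?m. 0 \<le> indicator B x * q (a, x) y / ?e"
      using pos q_nonneg by (intro AE_I2 divide_nonneg_pos mult_nonneg_nonneg) auto
  qed
  also have "(\<integral>x. indicator B x * q (a, x) y / ?e \<partial>?m) = obs_density (indicator B) z a y / ?e"
    by (simp add: obs_density_def)
  finally show ?thesis .
qed

lemma integral_posterior:
  assumes z: "z \<in> PX" and a: "a \<in> A" and y: "y \<in> Y" and pos: "0 < evidence z a y" and f: "f \<in> borel_measurable BX"
  shows "integral\<^sup>L (posterior (z, a, y)) f = obs_density f z a y / evidence z a y"
proof -
  have "integral\<^sup>L (posterior (z, a, y)) f = (\<integral>x. (q (a, x) y / evidence z a y) *\<^sub>R f x \<partial>predict z a)"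
    using pos q_nonneg q_state_measurable[OF z a y] measurable_predict[OF z a f]
    by (simp add: posterior_def) (subst integral_density, auto)
  also have "\<dots> = (\<integral>x. f x * q (a, x) y / evidence z a y \<partial>predict z a)"
    by (simp add: mult.commute)
  finally show ?thesis by (simp add: obs_density_def)
qed

lemma posterior_prob:
  assumes z: "z \<in> PX" and a: "a \<in> A" and y: "y \<in> Y"
  shows "posterior (z, a, y) \<in> PX"
proof (cases "0 < evidence z a y")
  case True
  have X: "X \<in> sets BX" by (metis sets.top space_borel_of topspace_euclidean_subtopology)
  have spm: "space (predict z a) = X" using prob_measuresD(3)[OF predict_prob[OF z a]] by simp
  have "obs_density (indicator X) z a y = evidence z a y"
    unfolding obs_density_def using spm
    by (intro Bochner_Integration.integral_cong) auto
  then have "emeasure (posterior (z, a, y)) X = 1"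
    using emeasure_posterior[OF z a y True X] True by simp
  moreover have "space (posterior (z, a, y)) = X" using True spm by (simp add: posterior_def)
  ultimately have "prob_space (posterior (z, a, y))" by (intro prob_spaceI) simp
  moreover have "sets (posterior (z, a, y)) = sets BX"
    using True prob_measuresD(2)[OF predict_prob[OF z a]] by (simp add: posterior_def)
  ultimately show ?thesis by (simp add: prob_measures_def)
next
  case False
  then show ?thesis using predict_prob[OF z a] by (simp add: posterior_def)
qed

section \<open>The posterior as a filter\<close>

abbreviation "ZAY \<equiv> prod_topology WX (prod_topology (top_of_set A) (top_of_set Y))"

lemma ZAY_projections:
  "fst \<in> borel_of ZAY \<rightarrow>\<^sub>M borel_of WX" "(\<lambda>s. fst (snd s)) \<in> borel_of ZAY \<rightarrow>\<^sub>M BA"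
  "(\<lambda>s. snd (snd s)) \<in> borel_of ZAY \<rightarrow>\<^sub>M BY"
proof -
  show "fst \<in> borel_of ZAY \<rightarrow>\<^sub>M borel_of WX"
    by (rule measurable_borel_of_continuous_map[OF continuous_map_fst])
  have s: "snd \<in> borel_of ZAY \<rightarrow>\<^sub>M borel_of (prod_topology (top_of_set A) (top_of_set Y))"
    by (rule measurable_borel_of_continuous_map[OF continuous_map_snd])
  show "(\<lambda>s. fst (snd s)) \<in> borel_of ZAY \<rightarrow>\<^sub>M BA"
    by (rule measurable_compose[OF s measurable_borel_of_continuous_map[OF continuous_map_fst]])
  show "(\<lambda>s. snd (snd s)) \<in> borel_of ZAY \<rightarrow>\<^sub>M BY"
    by (rule measurable_compose[OF s measurable_borel_of_continuous_map[OF continuous_map_snd]])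
qed

lemma posterior_kernel: "stochastic_kernel (top_of_set X) ZAY posterior"
  unfolding stochastic_kernel_def
proof (intro conjI ballI)
  fix s assume "s \<in> topspace ZAY"
  then show "posterior s \<in> PX" using posterior_prob by (cases s) auto
next
  fix B assume B: "B \<in> sets BX"
  let ?M = "borel_of ZAY"
  let ?e = "\<lambda>s. evidence (fst s) (fst (snd s)) (snd (snd s))"
  let ?b = "\<lambda>s. obs_density (indicator B) (fst s) (fst (snd s)) (snd (snd s))"
  have em: "?e \<in> borel_measurable ?M"
    by (rule obs_density_measurable[OF ZAY_projections]) auto
  have bm: "?b \<in> borel_measurable ?M"
    by (rule obs_density_measurable[OF ZAY_projections]) (use B in auto)
  have pm: "(\<lambda>s. measure (predict (fst s) (fst (snd s))) B) \<in> borel_measurable ?M"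
    by (rule measurable_compose[OF predict_measurable[OF ZAY_projections(1,2)] measurable_measure_subprob_algebra[OF B]])
  have "(\<lambda>s. if 0 < ?e s then ?b s / ?e s else measure (predict (fst s) (fst (snd s))) B) \<in> borel_measurable ?M"
    using em bm pm by measurable
  moreover have "measure (posterior s) B = (if 0 < ?e s then ?b s / ?e s else measure (predict (fst s) (fst (snd s))) B)"
    if sp: "s \<in> space ?M" for s
  proof -
    obtain z a y where s: "s = (z, a, y)" "z \<in> PX" "a \<in> A" "y \<in> Y" using sp by (cases s) auto
    have "0 < evidence z a y \<Longrightarrow> measure (posterior (z, a, y)) B = obs_density (indicator B) z a y / evidence z a y"
      using emeasure_posterior[OF s(2-4) _ B] obs_density_nonneg[of "indicator B" z a y] by (simp add: measure_def)
    then show ?thesis by (simp add: s(1)) (simp add: posterior_def)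
  qed
  ultimately show "(\<lambda>s. measure (posterior s) B) \<in> borel_measurable ?M"
    by (subst measurable_cong) auto
qed

text \<open>The density of \<open>R'\<close> cancels the normalisation in Bayes' formula. Where the
  evidence is 0, the numerator for any \<open>B\<close> is dominated by it and is 0 as well, so the
  arbitrary value of the posterior there is harmless.\<close>

lemma posterior_filter_kernel:
  "filter_kernel (top_of_set X) (top_of_set Y) (top_of_set A) P Q posterior"
  unfolding filter_kernel_def
proof (intro conjI ballI posterior_kernel)
  fix B C z a assume B: "B \<in> sets BX" and C: "C \<in> sets BY" and z: "z \<in> PX" and "a \<in> topspace (top_of_set A)"
  then have a: "a \<in> A" by simp
  have one: "(\<lambda>_. 1) \<in> unit_functions (top_of_set Y)" by (simp add: unit_functions_def)
  have sec: "(\<lambda>y. (z, a, y)) \<in> BY \<rightarrow>\<^sub>M borel_of ZAY"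
    using z a by (intro measurable_borel_of_continuous_map continuous_map_pairedI) auto
  have "(\<lambda>y. emeasure (posterior (z, a, y)) B) \<in> borel_measurable BY"
    by (rule measurable_compose[OF measurable_compose[OF sec stochastic_kernel_measurable[OF posterior_kernel]]
          measurable_emeasure_subprob_algebra[OF B]])
  then have pm: "(\<lambda>y. emeasure (posterior (z, a, y)) B * indicator C y) \<in> borel_measurable \<nu>"
    using C by (simp add: measurable_cong_sets[OF sets_\<nu> refl])
  have "(\<integral>\<^sup>+y\<in>C. emeasure (posterior (z, a, y)) B \<partial>R' (z, a)) =
      (\<integral>\<^sup>+y. ennreal (evidence z a y) * (emeasure (posterior (z, a, y)) B * indicator C y) \<partial>\<nu>)"
    unfolding R'_eq_density[OF z a] using evidence_measurable[OF z a] pm by (intro nn_integral_density) auto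
  also have "\<dots> = (\<integral>\<^sup>+y\<in>C. ennreal (obs_density (indicator B) z a y) \<partial>\<nu>)"
  proof (rule nn_integral_cong_AE)
    \<comment> \<open>Observations with divergent evidence must be discarded: the evidence is 0
      there by convention, while the numerator for a smaller \<open>B\<close> could converge to a
      positive value.\<close>
    have "AE y in \<nu>. integrable (predict z a) (\<lambda>x. 1 * q (a, x) y)"
      by (rule obs_density_fubini(1)[OF z a _ _ one, where M=1]) auto
    then show "AE y in \<nu>. ennreal (evidence z a y) * (emeasure (posterior (z, a, y)) B * indicator C y) =
        ennreal (obs_density (indicator B) z a y) * indicator C y"
    proof (rule AE_mp, intro AE_I2 impI)
      fix y assume "y \<in> space \<nu>" and int: "integrable (predict z a) (\<lambda>x. 1 * q (a, x) y)"
      then have y: "y \<in> Y" by (simp add: space_\<nu>)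
      have b0: "0 \<le> obs_density (indicator B) z a y" by (rule obs_density_nonneg) auto
      have "ennreal (evidence z a y) * emeasure (posterior (z, a, y)) B = ennreal (obs_density (indicator B) z a y)"
      proof (cases "0 < evidence z a y")
        case True
        then show ?thesis
          using emeasure_posterior[OF z a y True B] b0 by (simp add: ennreal_mult[symmetric])
      next
        case False
        then have e0: "evidence z a y = 0" using obs_density_nonneg[of "\<lambda>_. 1" z a y] by simp
        have "obs_density (indicator B) z a y \<le> evidence z a y"
          unfolding obs_density_def
        proof (rule integral_mono_AE')
          show "integrable (predict z a) (\<lambda>x. 1 * q (a, x) y)" by (rule int)
          show "AE x in predict z a. indicator B x * q (a, x) y \<le> 1 * q (a, x) y"
            using q_nonneg by (intro AE_I2 mult_right_mono) (auto simp: indicator_def)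
          show "AE x in predict z a. 0 \<le> 1 * q (a, x) y"
            using q_nonneg by (intro AE_I2) auto
        qed
        with b0 e0 show ?thesis by simp
      qed
      then show "ennreal (evidence z a y) * (emeasure (posterior (z, a, y)) B * indicator C y) =
        ennreal (obs_density (indicator B) z a y) * indicator C y"
        by (simp add: mult.assoc[symmetric])
    qed
  qed
  also have "\<dots> = emeasure (R (z, a)) (B \<times> C)" by (rule emeasure_R_Times[OF z a B C, symmetric])
  finally show "emeasure (R (z, a)) (B \<times> C) = (\<integral>\<^sup>+y\<in>C. emeasure (posterior (z, a, y)) B \<partial>R' (z, a))" by simp
qed

text \<open>All numerators and the denominator have to converge at the same \<open>y\<close> along
  the same subsequence; then their ratios, the test integrals of the posteriors, converge wherever
  the limiting evidence is positive.\<close>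

lemma posterior_converges:
  assumes zn: "\<And>n. zn n \<in> PX" and z: "z \<in> PX" and conv: "weakly_converges (top_of_set X) zn z"
    and an: "\<And>n. an n \<in> A" and a: "a \<in> A" and lim: "an \<longlonglongrightarrow> a"
  obtains r C where "strict_mono (r :: nat \<Rightarrow> nat)" "C \<in> sets BY" "measure (R' (z, a)) C = 1"
    "\<And>y. y \<in> C \<Longrightarrow> weakly_converges (top_of_set X) (\<lambda>k. posterior (zn (r k), an (r k), y)) (posterior (z, a, y))"
proof -
  \<comment> \<open>Index 0 is reserved for the constant 1, whose density is the evidence.\<close>
  define h where "h k = (case k of 0 \<Rightarrow> (\<lambda>_::'x. 1) | Suc i \<Rightarrow> test_fun i)" for k
  have h: "h k \<in> bounded_continuous (top_of_set X)" for k
    by (cases k) (simp_all add: h_def one_bounded_continuous test_fun_bounded_continuous)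
  define u where "u k n y = obs_density (h k) (zn n) (an n) y - obs_density (h k) z a y" for k n y
  have int: "integrable \<nu> (u k n)" for k n
    unfolding u_def by (intro Bochner_Integration.integrable_diff obs_density_integrable zn an z a h)
  have L1: "(\<lambda>n. \<integral>y. \<bar>u k n y\<bar> \<partial>\<nu>) \<longlonglongrightarrow> 0" for k
    unfolding u_def by (rule obs_density_L1_converges[OF zn z conv an a lim h])
  obtain r :: "nat \<Rightarrow> nat" where r: "strict_mono r" "AE y in \<nu>. \<forall>k. (\<lambda>j. u k (r j) y) \<longlonglongrightarrow> 0"
    by (rule diagonal_subsequence_AE_tendsto_0[OF int L1])
  let ?good = "\<lambda>y. 0 < evidence z a y \<and> (\<forall>k. (\<lambda>j. u k (r j) y) \<longlonglongrightarrow> 0)"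
  interpret R': prob_space "R' (z, a)" by (rule prob_measuresD(1)[OF R'_prob[OF z a]])
  have sp: "space (R' (z, a)) = Y" using prob_measuresD(3)[OF R'_prob[OF z a]] by simp
  \<comment> \<open>A \<nu>-null set is \<open>R'\<close>-null, and a law with density
    \<open>evidence\<close> does not charge the set where this density vanishes.\<close>
  have "AE y in R' (z, a). ?good y"
    unfolding R'_eq_density[OF z a] using r(2) evidence_measurable[OF z a]
    by (subst AE_density) (auto elim: eventually_mono)
  then obtain N where N: "{y \<in> space (R' (z, a)). \<not> ?good y} \<subseteq> N" "emeasure (R' (z, a)) N = 0" "N \<in> sets (R' (z, a))"
    by (rule AE_E)
  define C where "C = space (R' (z, a)) - N"
  have C: "C \<in> sets BY" using N(3) prob_measuresD(2)[OF R'_prob[OF z a]] by (auto simp: C_def)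
  have C1: "measure (R' (z, a)) C = 1"
    unfolding C_def using R'.prob_compl[OF N(3)] N(2) by (simp add: measure_def)
  have "weakly_converges (top_of_set X) (\<lambda>k. posterior (zn (r k), an (r k), y)) (posterior (z, a, y))"
    if yC: "y \<in> C" for y
  proof -
    have y: "y \<in> Y" using yC by (simp add: C_def sp)
    have "?good y" using N(1) yC by (auto simp: C_def)
    then have pos: "0 < evidence z a y" and lim: "\<And>k. (\<lambda>j. u k (r j) y) \<longlonglongrightarrow> 0" by auto
    have l: "(\<lambda>j. obs_density (h k) (zn (r j)) (an (r j)) y) \<longlonglongrightarrow> obs_density (h k) z a y" for k
      using lim[of k] unfolding u_def by (rule LIM_zero_cancel)
    have le: "(\<lambda>j. evidence (zn (r j)) (an (r j)) y) \<longlonglongrightarrow> evidence z a y"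
      using l[of 0] by (simp add: h_def)
    \<comment> \<open>Along the subsequence the ratio formula is valid only where the evidence is
      positive, which holds from some index on.\<close>
    then have ev: "\<forall>\<^sub>F j in sequentially. 0 < evidence (zn (r j)) (an (r j)) y"
      using pos by (rule order_tendstoD)
    show ?thesis
      unfolding weakly_converges_iff_test_fun[OF posterior_prob[OF zn an y] posterior_prob[OF z a y]]
    proof
      fix i
      have tm: "test_fun i \<in> borel_measurable BX" by (rule bounded_continuous_measurable[OF test_fun_bounded_continuous])
      have "(\<lambda>j. obs_density (test_fun i) (zn (r j)) (an (r j)) y / evidence (zn (r j)) (an (r j)) y)
          \<longlonglongrightarrow> obs_density (test_fun i) z a y / evidence z a y"
        using l[of "Suc i"] le pos by (intro tendsto_divide) (simp_all add: h_def)
      moreover have "\<forall>\<^sub>F j in sequentially. obs_density (test_fun i) (zn (r j)) (an (r j)) y / evidence (zn (r j)) (an (r j)) y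
          = (\<integral>x. test_fun i x \<partial>posterior (zn (r j), an (r j), y))"
        using ev by eventually_elim (simp add: integral_posterior[OF zn an y _ tm])
      ultimately have "(\<lambda>j. \<integral>x. test_fun i x \<partial>posterior (zn (r j), an (r j), y)) \<longlonglongrightarrow> obs_density (test_fun i) z a y / evidence z a y"
        by (rule Lim_transform_eventually)
      then show "(\<lambda>j. \<integral>x. test_fun i x \<partial>posterior (zn (r j), an (r j), y)) \<longlonglongrightarrow> (\<integral>x. test_fun i x \<partial>posterior (z, a, y))"
        by (simp add: integral_posterior[OF z a y pos tm])
    qed
  qed
  with r(1) C C1 that show thesis by blast
qed

lemma limitin_A: "limitin (top_of_set A) an a sequentially \<Longrightarrow> a \<in> A \<and> an \<longlonglongrightarrow> a"
  by (simp add: limitin_subtopology)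

lemma assumption_H: "assumption_H (top_of_set X) (top_of_set Y) (top_of_set A) P Q"
  unfolding assumption_H_def
proof (intro exI[of _ posterior] conjI posterior_filter_kernel allI impI)
  fix zn z an a
  assume *: "(\<forall>n. zn n \<in> PX) \<and> z \<in> PX \<and> weakly_converges (top_of_set X) zn z \<and>
    (\<forall>n. an n \<in> topspace (top_of_set A)) \<and> limitin (top_of_set A) an a sequentially"
  then have "a \<in> A" "an \<longlonglongrightarrow> a" using limitin_A by blast+
  with * obtain r C where "strict_mono (r :: nat \<Rightarrow> nat)" "C \<in> sets BY" "measure (R' (z, a)) C = 1"
    "\<And>y. y \<in> C \<Longrightarrow> weakly_converges (top_of_set X) (\<lambda>k. posterior (zn (r k), an (r k), y)) (posterior (z, a, y))"
    using posterior_converges[of zn z an a] by auto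
  then show "\<exists>r C. strict_mono (r :: nat \<Rightarrow> nat) \<and> C \<in> sets BY \<and> measure (R' (z, a)) C = 1 \<and>
      (\<forall>y\<in>C. weakly_converges (top_of_set X) (\<lambda>k. posterior (zn (r k), an (r k), y)) (posterior (z, a, y)))"
    by blast
qed

section \<open>Continuity of the law of the observation\<close>

text \<open>The bound depends on \<open>f\<close> only through \<open>M\<close>, so it remains
  usable when the integrand changes with the measure, as it does for the law of the
  posterior.\<close>

lemma integral_R'_diff_le:
  fixes f :: "'y \<Rightarrow> real"
  assumes "z1 \<in> PX" "a1 \<in> A" "z2 \<in> PX" "a2 \<in> A"
    and f: "f \<in> borel_measurable BY" "\<And>y. y \<in> Y \<Longrightarrow> \<bar>f y\<bar> \<le> M"
  shows "\<bar>integral\<^sup>L (R' (z1, a1)) f - integral\<^sup>L (R' (z2, a2)) f\<bar>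
    \<le> M * (\<integral>y. \<bar>evidence z1 a1 y - evidence z2 a2 y\<bar> \<partial>\<nu>)"
proof -
  have fm: "f \<in> borel_measurable \<nu>" using f(1) by (simp add: measurable_cong_sets[OF sets_\<nu> refl])
  have eq: "integral\<^sup>L (R' (z, a)) f = (\<integral>y. evidence z a y * f y \<partial>\<nu>)" if "z \<in> PX" "a \<in> A" for z a
    unfolding R'_eq_density[OF that] using evidence_measurable[OF that] fm obs_density_nonneg[of "\<lambda>_. 1"]
    by (subst integral_density) auto
  have int: "integrable \<nu> (evidence z a)" if "z \<in> PX" "a \<in> A" for z a
    by (rule obs_density_integrable[OF that one_bounded_continuous])
  have intf: "integrable \<nu> (\<lambda>y. evidence z a y * f y)" if "z \<in> PX" "a \<in> A" for z a
  proof (rule Bochner_Integration.integrable_bound)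
    show "integrable \<nu> (\<lambda>y. M * evidence z a y)" using int[OF that] by simp
    show "AE y in \<nu>. norm (evidence z a y * f y) \<le> norm (M * evidence z a y)"
    proof (rule AE_I2)
      fix y assume "y \<in> space \<nu>"
      then have fy: "\<bar>f y\<bar> \<le> M" using f(2) by (simp add: space_\<nu>)
      then have "\<bar>f y\<bar> * \<bar>evidence z a y\<bar> \<le> \<bar>M\<bar> * \<bar>evidence z a y\<bar>" by (intro mult_right_mono) auto
      then show "norm (evidence z a y * f y) \<le> norm (M * evidence z a y)" by (simp add: abs_mult mult.commute)
    qed
  qed (use evidence_measurable[OF that] fm in auto)
  have "integral\<^sup>L (R' (z1, a1)) f - integral\<^sup>L (R' (z2, a2)) f =
      (\<integral>y. (evidence z1 a1 y - evidence z2 a2 y) * f y \<partial>\<nu>)"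
    unfolding eq[OF assms(1,2)] eq[OF assms(3,4)]
    using intf[OF assms(1,2)] intf[OF assms(3,4)] by (simp add: left_diff_distrib)
  also have "\<bar>\<dots>\<bar> \<le> (\<integral>y. \<bar>(evidence z1 a1 y - evidence z2 a2 y) * f y\<bar> \<partial>\<nu>)"
    by (rule integral_abs_bound)
  also have "\<dots> \<le> (\<integral>y. M * \<bar>evidence z1 a1 y - evidence z2 a2 y\<bar> \<partial>\<nu>)"
  proof (rule integral_mono)
    show "integrable \<nu> (\<lambda>y. \<bar>(evidence z1 a1 y - evidence z2 a2 y) * f y\<bar>)"
      using intf[OF assms(1,2)] intf[OF assms(3,4)] by (simp add: left_diff_distrib)
    show "integrable \<nu> (\<lambda>y. M * \<bar>evidence z1 a1 y - evidence z2 a2 y\<bar>)"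
      using int[OF assms(1,2)] int[OF assms(3,4)] by simp
    fix y assume "y \<in> space \<nu>"
    then have "\<bar>f y\<bar> \<le> M" using f(2) by (simp add: space_\<nu>)
    then show "\<bar>(evidence z1 a1 y - evidence z2 a2 y) * f y\<bar> \<le> M * \<bar>evidence z1 a1 y - evidence z2 a2 y\<bar>"
      by (simp add: abs_mult mult.commute mult_right_mono)
  qed
  finally show ?thesis by simp
qed

abbreviation "ZA \<equiv> prod_topology WX (top_of_set A)"

lemma R'_kernel_stochastic: "stochastic_kernel (top_of_set Y) ZA R'"
  unfolding stochastic_kernel_def
proof (intro conjI ballI)
  fix s assume "s \<in> topspace ZA"
  then show "R' s \<in> prob_measures (top_of_set Y)" using R'_prob by (cases s) auto
next
  fix C assume C: "C \<in> sets BY"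
  have p: "fst \<in> borel_of ZA \<rightarrow>\<^sub>M borel_of WX" "snd \<in> borel_of ZA \<rightarrow>\<^sub>M BA"
    by (intro measurable_borel_of_continuous_map continuous_map_fst continuous_map_snd)+
  have id: "(\<lambda>y. y) \<in> \<nu> \<rightarrow>\<^sub>M BY" by (rule measurable_ident_sets[OF sets_\<nu>])
  have "(\<lambda>w. evidence (fst (fst w)) (snd (fst w)) (snd w)) \<in> borel_measurable (borel_of ZA \<Otimes>\<^sub>M \<nu>)"
    by (intro obs_density_measurable measurable_compose[OF measurable_fst p(1)] measurable_compose[OF measurable_fst p(2)]
        measurable_compose[OF measurable_snd id]) auto
  moreover have "(\<lambda>w. indicator C (snd w) :: ennreal) \<in> borel_measurable (borel_of ZA \<Otimes>\<^sub>M \<nu>)"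
    using C by (intro measurable_compose[OF measurable_snd] borel_measurable_indicator) (simp add: sets_\<nu>)
  ultimately have "(\<lambda>w. ennreal (evidence (fst (fst w)) (snd (fst w)) (snd w)) * indicator C (snd w))
      \<in> borel_measurable (borel_of ZA \<Otimes>\<^sub>M \<nu>)"
    by simp
  from \<nu>.borel_measurable_nn_integral_fst[OF this]
  have "(\<lambda>s. enn2real (\<integral>\<^sup>+y. ennreal (evidence (fst s) (snd s) y) * indicator C y \<partial>\<nu>)) \<in> borel_measurable (borel_of ZA)"
    by simp
  moreover have "measure (R' s) C = enn2real (\<integral>\<^sup>+y. ennreal (evidence (fst s) (snd s) y) * indicator C y \<partial>\<nu>)"
    if "s \<in> space (borel_of ZA)" for s
    using that C evidence_measurable[of "fst s" "snd s"]
    by (cases s) (simp add: measure_def R'_eq_density emeasure_density sets_\<nu>)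
  ultimately show "(\<lambda>s. measure (R' s) C) \<in> borel_measurable (borel_of ZA)"
    by (subst measurable_cong) auto
qed

lemma limitin_ZA:
  assumes s: "\<forall>n. s n \<in> topspace ZA" and lim: "limitin ZA s l sequentially"
  shows "\<And>n. fst (s n) \<in> PX" "\<And>n. snd (s n) \<in> A" "fst l \<in> PX" "snd l \<in> A"
    "weakly_converges (top_of_set X) (\<lambda>n. fst (s n)) (fst l)" "(\<lambda>n. snd (s n)) \<longlonglongrightarrow> snd l"
proof -
  show s1: "fst (s n) \<in> PX" "snd (s n) \<in> A" for n using spec[OF s, of n] by (auto simp: mem_Times_iff)
  have "limitin WX (\<lambda>n. fst (s n)) (fst l) sequentially" "limitin (top_of_set A) (\<lambda>n. snd (s n)) (snd l) sequentially"
    using lim by (simp_all add: limitin_pairwise o_def)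
  then show "fst l \<in> PX" "snd l \<in> A" "weakly_converges (top_of_set X) (\<lambda>n. fst (s n)) (fst l)" "(\<lambda>n. snd (s n)) \<longlonglongrightarrow> snd l"
    using limitin_A by (auto simp: limitin_weak_topology[OF s1(1)])
qed

lemma R'_setwise_continuous: "setwise_continuous_kernel (top_of_set Y) ZA R'"
  unfolding setwise_continuous_kernel_def kernel_continuous_def setwise_converges_def
proof (intro conjI R'_kernel_stochastic allI impI ballI)
  fix s l f assume "(\<forall>n. s n \<in> topspace ZA) \<and> limitin ZA s l sequentially" and f: "f \<in> bounded_Borel (top_of_set Y)"
  then have s: "\<forall>n. s n \<in> topspace ZA" "limitin ZA s l sequentially" by auto
  note L = limitin_ZA[OF s]
  obtain M where M: "\<And>y. y \<in> Y \<Longrightarrow> \<bar>f y\<bar> \<le> M" and fm: "f \<in> borel_measurable BY"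
    using f by (auto simp: bounded_Borel_def bounded_iff)
  have lim: "(\<lambda>n. M * (\<integral>y. \<bar>evidence (fst (s n)) (snd (s n)) y - evidence (fst l) (snd l) y\<bar> \<partial>\<nu>)) \<longlonglongrightarrow> 0"
    using tendsto_mult_left[OF obs_density_L1_converges[OF L(1,3,5,2,4,6) one_bounded_continuous], of M] by simp
  show "(\<lambda>n. integral\<^sup>L (R' (s n)) f) \<longlonglongrightarrow> integral\<^sup>L (R' l) f"
  proof (rule LIM_zero_cancel, rule Lim_null_comparison[OF always_eventually lim], rule allI)
    fix n
    show "norm (integral\<^sup>L (R' (s n)) f - integral\<^sup>L (R' l) f)
        \<le> M * (\<integral>y. \<bar>evidence (fst (s n)) (snd (s n)) y - evidence (fst l) (snd l) y\<bar> \<partial>\<nu>)"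
      using integral_R'_diff_le[OF L(1,2)[of n] L(3,4) fm, of M] M by simp
  qed
qed


section \<open>The law of the posterior\<close>

lemma filter_kernelD:
  assumes "filter_kernel (top_of_set X) (top_of_set Y) (top_of_set A) P Q H"
  shows "stochastic_kernel (top_of_set X) ZAY H"
    and "z \<in> PX \<Longrightarrow> a \<in> A \<Longrightarrow> y \<in> Y \<Longrightarrow> H (z, a, y) \<in> PX"
    and "B \<in> sets BX \<Longrightarrow> C \<in> sets BY \<Longrightarrow> z \<in> PX \<Longrightarrow> a \<in> A \<Longrightarrow>
      emeasure (R (z, a)) (B \<times> C) = (\<integral>\<^sup>+y\<in>C. emeasure (H (z, a, y)) B \<partial>R' (z, a))"
  using assms by (simp_all add: filter_kernel_def stochastic_kernel_def)

lemma filter_kernel_measurable: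
  assumes "filter_kernel (top_of_set X) (top_of_set Y) (top_of_set A) P Q H"
  shows "H \<in> borel_of ZAY \<rightarrow>\<^sub>M borel_of WX"
proof (rule measurable_borel_of_weak_topology)
  show "H \<in> borel_of ZAY \<rightarrow>\<^sub>M subprob_algebra BX"
    by (rule stochastic_kernel_measurable[OF filter_kernelD(1)[OF assms]])
  show "H w \<in> PX" if "w \<in> space (borel_of ZAY)" for w
    using filter_kernelD(1)[OF assms] that by (simp only: stochastic_kernel_def space_borel_of)
qed

lemma observation_section_measurable:
  assumes "z \<in> PX" "a \<in> A"
  shows "(\<lambda>y. (z, a, y)) \<in> R' (z, a) \<rightarrow>\<^sub>M borel_of ZAY"
proof -
  have "(\<lambda>y. (z, a, y)) \<in> BY \<rightarrow>\<^sub>M borel_of ZAY"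
    using assms by (intro measurable_borel_of_continuous_map continuous_map_pairedI) auto
  then show ?thesis by (subst measurable_cong_sets[OF prob_measuresD(2)[OF R'_prob[OF assms]] refl])
qed

text \<open>Restrict \<open>R'\<close> to \<open>C\<close> and mix the filter over it: by (F) the
  mixture gives \<open>B\<close> the mass of \<open>B \<times> C\<close> under \<open>R\<close>,
  whichever filter is used. Equality of the mixtures then passes from sets to integrands.\<close>

lemma filter_kernel_nn_integral:
  assumes H: "filter_kernel (top_of_set X) (top_of_set Y) (top_of_set A) P Q H"
    and K: "filter_kernel (top_of_set X) (top_of_set Y) (top_of_set A) P Q K"
    and z: "z \<in> PX" and a: "a \<in> A" and C: "C \<in> sets BY" and f: "f \<in> borel_measurable BX"
  shows "(\<integral>\<^sup>+y\<in>C. \<integral>\<^sup>+x. f x \<partial>H (z, a, y) \<partial>R' (z, a)) = (\<integral>\<^sup>+y\<in>C. \<integral>\<^sup>+x. f x \<partial>K (z, a, y) \<partial>R' (z, a))"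
proof -
  interpret R': prob_space "R' (z, a)" by (rule prob_measuresD(1)[OF R'_prob[OF z a]])
  have C': "C \<in> sets (R' (z, a))" using C prob_measuresD(2)[OF R'_prob[OF z a]] by simp
  have sp: "space (R' (z, a)) = Y" using prob_measuresD(3)[OF R'_prob[OF z a]] by simp
  define D where "D = density (R' (z, a)) (indicator C)"
  have spD: "space D = Y" and neD: "space D \<noteq> {}" using R'.not_empty by (simp_all add: D_def sp)
  have Gm: "(\<lambda>y. G (z, a, y)) \<in> D \<rightarrow>\<^sub>M subprob_algebra BX"
    if G: "filter_kernel (top_of_set X) (top_of_set Y) (top_of_set A) P Q G" for G
    unfolding D_def
    using measurable_compose[OF observation_section_measurable[OF z a] stochastic_kernel_measurable[OF filter_kernelD(1)[OF G]]]
    by simp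
  have intD: "(\<integral>\<^sup>+y. g y \<partial>D) = (\<integral>\<^sup>+y\<in>C. g y \<partial>R' (z, a))" if "g \<in> borel_measurable (R' (z, a))" for g
    unfolding D_def using that C' by (simp add: nn_integral_density mult.commute)
  have em: "emeasure (D \<bind> (\<lambda>y. G (z, a, y))) B = emeasure (R (z, a)) (B \<times> C)"
    if G: "filter_kernel (top_of_set X) (top_of_set Y) (top_of_set A) P Q G" and B: "B \<in> sets BX" for G B
  proof -
    have "(\<lambda>y. emeasure (G (z, a, y)) B) \<in> borel_measurable (R' (z, a))"
      using measurable_compose[OF Gm[OF G] measurable_emeasure_subprob_algebra[OF B]] by (simp add: D_def)
    then show ?thesis
      unfolding emeasure_bind[OF neD Gm[OF G] B] filter_kernelD(3)[OF G B C z a] by (rule intD)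
  qed
  have setsb: "sets (D \<bind> (\<lambda>y. G (z, a, y))) = sets BX"
    if G: "filter_kernel (top_of_set X) (top_of_set Y) (top_of_set A) P Q G" for G
    using filter_kernelD(2)[OF G z a] spD by (intro sets_bind neD prob_measuresD(2)) simp
  have bind_eq: "D \<bind> (\<lambda>y. H (z, a, y)) = D \<bind> (\<lambda>y. K (z, a, y))"
    by (rule measure_eqI) (simp_all add: setsb[OF H] setsb[OF K] em[OF H] em[OF K])
  have "(\<integral>\<^sup>+y\<in>C. \<integral>\<^sup>+x. f x \<partial>G (z, a, y) \<partial>R' (z, a)) = (\<integral>\<^sup>+x. f x \<partial>(D \<bind> (\<lambda>y. G (z, a, y))))"
    if G: "filter_kernel (top_of_set X) (top_of_set Y) (top_of_set A) P Q G" for G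
  proof -
    have "(\<lambda>y. \<integral>\<^sup>+x. f x \<partial>G (z, a, y)) \<in> borel_measurable (R' (z, a))"
      using measurable_compose[OF Gm[OF G] nn_integral_measurable_subprob_algebra[OF f]] by (simp add: D_def)
    from intD[OF this] show ?thesis
      by (simp add: nn_integral_bind[OF f Gm[OF G]])
  qed
  from this[OF H] this[OF K] bind_eq show ?thesis by simp
qed

text \<open>For each test function the two filter integrals have equal integrals over every
  \<open>C\<close>, so they agree as densities with respect to \<open>R'\<close>. Countability of
  the test functions yields one common null set.\<close>

lemma filter_kernel_AE_unique:
  assumes H: "filter_kernel (top_of_set X) (top_of_set Y) (top_of_set A) P Q H"
    and K: "filter_kernel (top_of_set X) (top_of_set Y) (top_of_set A) P Q K"
    and z: "z \<in> PX" and a: "a \<in> A"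
  shows "AE y in R' (z, a). test_integrals (H (z, a, y)) = test_integrals (K (z, a, y))"
proof -
  interpret R': prob_space "R' (z, a)" by (rule prob_measuresD(1)[OF R'_prob[OF z a]])
  have sp: "space (R' (z, a)) = Y" using prob_measuresD(3)[OF R'_prob[OF z a]] by simp
  have "AE y in R' (z, a). test_integrals (H (z, a, y)) k = test_integrals (K (z, a, y)) k" for k
  proof -
    define f where "f x = ennreal (test_fun k x)" for x :: 'x
    have tm: "test_fun k \<in> borel_measurable BX" by (rule bounded_continuous_measurable[OF test_fun_bounded_continuous])
    then have f: "f \<in> borel_measurable BX" unfolding f_def by simp
    have m: "(\<lambda>y. \<integral>\<^sup>+x. f x \<partial>G (z, a, y)) \<in> borel_measurable (R' (z, a))"
      if G: "filter_kernel (top_of_set X) (top_of_set Y) (top_of_set A) P Q G" for G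
      by (rule measurable_compose[OF measurable_compose[OF observation_section_measurable[OF z a]
            stochastic_kernel_measurable[OF filter_kernelD(1)[OF G]]] nn_integral_measurable_subprob_algebra[OF f]])
    have "density (R' (z, a)) (\<lambda>y. \<integral>\<^sup>+x. f x \<partial>H (z, a, y)) = density (R' (z, a)) (\<lambda>y. \<integral>\<^sup>+x. f x \<partial>K (z, a, y))"
    proof (rule measure_eqI)
      fix C assume "C \<in> sets (density (R' (z, a)) (\<lambda>y. \<integral>\<^sup>+x. f x \<partial>H (z, a, y)))"
      then have C: "C \<in> sets (R' (z, a))" "C \<in> sets BY" using prob_measuresD(2)[OF R'_prob[OF z a]] by simp_all
      show "emeasure (density (R' (z, a)) (\<lambda>y. \<integral>\<^sup>+x. f x \<partial>H (z, a, y))) C =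
          emeasure (density (R' (z, a)) (\<lambda>y. \<integral>\<^sup>+x. f x \<partial>K (z, a, y))) C"
        using filter_kernel_nn_integral[OF H K z a C(2) f] m[OF H] m[OF K] C(1) by (simp add: emeasure_density)
    qed simp
    then have ae: "AE y in R' (z, a). (\<integral>\<^sup>+x. f x \<partial>H (z, a, y)) = (\<integral>\<^sup>+x. f x \<partial>K (z, a, y))"
      using R'.density_unique_iff[OF m[OF H] m[OF K]] by simp
    have ti: "test_integrals (G (z, a, y)) k = enn2real (\<integral>\<^sup>+x. f x \<partial>G (z, a, y))"
      if G: "filter_kernel (top_of_set X) (top_of_set Y) (top_of_set A) P Q G" and y: "y \<in> Y" for G y
      unfolding test_integrals_def f_def using tm
      by (intro integral_eq_nn_integral) (simp_all add: test_fun_nonneg measurable_cong_sets[OF prob_measuresD(2)[OF filter_kernelD(2)[OF G z a y]] refl])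
    show ?thesis
      using ae by (rule AE_mp, intro AE_I2 impI) (simp add: sp ti[OF H] ti[OF K])
  qed
  then have "AE y in R' (z, a). \<forall>k. test_integrals (H (z, a, y)) k = test_integrals (K (z, a, y)) k"
    by (simp add: AE_all_countable)
  then show ?thesis by (simp add: fun_eq_iff)
qed

section \<open>Continuity of the posterior law for an arbitrary filter\<close>

context
  fixes H
  assumes H: "filter_kernel (top_of_set X) (top_of_set Y) (top_of_set A) P Q H"
begin

abbreviation "qH \<equiv> q_kernel (top_of_set X) (top_of_set Y) P Q H"

lemma filter_section_measurable:
  assumes "z \<in> PX" "a \<in> A"
  shows "(\<lambda>y. H (z, a, y)) \<in> R' (z, a) \<rightarrow>\<^sub>M borel_of WX"
  by (rule measurable_compose[OF observation_section_measurable[OF assms] filter_kernel_measurable[OF H]])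

lemma q_kernel_prob:
  assumes "z \<in> PX" "a \<in> A"
  shows "qH (z, a) \<in> prob_measures WX"
proof -
  interpret R': prob_space "R' (z, a)" by (rule prob_measuresD(1)[OF R'_prob[OF assms]])
  show ?thesis
    using R'.prob_space_distr[OF filter_section_measurable[OF assms]]
    by (simp add: prob_measures_def q_kernel_def)
qed

text \<open>\<open>qH s\<close> gives \<open>D\<close> the \<open>R'\<close>-mass of the section at
  \<open>s\<close> of the preimage of \<open>D\<close> under \<open>H\<close>. Section masses are
  measurable when that preimage is product-measurable, and second countability of \<open>ZA\<close>
  ensures this.\<close>

lemma q_kernel_stochastic: "stochastic_kernel WX ZA qH"
  unfolding stochastic_kernel_def
proof (intro conjI ballI)
  fix s assume "s \<in> topspace ZA"
  then show "qH s \<in> prob_measures WX" using q_kernel_prob by (cases s) auto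
next
  fix D assume D: "D \<in> sets (borel_of WX)"
  have sc: "second_countable ZA"
    by (intro second_countable_prod_topology second_countable_weak_topology second_countable_top_of_set)
  have f: "continuous_map (prod_topology ZA (top_of_set Y)) ZA fst" by (rule continuous_map_fst)
  have "continuous_map (prod_topology ZA (top_of_set Y)) ZAY (\<lambda>w. (fst (fst w), snd (fst w), snd w))"
    by (intro continuous_map_pairedI continuous_map_snd
        continuous_map_compose[OF f continuous_map_fst, unfolded o_def]
        continuous_map_compose[OF f continuous_map_snd, unfolded o_def])
  from measurable_compose[OF measurable_borel_of_continuous_map[OF this] filter_kernel_measurable[OF H]]
  have "(\<lambda>w. H (fst (fst w), snd (fst w), snd w)) \<in> borel_of (prod_topology ZA (top_of_set Y)) \<rightarrow>\<^sub>M borel_of WX" .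
  then have m: "(\<lambda>w. H (fst (fst w), snd (fst w), snd w)) \<in> borel_of ZA \<Otimes>\<^sub>M BY \<rightarrow>\<^sub>M borel_of WX"
    by (simp only: measurable_cong_sets[OF sets_borel_of_prod_topology[OF sc second_countable_top_of_set] refl])
  let ?A = "\<lambda>s. {y \<in> Y. H (fst s, snd s, y) \<in> D}"
  have "(SIGMA s:space (borel_of ZA). ?A s) = (\<lambda>w. H (fst (fst w), snd (fst w), snd w)) -` D \<inter> space (borel_of ZA \<Otimes>\<^sub>M BY)"
    by (auto simp: space_pair_measure)
  then have "(SIGMA s:space (borel_of ZA). ?A s) \<in> sets (borel_of ZA \<Otimes>\<^sub>M BY)"
    using measurable_sets[OF m D] by simp
  from measure_measurable_subprob_algebra2[OF this stochastic_kernel_measurable[OF R'_kernel_stochastic]]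
  have "(\<lambda>s. measure (R' s) (?A s)) \<in> borel_measurable (borel_of ZA)" .
  moreover have "measure (qH s) D = measure (R' s) (?A s)" if sp: "s \<in> space (borel_of ZA)" for s
  proof -
    obtain z a where s: "s = (z, a)" "z \<in> PX" "a \<in> A" using sp by (cases s) auto
    have "(\<lambda>y. H (z, a, y)) -` D \<inter> space (R' (z, a)) = ?A s"
      using prob_measuresD(3)[OF R'_prob[OF s(2,3)]] by (auto simp: s(1))
    then show ?thesis
      using measure_distr[OF filter_section_measurable[OF s(2,3)] D] by (simp add: q_kernel_def s(1))
  qed
  ultimately show "(\<lambda>s. measure (qH s) D) \<in> borel_measurable (borel_of ZA)"
    by (subst measurable_cong) auto
qed

text \<open>\<open>F\<close> sees a measure only through its test integrals, and on these
  \<open>H\<close> agrees with the Bayes filter almost surely. The given filter, about whose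
  convergence nothing is known, is thereby replaced.\<close>

lemma integral_q_kernel:
  assumes z: "z \<in> PX" and a: "a \<in> A" and F: "F \<in> bounded_continuous WX"
  shows "integral\<^sup>L (qH (z, a)) F = (\<integral>y. F (posterior (z, a, y)) \<partial>R' (z, a))"
proof -
  have Fm: "F \<in> borel_measurable (borel_of WX)" by (rule bounded_continuous_measurable[OF F])
  have Fc: "continuous_map WX euclideanreal F" using F by (simp add: bounded_continuous_def)
  have sp: "space (R' (z, a)) = Y" using prob_measuresD(3)[OF R'_prob[OF z a]] by simp
  have pm: "(\<lambda>y. posterior (z, a, y)) \<in> R' (z, a) \<rightarrow>\<^sub>M borel_of WX"
    by (rule measurable_compose[OF observation_section_measurable[OF z a] filter_kernel_measurable[OF posterior_filter_kernel]])
  have "integral\<^sup>L (qH (z, a)) F = (\<integral>y. F (H (z, a, y)) \<partial>R' (z, a))"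
    unfolding q_kernel_def prod.case by (rule integral_distr[OF filter_section_measurable[OF z a] Fm])
  also have "\<dots> = (\<integral>y. F (posterior (z, a, y)) \<partial>R' (z, a))"
  proof (rule integral_cong_AE)
    show "AE y in R' (z, a). F (H (z, a, y)) = F (posterior (z, a, y))"
      using filter_kernel_AE_unique[OF H posterior_filter_kernel z a]
      by (rule AE_mp, intro AE_I2 impI continuous_map_weak_topology_eqI[OF Fc])
        (simp_all add: sp filter_kernelD(2)[OF H] posterior_prob z a)
  qed (use measurable_compose[OF filter_section_measurable[OF z a] Fm] measurable_compose[OF pm Fm] in auto)
  finally show ?thesis .
qed

text \<open>Integrand and observation law both vary, and the integrand need not be continuous in
  \<open>y\<close>. Replacing the law by its limit costs at most \<open>M\<close> times an L1
  distance of evidences, uniformly in the integrand; under the fixed law \<open>R' l\<close>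
  dominated convergence finishes.\<close>

lemma q_kernel_weakly_continuous: "weakly_continuous_kernel WX ZA qH"
  unfolding weakly_continuous_kernel_def kernel_continuous_def weakly_converges_def
proof (intro conjI q_kernel_stochastic allI impI ballI)
  fix s l F assume "(\<forall>n. s n \<in> topspace ZA) \<and> limitin ZA s l sequentially" and F: "F \<in> bounded_continuous WX"
  then have s: "\<forall>n. s n \<in> topspace ZA" "limitin ZA s l sequentially" by auto
  note L = limitin_ZA[OF s]
  have Fc: "continuous_map WX euclideanreal F" using F by (simp add: bounded_continuous_def)
  have Fm: "F \<in> borel_measurable (borel_of WX)" by (rule bounded_continuous_measurable[OF F])
  obtain M where M: "\<And>\<mu>. \<mu> \<in> PX \<Longrightarrow> \<bar>F \<mu>\<bar> \<le> M"
    using F by (auto simp: bounded_continuous_def bounded_iff)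
  define p where "p = (\<lambda>s y. posterior (fst s, snd s, y))"
  have p_prob: "p s y \<in> PX" if "fst s \<in> PX" "snd s \<in> A" "y \<in> Y" for s y
    unfolding p_def using that by (rule posterior_prob)
  have Fp: "(\<lambda>y. F (p s y)) \<in> borel_measurable BY" if "fst s \<in> PX" "snd s \<in> A" for s
  proof -
    have "(\<lambda>y. (fst s, snd s, y)) \<in> BY \<rightarrow>\<^sub>M borel_of ZAY"
      using that by (intro measurable_borel_of_continuous_map continuous_map_pairedI) auto
    from measurable_compose[OF measurable_compose[OF this filter_kernel_measurable[OF posterior_filter_kernel]] Fm]
    show ?thesis by (simp add: p_def)
  qed
  have int: "integral\<^sup>L (qH s) F = (\<integral>y. F (p s y) \<partial>R' s)" if "fst s \<in> PX" "snd s \<in> A" for s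
    using integral_q_kernel[OF that F] by (simp add: p_def)
  have R'l: "R' l \<in> prob_measures (top_of_set Y)" using R'_prob[OF L(3,4)] by simp
  interpret R': prob_space "R' l" by (rule prob_measuresD(1)[OF R'l])
  have spl: "space (R' l) = Y" using prob_measuresD(3)[OF R'l] by simp
  show "(\<lambda>n. integral\<^sup>L (qH (s n)) F) \<longlonglongrightarrow> integral\<^sup>L (qH l) F"
  proof (rule tendsto_if_subsequences)
    fix r :: "nat \<Rightarrow> nat" assume r: "strict_mono r"
    have lim_a: "(\<lambda>k. snd (s (r k))) \<longlonglongrightarrow> snd l" using LIMSEQ_subseq_LIMSEQ[OF L(6) r] by (simp add: o_def)
    obtain r' C where r': "strict_mono (r' :: nat \<Rightarrow> nat)" "C \<in> sets BY" "measure (R' (fst l, snd l)) C = 1"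
      "\<And>y. y \<in> C \<Longrightarrow> weakly_converges (top_of_set X) (\<lambda>k. posterior (fst (s (r (r' k))), snd (s (r (r' k))), y)) (posterior (fst l, snd l, y))"
    proof (rule posterior_converges[OF L(1) L(3) weakly_converges_subseq[OF L(5) r] L(2) L(4) lim_a])
      fix r' :: "nat \<Rightarrow> nat" and C
      assume "strict_mono r'" "C \<in> sets BY" "measure (R' (fst l, snd l)) C = 1"
        "\<And>y. y \<in> C \<Longrightarrow> weakly_converges (top_of_set X) (\<lambda>k. posterior (fst (s (r (r' k))), snd (s (r (r' k))), y)) (posterior (fst l, snd l, y))"
      then show thesis by (rule that)
    qed
    define t where "t k = s (r (r' k))" for k
    have t: "fst (t k) \<in> PX" "snd (t k) \<in> A" for k using L(1,2) by (auto simp: t_def)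
    have rr': "strict_mono (\<lambda>k. r (r' k))" using strict_mono_o[OF r r'(1)] by (simp add: o_def)
    have C: "C \<in> sets (R' l)" "measure (R' l) C = 1" "C \<subseteq> Y"
      using r'(2,3) prob_measuresD(2)[OF R'l] sets.sets_into_space[OF r'(2)] by simp_all
    have "AE y in R' l. y \<in> C" using C by (intro R'.AE_prob_1) auto
    \<comment> \<open>The set \<open>C\<close> supplied by posterior convergence has full mass under
      the limit law, hence the comparison of the varying laws with \<open>R' l\<close>
      below.\<close>
    then have ae: "AE y in R' l. (\<lambda>k. F (p (t k) y)) \<longlonglongrightarrow> F (p l y)"
    proof (rule AE_mp, intro AE_I2 impI)
      fix y assume y: "y \<in> C"
      then have yY: "y \<in> Y" using C(3) by blast
      show "(\<lambda>k. F (p (t k) y)) \<longlonglongrightarrow> F (p l y)"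
        by (rule continuous_map_weak_topology_tendsto[OF Fc p_prob[OF t yY] p_prob[OF L(3,4) yY]])
          (use r'(4)[OF y] in \<open>simp add: p_def t_def\<close>)
    qed
    have lim1: "(\<lambda>k. \<integral>y. F (p (t k) y) \<partial>R' l) \<longlonglongrightarrow> (\<integral>y. F (p l y) \<partial>R' l)"
    proof (rule integral_dominated_convergence[where w="\<lambda>_. M"])
      show "(\<lambda>y. F (p l y)) \<in> borel_measurable (R' l)"
        using Fp[OF L(3,4)] by (subst measurable_cong_sets[OF prob_measuresD(2)[OF R'l] refl])
      show "(\<lambda>y. F (p (t k) y)) \<in> borel_measurable (R' l)" for k
        using Fp[OF t] by (subst measurable_cong_sets[OF prob_measuresD(2)[OF R'l] refl])
      show "AE y in R' l. norm (F (p (t k) y)) \<le> M" for k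
        using M[OF p_prob[OF t]] by (intro AE_I2) (simp add: spl)
    qed (use ae in auto)
    let ?e = "\<lambda>k. \<integral>y. \<bar>evidence (fst (t k)) (snd (t k)) y - evidence (fst l) (snd l) y\<bar> \<partial>\<nu>"
    have "(\<lambda>n. \<integral>y. \<bar>evidence (fst (s n)) (snd (s n)) y - evidence (fst l) (snd l) y\<bar> \<partial>\<nu>) \<longlonglongrightarrow> 0"
      by (rule obs_density_L1_converges[OF L(1,3,5,2,4,6) one_bounded_continuous])
    from LIMSEQ_subseq_LIMSEQ[OF this rr'] have "?e \<longlonglongrightarrow> 0" by (simp add: o_def t_def)
    then have lim2: "(\<lambda>k. M * ?e k) \<longlonglongrightarrow> 0" by (rule tendsto_mult_right_zero)
    have bound: "norm ((\<integral>y. F (p (t k) y) \<partial>R' (t k)) - (\<integral>y. F (p (t k) y) \<partial>R' l)) \<le> M * ?e k" for k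
      using integral_R'_diff_le[OF t[of k] L(3,4) Fp[OF t[of k]], of M] M[OF p_prob[OF t[of k]]] by simp
    have "(\<lambda>k. (\<integral>y. F (p (t k) y) \<partial>R' (t k)) - (\<integral>y. F (p (t k) y) \<partial>R' l)) \<longlonglongrightarrow> 0"
      by (rule Lim_null_comparison[OF always_eventually lim2]) (use bound in blast)
    from tendsto_add[OF this lim1] have "(\<lambda>k. \<integral>y. F (p (t k) y) \<partial>R' (t k)) \<longlonglongrightarrow> (\<integral>y. F (p l y) \<partial>R' l)" by simp
    then have "(\<lambda>k. integral\<^sup>L (qH (s (r (r' k)))) F) \<longlonglongrightarrow> integral\<^sup>L (qH l) F"
      unfolding t_def[symmetric] int[OF t] int[OF L(3,4)] .
    with r'(1) show "\<exists>r'. strict_mono r' \<and> (\<lambda>k. integral\<^sup>L (qH (s (r (r' k)))) F) \<longlonglongrightarrow> integral\<^sup>L (qH l) F"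
      by blast
  qed
qed

end

end

theorem theorem3p7:
  fixes X :: "'x::polish_space set" and Y :: "'y::polish_space set" and A :: "'a::polish_space set"
    and P :: "'x \<times> 'a \<Rightarrow> 'x measure" and Q :: "'a \<times> 'x \<Rightarrow> 'y measure"
  assumes "X \<in> sets borel" and "Y \<in> sets borel" and "A \<in> sets borel"
    and "weakly_continuous_kernel (top_of_set X) (prod_topology (top_of_set X) (top_of_set A)) P"
    and "tv_continuous_kernel (top_of_set Y) (prod_topology (top_of_set A) (top_of_set X)) Q"
  shows "setwise_continuous_kernel (top_of_set Y)
           (prod_topology (weak_topology (top_of_set X)) (top_of_set A))
           (R'_kernel (top_of_set X) (top_of_set Y) P Q) \<and>
         assumption_H (top_of_set X) (top_of_set Y) (top_of_set A) P Q \<and>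
         (\<forall>H. filter_kernel (top_of_set X) (top_of_set Y) (top_of_set A) P Q H \<longrightarrow>
            weakly_continuous_kernel (weak_topology (top_of_set X))
              (prod_topology (weak_topology (top_of_set X)) (top_of_set A))
              (q_kernel (top_of_set X) (top_of_set Y) P Q H))"
proof -
  \<comment> \<open>The joint density is constructed over one metric space, so the product of the
    subspaces is read as the subspace \<open>A \<times> X\<close> of the product.\<close>
  have "tv_continuous_kernel (top_of_set Y) (top_of_set (A \<times> X)) Q"
    using assms(5) by (simp only: top_of_set_Times)
  note joint = tv_continuous_kernel_joint_density[OF this]
  obtain \<nu> :: "'y measure" and q where q: "finite_measure \<nu>" "sets \<nu> = sets (borel_of (top_of_set Y))"
    "case_prod q \<in> borel_measurable (borel_of (top_of_set (A \<times> X)) \<Otimes>\<^sub>M borel_of (top_of_set Y))"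
    "\<And>s y. 0 \<le> q s y" "\<And>s. s \<in> A \<times> X \<Longrightarrow> Q s = density \<nu> (\<lambda>y. ennreal (q s y))"
  proof (rule joint)
    fix \<nu> :: "'y measure" and q
    assume "finite_measure \<nu>" "sets \<nu> = sets (borel_of (top_of_set Y))"
      "case_prod q \<in> borel_measurable (borel_of (top_of_set (A \<times> X)) \<Otimes>\<^sub>M borel_of (top_of_set Y))"
      "\<And>s y. 0 \<le> q s y" "\<And>s. s \<in> A \<times> X \<Longrightarrow> Q s = density \<nu> (\<lambda>y. ennreal (q s y))"
    then show thesis by (rule that)
  qed
  interpret filter_model X Y A P Q \<nu> q
    by (rule filter_model.intro) (use assms(4,5) q in \<open>simp_all only: top_of_set_Times mem_Times_iff fst_conv snd_conv\<close>)
  show ?thesis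
    using R'_setwise_continuous assumption_H q_kernel_weakly_continuous by blast
qed

end
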